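(* Let $q$ be transcendental over $\mathbb{Q}$. Then, as subalgebras of $\mathrm{End}_{\mathbb{Q}(q)}(\underline{V}^{\otimes m})$, $$\Phi\bigl(L_q^{\imath}(\mathfrak{sl}_{2r+4})\bigr)=\mathrm{End}_{\mathfrak{HH}_m}(\underline{V}^{\otimes m}),$$ where $L_q^{\imath}(\mathfrak{sl}_{2r+4})$ is the $\imath$quantum group of Levi type acting on $\underline{V}^{\otimes m}$ via $\Phi$, $\mathfrak{HH}_m$ is the duplex Hecke algebra of type $\mathsf{B}$ acting (on the right) on $\underline{V}^{\otimes m}$ via $\Xi$, and the right-hand side is the algebra of all $\mathbb{Q}(q)$-linear endomorphisms of $\underline{V}^{\otimes m}$ commuting with $\Xi(h)$ for every $h\in\mathfrak{HH}_m$.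
   Context: Fix integers $r\ge 1$ and $m\ge 2$; $q$ is transcendental over $\mathbb{Q}$ and the base field is $\mathbb{Q}(q)$. Index sets: $\mathbb{I}_{2r+1}=\{-r,-r+1,\dots,r\}$, $\mathbb{I}_{2r+3}=\{-r-1,-r,\dots,r+1\}$, $\mathbb{I}_{2r+2}=\{-r-\tfrac12,-r+\tfrac12,\dots,r+\tfrac12\}$, $\mathbb{I}_{2r+4}=\{-r-\tfrac32,-r-\tfrac12,\dots,r+\tfrac32\}$. Quantum group. $\mathbf{U}_q(\mathfrak{sl}_{2r+4})$ is the usual quantum group over $\mathbb{Q}(q)$ with generators $E_i,F_i,K_i^{\pm1}$ indexed by $i\in\mathbb{I}_{2r+3}$: the $K_i$ commute, $K_iE_jK_i^{-1}=q^{c_{ij}}E_j$, $K_iF_jK_i^{-1}=q^{-c_{ij}}F_j$, $E_iF_j-F_jE_i=\delta_{ij}\frac{K_i-K_i^{-1}}{q-q^{-1}}$, and the quantum Serre relations, where $c_{ii}=2$, $c_{ij}=-1$ if $|i-j|=1$, and $c_{ij}=0$ if $|i-j|>1$. Comultiplication: $\Delta(K_i)=K_i\otimes K_i$, $\Delta(E_i)=1\otimes E_i+E_i\otimes K_i^{-1}$, $\Delta(F_i)=F_i\otimes 1+K_i\otimes F_i$. $\imath$quantum group of Levi type. In $\mathbf{U}_q(\mathfrak{sl}_{2r+4})$ put $k_i=K_iK_{-i}^{-1}$ ($i\in\mathbb{I}_{2r+3}$), $B_i=E_i+F_{-i}K_i^{-1}$ ($i\ne 0$), $B_0=E_0+qF_0K_0^{-1}+K_0^{-1}$.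 The $\imath$quantum group $\mathbf{U}_q^{\imath}(\mathfrak{sl}_{2r+4})$ is the $\mathbb{Q}(q)$-subalgebra generated by all $k_i,B_i$ with $i\in\mathbb{I}_{2r+3}$, and $L_q^{\imath}(\mathfrak{sl}_{2r+4})$ is its subalgebra generated by $k_i$ ($i\in\mathbb{I}_{2r+3}$) and $B_i$ ($i\in\mathbb{I}_{2r+1}$). Representation $\Phi$. $\underline{V}$ is the $\mathbb{Q}(q)$-space with basis $\{\eta_j: j\in\mathbb{I}_{2r+4}\}$, and $V\subset\underline{V}$ is the span of $\{\eta_j: j\in\mathbb{I}_{2r+2}\}$. $\mathbf{U}_q(\mathfrak{sl}_{2r+4})$ acts on $\underline{V}$ by $F_i\eta_{i-1/2}=\eta_{i+1/2}$, $F_i\eta_j=0$ for $j\neq i-\tfrac12$; $E_i\eta_{i+1/2}=\eta_{i-1/2}$, $E_i\eta_j=0$ for $j\ne i+\tfrac12$; $K_i\eta_{i-1/2}=q\eta_{i-1/2}$, $K_i\eta_{i+1/2}=q^{-1}\eta_{i+1/2}$, $K_i\eta_j=\eta_j$ for $j\neq i\pm\tfrac12$. It acts on $\underline{V}^{\otimes m}$ through the iterated comultiplication $\Delta^m=(\Delta\otimes\mathrm{id}^{\otimes m-2})\circ\cdots\circ(\Delta\otimes\mathrm{id})\circ\Delta$. $\Phi$ denotes this action and its restriction to $L_q^{\imath}(\mathfrak{sl}_{2r+4})$. Hecke algebra and its right action. $\mathcal{H}(\mathsf{B}_l)$ is the $\mathbb{Q}(q)$-algebra generated by $H_0,\dots,H_{l-1}$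 with relations $(H_i-q^{-1})(H_i+q)=0$; $H_iH_{i+1}H_i=H_{i+1}H_iH_{i+1}$ for $1\le i\le l-2$; $H_iH_j=H_jH_i$ for $|i-j|>1$; $H_0H_1H_0H_1=H_1H_0H_1H_0$ (with $\mathcal{H}(\mathsf{B}_0)=\mathbb{Q}(q)$). For $\sigma\in\mathfrak{S}_l=\langle s_1,\dots,s_{l-1}\rangle$ with reduced expression $s_{i_1}\cdots s_{i_k}$, $H_\sigma=H_{i_1}\cdots H_{i_k}$. For $f=(f(1),\dots,f(m))\in\mathbb{I}_{2r+4}^m$ put $M_f=\eta_{f(1)}\otimes\cdots\otimes\eta_{f(m)}$; $fs_i$ ($i\ge1$) is $f$ with entries $i,i+1$ swapped, and $fs_0=(-f(1),f(2),\dots,f(m))$. $\mathcal{H}(\mathsf{B}_m)$ acts on $\underline{V}^{\otimes m}$ on the right (action $\Psi$) by: for $i\ge1$, $M_fH_i=q^{-1}M_f$ if $f(i)=f(i+1)$, $M_fH_i=M_{fs_i}$ if $f(i)<f(i+1)$, $M_fH_i=M_{fs_i}+(q^{-1}-q)M_f$ if $f(i)>f(i+1)$; $M_fH_0=M_{fs_0}$ if $f(1)>0$, and $M_fH_0=M_{fs_0}+(q^{-1}-q)M_f$ if $f(1)<0$. By the same formulas $\mathcal{H}(\mathsf{B}_l)$ acts on the right on $V^{\otimes l}$; this action is denoted $\Psi_l^V$. We write $\Psi(h)$, $\Psi_l^V(h)$ for the corresponding operators (so $\Psi,\Psi^V_l$ are anti-homomorphisms). Duplex Hecke algebra. $\mathfrak{HH}_m$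 is the $\mathbb{Q}(q)$-algebra generated by $T_0,\dots,T_{m-1}$ and $x_\sigma^{(l)}$ ($0\le l\le m$, $\sigma\in\mathfrak{S}_l$, with $\mathfrak{S}_0=\mathfrak{S}_1$ trivial) with relations: the $T_i$ satisfy the relations of the generators $H_i$ of $\mathcal{H}(\mathsf{B}_m)$; for $0<i<l$, with $\ell$ the length function, $x_\sigma^{(l)}x_{s_i}^{(l)}=x_{\sigma s_i}^{(l)}$ if $\ell(\sigma s_i)=\ell(\sigma)+1$ and $=x_{\sigma s_i}^{(l)}+(q^{-1}-q)x_\sigma^{(l)}$ if $\ell(\sigma s_i)=\ell(\sigma)-1$; $x_{s_i}^{(l)}x_\sigma^{(l)}=x_{s_i\sigma}^{(l)}$ if $\ell(s_i\sigma)=\ell(\sigma)+1$ and $=x_{s_i\sigma}^{(l)}+(q^{-1}-q)x_\sigma^{(l)}$ if $\ell(s_i\sigma)=\ell(\sigma)-1$; $x_\sigma^{(l)}x_\gamma^{(k)}=0$ for $l\ne k$; $T_ix_\sigma^{(l)}=x_{s_i}^{(l)}x_\sigma^{(l)}$ and $x_\sigma^{(l)}T_i=x_\sigma^{(l)}x_{s_i}^{(l)}$ for $0<i<l$; $T_ix_\sigma^{(l)}=q^{-1}x_\sigma^{(l)}=x_\sigma^{(l)}T_i$ for $i>l$. Representation $\Xi$. Let $\underline{V}_{\underline{l},\emptyset}^{\otimes m}=V^{\otimes l}\otimes\eta_{r+3/2}^{\otimes m-l}$. $\Xi:\mathfrak{HH}_m\to\mathrm{End}(\underline{V}^{\otimes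 m})$ is the unique algebra anti-homomorphism with $\Xi(T_i)=\Psi(H_i)$, $\Xi(x_\sigma^{(l)})|_{\underline{V}_{\underline{l},\emptyset}^{\otimes m}}=\Psi_l^V(H_\sigma)\otimes\mathrm{id}^{\otimes m-l}$, and $\Xi(x_\sigma^{(l)})(M_f)=0$ for $M_f\notin\underline{V}_{\underline{l},\emptyset}^{\otimes m}$. *)

theory Defs
  imports
    "HOL-Library.Poly_Mapping"
    "HOL-Library.Product_Plus"
    "HOL-Library.FuncSet"
    "HOL-Combinatorics.Permutations"
    "HOL-Computational_Algebra.Polynomial"
    "HOL-Algebra.QuotRing"
    "HOL-Algebra.Generated_Rings"
begin

section \<open>Free algebras, presented algebras\<close>

text \<open>
  Words form a monoid under concatenation, so the convolution product of
  \<^theory>\<open>HOL-Library.Poly_Mapping\<close> makes \<open>'g list \<Rightarrow>\<^sub>0 'k\<close> the free associative algebra on \<open>'g\<close>,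
  and \<open>('g list \<times> 'g list) \<Rightarrow>\<^sub>0 'k\<close> its tensor square.  The same type, on letters \<open>j\<close> standing
  for basis vectors \<open>\<eta>\<^sub>j\<close>, is the tensor algebra of the space spanned by the \<open>\<eta>\<^sub>j\<close>: there
  the product is the tensor product of vectors.
\<close>

instantiation list :: (type) monoid_add
begin
definition zero_list :: "'a list" where "zero_list = []"
definition plus_list :: "'a list \<Rightarrow> 'a list \<Rightarrow> 'a list" where "plus_list xs ys = xs @ ys"
instance by standard (simp_all add: zero_list_def plus_list_def)
end

definition cst :: "'k::comm_ring_1 \<Rightarrow> ('b::monoid_add \<Rightarrow>\<^sub>0 'k)" where
  "cst c = Poly_Mapping.single 0 c"

definition bas :: "'b \<Rightarrow> ('b \<Rightarrow>\<^sub>0 'k::comm_ring_1)" where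
  "bas b = Poly_Mapping.single b 1"

definition gen :: "'g \<Rightarrow> ('g list \<Rightarrow>\<^sub>0 'k::comm_ring_1)" where
  "gen g = bas [g]"

text \<open>The linear map with values \<open>u b\<close> on the basis.\<close>

definition lin :: "('b \<Rightarrow> ('c::monoid_add \<Rightarrow>\<^sub>0 'k)) \<Rightarrow> ('b \<Rightarrow>\<^sub>0 'k::comm_ring_1) \<Rightarrow> ('c \<Rightarrow>\<^sub>0 'k)" where
  "lin u v = (\<Sum>b\<in>Poly_Mapping.keys v. cst (Poly_Mapping.lookup v b) * u b)"

definition free_algebra :: "'g set \<Rightarrow> ('g list \<Rightarrow>\<^sub>0 'k::comm_ring_1) ring" where
  "free_algebra S = \<lparr>carrier = {p. \<forall>w\<in>Poly_Mapping.keys p. set w \<subseteq> S},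
     mult = (*), one = 1, zero = 0, add = (+)\<rparr>"

definition presented_algebra ::
    "'g set \<Rightarrow> ('g list \<Rightarrow>\<^sub>0 'k::comm_ring_1) set \<Rightarrow> ('g list \<Rightarrow>\<^sub>0 'k) set ring" where
  "presented_algebra S R = free_algebra S Quot genideal (free_algebra S) R"

definition cls ::
    "'g set \<Rightarrow> ('g list \<Rightarrow>\<^sub>0 'k::comm_ring_1) set \<Rightarrow> ('g list \<Rightarrow>\<^sub>0 'k) \<Rightarrow> ('g list \<Rightarrow>\<^sub>0 'k) set" where
  "cls S R p = genideal (free_algebra S) R +>\<^bsub>free_algebra S\<^esub> p"

text \<open>
  The unital subalgebra generated by the classes of the elements of \<open>X\<close>: the subring generated
  by these together with all scalars.
\<close>

definition generated_subalgebra ::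
    "'g set \<Rightarrow> ('g list \<Rightarrow>\<^sub>0 'k::comm_ring_1) set \<Rightarrow> ('g list \<Rightarrow>\<^sub>0 'k) set \<Rightarrow> ('g list \<Rightarrow>\<^sub>0 'k) set set" where
  "generated_subalgebra S R X =
     generate_ring (presented_algebra S R) (cls S R ` (range cst \<union> X))"

text \<open>
  Operators \<open>op g\<close> attached to the letters give a homomorphism (\<open>left_act\<close>) and an
  anti-homomorphism (\<open>right_act\<close>) from the free algebra to linear operators.
\<close>

definition left_act :: "('g \<Rightarrow> ('c::monoid_add \<Rightarrow>\<^sub>0 'k) \<Rightarrow> ('c \<Rightarrow>\<^sub>0 'k)) \<Rightarrow>
    ('g list \<Rightarrow>\<^sub>0 'k::comm_ring_1) \<Rightarrow> ('c \<Rightarrow>\<^sub>0 'k) \<Rightarrow> ('c \<Rightarrow>\<^sub>0 'k)" where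
  "left_act op p v = lin (\<lambda>w. foldr op w v) p"

definition right_act :: "('g \<Rightarrow> ('c::monoid_add \<Rightarrow>\<^sub>0 'k) \<Rightarrow> ('c \<Rightarrow>\<^sub>0 'k)) \<Rightarrow>
    ('g list \<Rightarrow>\<^sub>0 'k::comm_ring_1) \<Rightarrow> ('c \<Rightarrow>\<^sub>0 'k) \<Rightarrow> ('c \<Rightarrow>\<^sub>0 'k)" where
  "right_act op p v = lin (\<lambda>w. fold op w v) p"

text \<open>
  The map on cosets induced by a map \<open>\<rho>\<close> from the free algebra to operators on \<open>W\<close> that is
  constant on each coset.
\<close>

definition induced :: "'v set \<Rightarrow> ('p \<Rightarrow> 'v \<Rightarrow> 'v) \<Rightarrow> 'p set \<Rightarrow> ('v \<Rightarrow> 'v)" where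
  "induced W \<rho> X = the_elem ((\<lambda>p. restrict (\<rho> p) W) ` X)"


section \<open>Tensor space\<close>

text \<open>\<open>half_idx N\<close> is \<open>{-(N-1)/2, -(N-1)/2 + 1, \<dots>, (N-1)/2}\<close>; it is used for even \<open>N\<close> only.\<close>

definition half_idx :: "nat \<Rightarrow> rat set" where
  "half_idx N = (\<lambda>k. of_nat k - (of_nat N - 1) / 2) ` {..<N}"

text \<open>
  The \<open>n\<close>-th tensor power of the space with basis \<open>\<eta>\<^sub>j\<close>, \<open>j \<in> half_idx N\<close>.
  The basis vector \<open>M\<^sub>f\<close> is \<^term>\<open>bas f\<close>; the entry \<open>f(i)\<close> is \<open>f ! (i - 1)\<close>.
\<close>

definition tensor_space :: "nat \<Rightarrow> nat \<Rightarrow> (rat list \<Rightarrow>\<^sub>0 'k::comm_ring_1) set" where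
  "tensor_space N n = {v. \<forall>f\<in>Poly_Mapping.keys v. length f = n \<and> set f \<subseteq> half_idx N}"

definition tensor_End ::
    "nat \<Rightarrow> nat \<Rightarrow> ((rat list \<Rightarrow>\<^sub>0 'k::comm_ring_1) \<Rightarrow> (rat list \<Rightarrow>\<^sub>0 'k)) set" where
  "tensor_End N n = {A \<in> tensor_space N n \<rightarrow>\<^sub>E tensor_space N n.
     (\<forall>v\<in>tensor_space N n. \<forall>w\<in>tensor_space N n. A (v + w) = A v + A w) \<and>
     (\<forall>c. \<forall>v\<in>tensor_space N n. A (cst c * v) = cst c * A v)}"

text \<open>\<open>A \<otimes> B\<close> for an operator \<open>A\<close> on the first \<open>n\<close> tensor factors and \<open>B\<close> on the remaining ones.\<close>

definition op_tensor :: "nat \<Rightarrow> ((rat list \<Rightarrow>\<^sub>0 'k) \<Rightarrow> (rat list \<Rightarrow>\<^sub>0 'k)) \<Rightarrow>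
    ((rat list \<Rightarrow>\<^sub>0 'k) \<Rightarrow> (rat list \<Rightarrow>\<^sub>0 'k)) \<Rightarrow>
    (rat list \<Rightarrow>\<^sub>0 'k::comm_ring_1) \<Rightarrow> (rat list \<Rightarrow>\<^sub>0 'k)" where
  "op_tensor n A B = lin (\<lambda>f. A (bas (take n f)) * B (bas (drop n f)))"


section \<open>The quantum group and its action on tensor space\<close>

datatype uq_gen = GenE int | GenF int | GenK int | GenKinv int

abbreviation UE :: "int \<Rightarrow> (uq_gen list \<Rightarrow>\<^sub>0 'k::comm_ring_1)" where "UE i \<equiv> gen (GenE i)"
abbreviation UF :: "int \<Rightarrow> (uq_gen list \<Rightarrow>\<^sub>0 'k::comm_ring_1)" where "UF i \<equiv> gen (GenF i)"
abbreviation UK :: "int \<Rightarrow> (uq_gen list \<Rightarrow>\<^sub>0 'k::comm_ring_1)" where "UK i \<equiv> gen (GenK i)"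
abbreviation UKinv :: "int \<Rightarrow> (uq_gen list \<Rightarrow>\<^sub>0 'k::comm_ring_1)" where "UKinv i \<equiv> gen (GenKinv i)"

definition int_idx :: "nat \<Rightarrow> int set" where
  "int_idx s = {- int s..int s}"

definition uq_gens :: "nat \<Rightarrow> uq_gen set" where
  "uq_gens r = (\<Union>i\<in>int_idx (r + 1). {GenE i, GenF i, GenK i, GenKinv i})"

definition cartan :: "int \<Rightarrow> int \<Rightarrow> int" where
  "cartan i j = (if i = j then 2 else if \<bar>i - j\<bar> = 1 then -1 else 0)"

definition serre :: "'k::field \<Rightarrow> (int \<Rightarrow> (uq_gen list \<Rightarrow>\<^sub>0 'k)) \<Rightarrow> int set \<Rightarrow> (uq_gen list \<Rightarrow>\<^sub>0 'k) set" where
  "serre q X I =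
     {X i * X i * X j - cst (q + inverse q) * (X i * X j * X i) + X j * X i * X i
        | i j. i \<in> I \<and> j \<in> I \<and> \<bar>i - j\<bar> = 1} \<union>
     {X i * X j - X j * X i | i j. i \<in> I \<and> j \<in> I \<and> \<bar>i - j\<bar> > 1}"

definition uq_rels :: "'k::field \<Rightarrow> nat \<Rightarrow> (uq_gen list \<Rightarrow>\<^sub>0 'k) set" where
  "uq_rels q r = (let I = int_idx (r + 1) in
     {UK i * UKinv i - 1 | i. i \<in> I} \<union>
     {UKinv i * UK i - 1 | i. i \<in> I} \<union>
     {UK i * UK j - UK j * UK i | i j. i \<in> I \<and> j \<in> I} \<union>
     {UK i * UE j * UKinv i - cst (q powi cartan i j) * UE j | i j. i \<in> I \<and> j \<in> I} \<union>
     {UK i * UF j * UKinv i - cst (q powi (- cartan i j)) * UF j | i j. i \<in> I \<and> j \<in> I} \<union>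
     {UE i * UF j - UF j * UE i -
        (if i = j then cst (inverse (q - inverse q)) * (UK i - UKinv i) else 0)
        | i j. i \<in> I \<and> j \<in> I} \<union>
     serre q UE I \<union> serre q UF I)"

definition uq :: "'k::field \<Rightarrow> nat \<Rightarrow> (uq_gen list \<Rightarrow>\<^sub>0 'k) set ring" where
  "uq q r = presented_algebra (uq_gens r) (uq_rels q r)"

text \<open>Representatives in the free algebra of \<open>k\<^sub>i\<close> and \<open>B\<^sub>i\<close>.\<close>

definition iq_k :: "int \<Rightarrow> (uq_gen list \<Rightarrow>\<^sub>0 'k::field)" where
  "iq_k i = UK i * UKinv (- i)"

definition iq_B :: "'k::field \<Rightarrow> int \<Rightarrow> (uq_gen list \<Rightarrow>\<^sub>0 'k)" where
  "iq_B q i = (if i = 0 then UE 0 + cst q * UF 0 * UKinv 0 + UKinv 0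
               else UE i + UF (- i) * UKinv i)"

definition iquantum_group :: "'k::field \<Rightarrow> nat \<Rightarrow> (uq_gen list \<Rightarrow>\<^sub>0 'k) set set" where
  "iquantum_group q r = generated_subalgebra (uq_gens r) (uq_rels q r)
     (iq_k ` int_idx (r + 1) \<union> iq_B q ` int_idx (r + 1))"

definition levi_iquantum_group :: "'k::field \<Rightarrow> nat \<Rightarrow> (uq_gen list \<Rightarrow>\<^sub>0 'k) set set" where
  "levi_iquantum_group q r = generated_subalgebra (uq_gens r) (uq_rels q r)
     (iq_k ` int_idx (r + 1) \<union> iq_B q ` int_idx r)"

lemma levi_subset_iquantum_group: "levi_iquantum_group q r \<subseteq> iquantum_group q r"
proof
  fix x assume "x \<in> levi_iquantum_group q r"
  then show "x \<in> iquantum_group q r"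
    unfolding levi_iquantum_group_def iquantum_group_def generated_subalgebra_def
    by induct (auto intro: generate_ring.intros simp: int_idx_def)
qed

text \<open>The comultiplication, as an algebra homomorphism from the free algebra to its tensor square.\<close>

fun comult_gen :: "uq_gen \<Rightarrow> ((uq_gen list \<times> uq_gen list) \<Rightarrow>\<^sub>0 'k::comm_ring_1)" where
  "comult_gen (GenE i) = bas ([], [GenE i]) + bas ([GenE i], [GenKinv i])"
| "comult_gen (GenF i) = bas ([GenF i], []) + bas ([GenK i], [GenF i])"
| "comult_gen (GenK i) = bas ([GenK i], [GenK i])"
| "comult_gen (GenKinv i) = bas ([GenKinv i], [GenKinv i])"

definition comult :: "(uq_gen list \<Rightarrow>\<^sub>0 'k::comm_ring_1) \<Rightarrow> ((uq_gen list \<times> uq_gen list) \<Rightarrow>\<^sub>0 'k)" where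
  "comult = lin (\<lambda>w. prod_list (map comult_gen w))"

text \<open>The natural representation, on words of length one.\<close>

fun nat_rep_basis :: "'k::field \<Rightarrow> uq_gen \<Rightarrow> rat \<Rightarrow> (rat list \<Rightarrow>\<^sub>0 'k)" where
  "nat_rep_basis q (GenE i) j = (if j = of_int i + 1/2 then gen (of_int i - 1/2) else 0)"
| "nat_rep_basis q (GenF i) j = (if j = of_int i - 1/2 then gen (of_int i + 1/2) else 0)"
| "nat_rep_basis q (GenK i) j =
     cst (if j = of_int i - 1/2 then q else if j = of_int i + 1/2 then inverse q else 1) * gen j"
| "nat_rep_basis q (GenKinv i) j =
     cst (if j = of_int i - 1/2 then inverse q else if j = of_int i + 1/2 then q else 1) * gen j"

definition nat_rep :: "'k::field \<Rightarrow> (uq_gen list \<Rightarrow>\<^sub>0 'k) \<Rightarrow> (rat list \<Rightarrow>\<^sub>0 'k) \<Rightarrow> (rat list \<Rightarrow>\<^sub>0 'k)" where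
  "nat_rep q = left_act (\<lambda>g. lin (\<lambda>f. nat_rep_basis q g (hd f)))"

text \<open>
  The action of \<open>p\<close> on the tensor power with \<open>n + 1\<close> factors through the iterated
  comultiplication, using \<open>\<Delta>\<^sup>n\<^sup>+\<^sup>1 = (\<Delta>\<^sup>n \<otimes> id) \<circ> \<Delta>\<close>.
\<close>

primrec tensor_rep :: "'k::field \<Rightarrow> nat \<Rightarrow> (uq_gen list \<Rightarrow>\<^sub>0 'k) \<Rightarrow>
    (rat list \<Rightarrow>\<^sub>0 'k) \<Rightarrow> (rat list \<Rightarrow>\<^sub>0 'k)" where
  "tensor_rep q 0 p v = nat_rep q p v"
| "tensor_rep q (Suc n) p v =
     lin (\<lambda>(a, b). op_tensor (Suc n) (tensor_rep q n (bas a)) (nat_rep q (bas b)) v) (comult p)"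

definition Phi :: "'k::field \<Rightarrow> nat \<Rightarrow> nat \<Rightarrow> (uq_gen list \<Rightarrow>\<^sub>0 'k) set \<Rightarrow>
    (rat list \<Rightarrow>\<^sub>0 'k) \<Rightarrow> (rat list \<Rightarrow>\<^sub>0 'k)" where
  "Phi q r m = induced (tensor_space (2*r + 4) m) (tensor_rep q (m - 1))"


section \<open>The Hecke algebra of type B and its right action\<close>

text \<open>The relations between elements \<open>h 0, \<dots>, h (l - 1)\<close> of a free algebra.\<close>

definition hecke_rels_for :: "'k::field \<Rightarrow> nat \<Rightarrow> (nat \<Rightarrow> ('g list \<Rightarrow>\<^sub>0 'k)) \<Rightarrow> ('g list \<Rightarrow>\<^sub>0 'k) set" where
  "hecke_rels_for q l h =
     {(h i - cst (inverse q)) * (h i + cst q) | i. i < l} \<union>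
     {h i * h (i+1) * h i - h (i+1) * h i * h (i+1) | i. 1 \<le> i \<and> i + 1 < l} \<union>
     {h i * h j - h j * h i | i j. i < l \<and> j < l \<and> \<bar>int i - int j\<bar> > 1} \<union>
     (if 2 \<le> l then {h 0 * h 1 * h 0 * h 1 - h 1 * h 0 * h 1 * h 0} else {})"

definition hecke_cls :: "'k::field \<Rightarrow> nat \<Rightarrow> (nat list \<Rightarrow>\<^sub>0 'k) \<Rightarrow> (nat list \<Rightarrow>\<^sub>0 'k) set" where
  "hecke_cls q l = cls {..<l} (hecke_rels_for q l gen)"

text \<open>
  The symmetric group on \<open>l\<close> letters consists of the permutations of \<open>{1..l}\<close>, with
  composition as product and \<open>s\<^sub>i\<close> swapping \<open>i\<close> and \<open>i + 1\<close>, where \<open>0 < i < l\<close>.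
\<close>

definition simple_refl :: "nat \<Rightarrow> nat \<Rightarrow> nat" where
  "simple_refl i = Transposition.transpose i (i + 1)"

definition refl_word :: "nat list \<Rightarrow> nat \<Rightarrow> nat" where
  "refl_word is = foldr (\<lambda>i. (\<circ>) (simple_refl i)) is id"

definition cox_length :: "nat \<Rightarrow> (nat \<Rightarrow> nat) \<Rightarrow> nat" where
  "cox_length l \<sigma> = (LEAST n. \<exists>is. length is = n \<and> set is \<subseteq> {1..<l} \<and> refl_word is = \<sigma>)"

definition reduced_expr :: "nat \<Rightarrow> (nat \<Rightarrow> nat) \<Rightarrow> nat list \<Rightarrow> bool" where
  "reduced_expr l \<sigma> is \<longleftrightarrow>
     set is \<subseteq> {1..<l} \<and> refl_word is = \<sigma> \<and> length is = cox_length l \<sigma>"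

text \<open>\<open>H\<^sub>\<sigma>\<close>, independent of the choice of the reduced expression.\<close>

definition hecke_elt :: "'k::field \<Rightarrow> nat \<Rightarrow> (nat \<Rightarrow> nat) \<Rightarrow> (nat list \<Rightarrow>\<^sub>0 'k) set" where
  "hecke_elt q l \<sigma> = hecke_cls q l (bas (SOME is. reduced_expr l \<sigma> is))"

definition hecke_op_basis :: "'k::field \<Rightarrow> nat \<Rightarrow> rat list \<Rightarrow> (rat list \<Rightarrow>\<^sub>0 'k)" where
  "hecke_op_basis q i f =
     (if i = 0 then
        (let f' = f[0 := - (f ! 0)] in
         if f ! 0 > 0 then bas f' else bas f' + cst (inverse q - q) * bas f)
      else
        (let a = f ! (i - 1); b = f ! i; f' = f[i - 1 := b, i := a] in
         if a = b then cst (inverse q) * bas f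
         else if a < b then bas f'
         else bas f' + cst (inverse q - q) * bas f))"

text \<open>The right action of the type \<open>B\<^sub>l\<close> Hecke algebra on the \<open>l\<close>-th tensor power for \<open>half_idx N\<close>.\<close>

definition Psi :: "'k::field \<Rightarrow> nat \<Rightarrow> nat \<Rightarrow> (nat list \<Rightarrow>\<^sub>0 'k) set \<Rightarrow>
    (rat list \<Rightarrow>\<^sub>0 'k) \<Rightarrow> (rat list \<Rightarrow>\<^sub>0 'k)" where
  "Psi q N l = induced (tensor_space N l) (right_act (\<lambda>i. lin (hecke_op_basis q i)))"


section \<open>The duplex Hecke algebra of type B and its right action\<close>

datatype hh_gen = GenT nat | GenX nat "nat \<Rightarrow> nat"

abbreviation HT :: "nat \<Rightarrow> (hh_gen list \<Rightarrow>\<^sub>0 'k::comm_ring_1)" where "HT i \<equiv> gen (GenT i)"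
abbreviation HX :: "nat \<Rightarrow> (nat \<Rightarrow> nat) \<Rightarrow> (hh_gen list \<Rightarrow>\<^sub>0 'k::comm_ring_1)" where
  "HX l \<sigma> \<equiv> gen (GenX l \<sigma>)"

definition hh_gens :: "nat \<Rightarrow> hh_gen set" where
  "hh_gens m = GenT ` {..<m} \<union> {GenX l \<sigma> | l \<sigma>. l \<le> m \<and> \<sigma> permutes {1..l}}"

definition hh_rels :: "'k::field \<Rightarrow> nat \<Rightarrow> (hh_gen list \<Rightarrow>\<^sub>0 'k) set" where
  "hh_rels q m =
     hecke_rels_for q m HT \<union>
     {HX l \<sigma> * HX l (simple_refl i) - HX l (\<sigma> \<circ> simple_refl i) | l \<sigma> i.
        l \<le> m \<and> \<sigma> permutes {1..l} \<and> 0 < i \<and> i < l \<and>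
        cox_length l (\<sigma> \<circ> simple_refl i) = cox_length l \<sigma> + 1} \<union>
     {HX l \<sigma> * HX l (simple_refl i)
        - (HX l (\<sigma> \<circ> simple_refl i) + cst (inverse q - q) * HX l \<sigma>) | l \<sigma> i.
        l \<le> m \<and> \<sigma> permutes {1..l} \<and> 0 < i \<and> i < l \<and>
        cox_length l (\<sigma> \<circ> simple_refl i) + 1 = cox_length l \<sigma>} \<union>
     {HX l (simple_refl i) * HX l \<sigma> - HX l (simple_refl i \<circ> \<sigma>) | l \<sigma> i.
        l \<le> m \<and> \<sigma> permutes {1..l} \<and> 0 < i \<and> i < l \<and>
        cox_length l (simple_refl i \<circ> \<sigma>) = cox_length l \<sigma> + 1} \<union>
     {HX l (simple_refl i) * HX l \<sigma>
        - (HX l (simple_refl i \<circ> \<sigma>) + cst (inverse q - q) * HX l \<sigma>) | l \<sigma> i.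
        l \<le> m \<and> \<sigma> permutes {1..l} \<and> 0 < i \<and> i < l \<and>
        cox_length l (simple_refl i \<circ> \<sigma>) + 1 = cox_length l \<sigma>} \<union>
     {HX l \<sigma> * HX k \<gamma> | l \<sigma> k \<gamma>.
        l \<le> m \<and> \<sigma> permutes {1..l} \<and> k \<le> m \<and> \<gamma> permutes {1..k} \<and> l \<noteq> k} \<union>
     {HT i * HX l \<sigma> - HX l (simple_refl i) * HX l \<sigma> | l \<sigma> i.
        l \<le> m \<and> \<sigma> permutes {1..l} \<and> 0 < i \<and> i < l} \<union>
     {HX l \<sigma> * HT i - HX l \<sigma> * HX l (simple_refl i) | l \<sigma> i.
        l \<le> m \<and> \<sigma> permutes {1..l} \<and> 0 < i \<and> i < l} \<union>
     {HT i * HX l \<sigma> - cst (inverse q) * HX l \<sigma> | l \<sigma> i.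
        l \<le> m \<and> \<sigma> permutes {1..l} \<and> l < i \<and> i < m} \<union>
     {HX l \<sigma> * HT i - cst (inverse q) * HX l \<sigma> | l \<sigma> i.
        l \<le> m \<and> \<sigma> permutes {1..l} \<and> l < i \<and> i < m}"

definition duplex_hecke :: "'k::field \<Rightarrow> nat \<Rightarrow> (hh_gen list \<Rightarrow>\<^sub>0 'k) set ring" where
  "duplex_hecke q m = presented_algebra (hh_gens m) (hh_rels q m)"

fun hh_op :: "'k::field \<Rightarrow> nat \<Rightarrow> nat \<Rightarrow> hh_gen \<Rightarrow> (rat list \<Rightarrow>\<^sub>0 'k) \<Rightarrow> (rat list \<Rightarrow>\<^sub>0 'k)" where
  "hh_op q r m (GenT i) = Psi q (2*r + 4) m (hecke_cls q m (gen i))"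
| "hh_op q r m (GenX l \<sigma>) = lin (\<lambda>f.
     if set (take l f) \<subseteq> half_idx (2*r + 2) \<and> drop l f = replicate (m - l) (of_nat r + 3/2)
     then Psi q (2*r + 2) l (hecke_elt q l \<sigma>) (bas (take l f)) * bas (drop l f)
     else 0)"

definition Xi :: "'k::field \<Rightarrow> nat \<Rightarrow> nat \<Rightarrow> (hh_gen list \<Rightarrow>\<^sub>0 'k) set \<Rightarrow>
    (rat list \<Rightarrow>\<^sub>0 'k) \<Rightarrow> (rat list \<Rightarrow>\<^sub>0 'k)" where
  "Xi q r m = induced (tensor_space (2*r + 4) m) (right_act (hh_op q r m))"

definition End_duplex_hecke ::
    "'k::field \<Rightarrow> nat \<Rightarrow> nat \<Rightarrow> ((rat list \<Rightarrow>\<^sub>0 'k) \<Rightarrow> (rat list \<Rightarrow>\<^sub>0 'k)) set" where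
  "End_duplex_hecke q r m = {A \<in> tensor_End (2*r + 4) m.
     \<forall>h\<in>carrier (duplex_hecke q m). \<forall>v\<in>tensor_space (2*r + 4) m.
       A (Xi q r m h v) = Xi q r m h (A v)}"

end

theory Submission
  imports Defs
begin

text \<open>
  Both algebras are presented by generators and relations, so it suffices to know their generators
  as operators on tensor space.  The operators of the Levi subalgebra commute with those of the
  duplex Hecke algebra because this holds for the generators.

  For the converse, \<open>q\<close> is specialized to \<open>1\<close>.  Each orbit sum of matrix units in the commutant at
  \<open>q = 1\<close> is the specialization of an operator from the Levi subalgebra: there the generators become
  the primitive operators \<open>\<Delta>(X)\<close> for matrices \<open>X\<close> commuting with \<open>j \<mapsto> -j\<close>, and products of these yield
  all symmetrized tensors.  The form \<open>\<Sum> a\<^sub>g\<^sub>f b\<^sub>g\<^sub>f\<close> on matrices is anisotropic over \<open>\<rat>(q)\<close>, so an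
  element of the commutant has an orthogonal projection onto the span of these lifts.  If the
  difference were nonzero, it could be rescaled to specialize at \<open>q = 1\<close> to a nonzero element of the
  commutant there that is orthogonal to all orbit sums, which is absurd.
\<close>

subsection \<open>Linear operators\<close>

text \<open>Operators are taken on the free module over all words, so that a defining relation
  becomes an identity in one ring of operators. Off the tensor space each generator then needs a
  value that respects the relations, and a one-dimensional representation supplies it. At
  \<open>q = 1\<close> every \<open>k_i\<close> becomes the identity, so the diagonal part has to be
  recovered from \<open>(k_i - 1) / (q - 1)\<close>, which lies in the Levi subalgebra because all
  of Q(q) is available as scalars. The top letter is special: the images of \<open>x_id^(l)\<close>
  are projections that keep it apart from the inner letters, and this matches the restriction to
  \<open>B_i\<close> with \<open>|i| <= r\<close>, whose E and F parts never reach the outer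
  letters. Dimensions are not computed on either side; the projection replaces their comparison. It
  rests on two consequences of transcendence: a rational function has at most one value at 1, and a
  finite nonzero family can be rescaled so that its values at 1 exist and are not all 0.\<close>

lemma lookup_cst_mult [simp]:
  "Poly_Mapping.lookup (cst c * v) b = c * Poly_Mapping.lookup v b"
proof -
  have "Poly_Mapping.lookup (Poly_Mapping.map ((*) c) v) b = c * Poly_Mapping.lookup v b"
    by (simp add: Poly_Mapping.map.rep_eq when_def)
  then show ?thesis by (simp add: mult_map_scale_conv_mult cst_def)
qed

lemma cst_0 [simp]: "cst 0 = 0"
  by (simp add: cst_def)

lemma cst_1 [simp]: "cst 1 = 1"
  by (simp add: cst_def)

lemma cst_add: "cst (c + d) = cst c + cst d"
  by (simp add: cst_def single_add)

lemma cst_diff: "cst (c - d) = cst c - cst d"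
  by (simp add: cst_def single_diff)

lemma cst_uminus: "cst (- c) = - cst c"
  by (simp add: cst_def single_uminus)

lemma cst_mult: "cst (c * d) = cst c * cst d"
  by (simp add: cst_def mult_single)

lemma cst_mult_assoc: "cst c * (cst d * v) = cst (c * d) * v"
  by (simp add: cst_mult mult.assoc)

lemma cst_mult_bas: "cst c * bas b = Poly_Mapping.single b c"
  by (simp add: cst_def bas_def mult_single)

lemma bas_mult: "bas a * bas b = bas (a + b)"
  by (simp add: bas_def mult_single)

lemma bas_0: "bas 0 = 1"
  by (simp add: bas_def)

lemma bas_Nil [simp]: "bas [] = 1"
  by (simp add: zero_list_def [symmetric] bas_0)

lemma bas_append: "bas (v @ w) = bas v * bas w"
  by (simp add: bas_mult plus_list_def)

lemma lookup_bas: "Poly_Mapping.lookup (bas a) b = (if a = b then 1 else 0)"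
  by (simp add: bas_def lookup_single when_def)

lemma keys_bas [simp]: "Poly_Mapping.keys (bas a :: _ \<Rightarrow>\<^sub>0 'k::comm_ring_1) = {a}"
  by (simp add: bas_def)

lemma pm_expand:
  assumes "finite S" "Poly_Mapping.keys v \<subseteq> S"
  shows "v = (\<Sum>b\<in>S. cst (Poly_Mapping.lookup v b) * bas b)"
proof (rule poly_mapping_eqI)
  fix a
  have "Poly_Mapping.lookup (\<Sum>b\<in>S. cst (Poly_Mapping.lookup v b) * bas b) a
      = (\<Sum>b\<in>S. if b = a then Poly_Mapping.lookup v b else 0)"
    by (simp add: lookup_sum lookup_bas if_distrib cong: if_cong)
  also have "\<dots> = Poly_Mapping.lookup v a"
    using assms by (auto simp: sum.delta in_keys_iff)
  finally show "Poly_Mapping.lookup v a = Poly_Mapping.lookup (\<Sum>b\<in>S. cst (Poly_Mapping.lookup v b) * bas b) a"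
    by simp
qed

lemma pm_induct [case_names single add]:
  fixes v :: "'b::monoid_add \<Rightarrow>\<^sub>0 'k::comm_ring_1"
  assumes single: "\<And>c b. P (cst c * bas b)" and add: "\<And>v w. P v \<Longrightarrow> P w \<Longrightarrow> P (v + w)"
  shows "P v"
proof -
  have "P (\<Sum>b\<in>S. cst (Poly_Mapping.lookup v b) * bas b)" if "finite S" for S
    using that
  proof induct
    case empty
    from single[of 0 0] show ?case by simp
  qed (auto intro: assms)
  from this[of "Poly_Mapping.keys v"] pm_expand[of "Poly_Mapping.keys v" v] show ?thesis
    by simp
qed

lemma cst_commute: "v * cst c = cst c * v" for v :: "'b::monoid_add \<Rightarrow>\<^sub>0 'k::comm_ring_1"
proof (induct v rule: pm_induct)
  case (single d b)
  then show ?case by (simp add: cst_def bas_def mult_single mult.commute)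
qed (simp add: algebra_simps)

lemma cst_commute_left: "v * (cst c * w) = cst c * (v * w)"
  for v :: "'b::monoid_add \<Rightarrow>\<^sub>0 'k::comm_ring_1"
  by (metis cst_commute mult.assoc)

section \<open>Linear extension from a basis\<close>

lemma lin_superset:
  assumes "finite S" "Poly_Mapping.keys v \<subseteq> S"
  shows "lin u v = (\<Sum>b\<in>S. cst (Poly_Mapping.lookup v b) * u b)"
  unfolding lin_def using assms by (intro sum.mono_neutral_left) (auto simp: in_keys_iff)

lemma lin_add: "lin u (v + w) = lin u v + lin u w"
proof -
  let ?S = "Poly_Mapping.keys v \<union> Poly_Mapping.keys w"
  have "lin u x = (\<Sum>b\<in>?S. cst (Poly_Mapping.lookup x b) * u b)"
    if "x \<in> {v, w, v + w}" for x
    using that keys_add[of v w] by (intro lin_superset) auto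
  then show ?thesis by (simp add: lookup_add cst_add sum.distrib distrib_right)
qed

lemma lin_scale: "lin u (cst c * v) = cst c * lin u v"
proof -
  have "Poly_Mapping.keys (cst c * v) \<subseteq> Poly_Mapping.keys v"
    by (auto simp: in_keys_iff)
  then have "lin u (cst c * v) = (\<Sum>b\<in>Poly_Mapping.keys v. cst (c * Poly_Mapping.lookup v b) * u b)"
    by (subst lin_superset[of "Poly_Mapping.keys v"]) auto
  then show ?thesis by (simp add: lin_def sum_distrib_left cst_mult mult.assoc)
qed

lemma lin_bas [simp]: "lin u (bas b) = u b"
  by (simp add: lin_def lookup_bas)

text \<open>Linearity on the whole free module, with no invariant subspace in the type, makes these
  operators a ring under composition, so that relations between generators can be stated and
  simplified as ring identities.\<close>

typedef (overloaded) ('b, 'k) lop =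
  "{A :: ('b::monoid_add \<Rightarrow>\<^sub>0 'k::comm_ring_1) \<Rightarrow> ('b \<Rightarrow>\<^sub>0 'k).
     (\<forall>v w. A (v + w) = A v + A w) \<and> (\<forall>c v. A (cst c * v) = cst c * A v)}"
  morphisms app Lop
  by (rule exI[of _ "\<lambda>v. v"]) simp

setup_lifting type_definition_lop

lemma app_add: "app A (v + w) = app A v + app A w"
  using app[of A] by simp

lemma app_scale: "app A (cst c * v) = cst c * app A v"
  using app[of A] by simp

lemma app_0 [simp]: "app A 0 = 0"
  using app_scale[of A 0 0] by simp

lemma app_uminus: "app A (- v) = - app A v"
  using app_add[of A v "- v"] by (simp add: eq_neg_iff_add_eq_0 add.commute)

lemma app_diff: "app A (v - w) = app A v - app A w"
  using app_add[of A v "- w"] by (simp add: app_uminus)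

lemma app_sum: "app A (sum g S) = (\<Sum>x\<in>S. app A (g x))"
  by (induct S rule: infinite_finite_induct) (auto simp: app_add)

lemmas app_linear = app_add app_scale app_0 app_uminus app_diff app_sum

instantiation lop :: (monoid_add, comm_ring_1) ring_1
begin
lift_definition zero_lop :: "('a, 'b) lop" is "\<lambda>v. 0" by simp
lift_definition one_lop :: "('a, 'b) lop" is "\<lambda>v. v" by simp
lift_definition plus_lop :: "('a, 'b) lop \<Rightarrow> ('a, 'b) lop \<Rightarrow> ('a, 'b) lop"
  is "\<lambda>A B v. A v + B v" by (simp add: algebra_simps)
lift_definition minus_lop :: "('a, 'b) lop \<Rightarrow> ('a, 'b) lop \<Rightarrow> ('a, 'b) lop"
  is "\<lambda>A B v. A v - B v" by (simp add: algebra_simps)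
lift_definition uminus_lop :: "('a, 'b) lop \<Rightarrow> ('a, 'b) lop"
  is "\<lambda>A v. - A v" by (simp add: algebra_simps)
lift_definition times_lop :: "('a, 'b) lop \<Rightarrow> ('a, 'b) lop \<Rightarrow> ('a, 'b) lop"
  is "\<lambda>A B v. A (B v)" by simp
instance
proof
  fix a b c :: "('a, 'b) lop"
  show "a * b * c = a * (b * c)" by transfer simp
  show "1 * a = a" by transfer simp
  show "a * 1 = a" by transfer simp
  show "a + b + c = a + (b + c)" by transfer (simp add: add.assoc)
  show "a + b = b + a" by transfer (simp add: add.commute)
  show "0 + a = a" by transfer simp
  show "- a + a = 0" by transfer simp
  show "a - b = a + - b" by transfer simp
  show "(a + b) * c = a * c + b * c" by transfer simp
  show "a * (b + c) = a * b + a * c" by transfer simp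
  show "0 \<noteq> (1 :: ('a, 'b) lop)"
    by transfer (metis cst_1 lookup_bas bas_0 lookup_zero zero_neq_one)
qed
end

lemma app_zero_lop [simp]: "app 0 v = 0" by transfer simp
lemma app_one_lop [simp]: "app 1 v = v" by transfer simp
lemma app_plus_lop [simp]: "app (A + B) v = app A v + app B v" by transfer simp
lemma app_minus_lop [simp]: "app (A - B) v = app A v - app B v" by transfer simp
lemma app_uminus_lop [simp]: "app (- A) v = - app A v" by transfer simp
lemma app_times_lop [simp]: "app (A * B) v = app A (app B v)" by transfer simp

lemma app_sum_lop [simp]: "app (sum F S) v = (\<Sum>x\<in>S. app (F x) v)"
  by (induct S rule: infinite_finite_induct) auto

lift_definition sc :: "'k::comm_ring_1 \<Rightarrow> ('b::monoid_add, 'k) lop" is "\<lambda>c v. cst c * v"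
  by (simp add: distrib_left cst_mult_assoc mult.commute)

lemma app_sc [simp]: "app (sc c) v = cst c * v"
  by transfer simp

lift_definition Lin :: "('b::monoid_add \<Rightarrow> ('b \<Rightarrow>\<^sub>0 'k)) \<Rightarrow> ('b, 'k::comm_ring_1) lop" is lin
  by (simp add: lin_add lin_scale)

lemma app_Lin: "app (Lin u) = lin u"
  by transfer simp

lemma app_Lin_bas [simp]: "app (Lin u) (bas b) = u b"
  by (simp add: app_Lin)

lemma lop_eqI:
  assumes "\<And>b. app A (bas b) = app B (bas b)"
  shows "A = B"
proof -
  have "app A v = app B v" for v
    by (induct v rule: pm_induct) (simp_all add: app_linear assms)
  then show ?thesis by (simp add: app_inject [symmetric] fun_eq_iff)
qed

lemma app_expand: "app A v = lin (\<lambda>b. app A (bas b)) v"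
  using lop_eqI[of A "Lin (\<lambda>b. app A (bas b))"] by (metis app_Lin app_Lin_bas)

lemma sc_0 [simp]: "sc 0 = 0" and sc_1 [simp]: "sc 1 = 1"
  by (rule lop_eqI; simp)+

lemma sc_add: "sc (c + d) = sc c + sc d" and sc_mult: "sc (c * d) = sc c * sc d"
  and sc_diff: "sc (c - d) = sc c - sc d" and sc_uminus: "sc (- c) = - sc c"
  by (rule lop_eqI; simp add: cst_add cst_mult cst_diff cst_uminus algebra_simps)+

lemma sc_commute: "A * sc c = sc c * A"
  by (rule lop_eqI) (simp add: app_linear)

lemma sc_commute_left: "A * (sc c * B) = sc c * (A * B)"
  by (metis sc_commute mult.assoc)

subsection \<open>Presented algebras and their operator representations\<close>

text \<open>The index type is arbitrary: besides words it covers pairs of words, so the same map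
  evaluates elements of the tensor square of a free algebra.\<close>

definition evl :: "('w \<Rightarrow> ('b::monoid_add, 'k::comm_ring_1) lop) \<Rightarrow> ('w \<Rightarrow>\<^sub>0 'k) \<Rightarrow> ('b, 'k) lop" where
  "evl u p = (\<Sum>w\<in>Poly_Mapping.keys p. sc (Poly_Mapping.lookup p w) * u w)"

lemma app_evl: "app (evl u p) v = lin (\<lambda>w. app (u w) v) p"
  by (simp add: evl_def lin_def)

lemma evl_add: "evl u (p + p') = evl u p + evl u p'"
  by (rule lop_eqI) (simp add: app_evl lin_add)

lemma evl_scale: "evl u (cst c * p) = sc c * evl u p"
  by (rule lop_eqI) (simp add: app_evl lin_scale)

lemma evl_bas [simp]: "evl u (bas w) = u w"
  by (rule lop_eqI) (simp add: app_evl)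

lemma evl_uminus: "evl u (- p) = - evl u (p :: 'w::monoid_add \<Rightarrow>\<^sub>0 'k::comm_ring_1)"
  using evl_scale[of u "- 1" p] by (simp add: cst_uminus sc_uminus)

lemma evl_diff: "evl u (p - p') = evl u p - evl u (p' :: 'w::monoid_add \<Rightarrow>\<^sub>0 'k::comm_ring_1)"
  using evl_add[of u p "- p'"] by (simp add: evl_uminus)

lemma evl_0 [simp]: "evl u 0 = 0"
  by (simp add: evl_def)

lemma evl_cst: "evl u (cst c) = sc c * u 0"
  by (metis bas_0 evl_bas evl_scale mult.right_neutral)

lemma evl_mult:
  fixes u :: "'w::monoid_add \<Rightarrow> ('b::monoid_add, 'k::comm_ring_1) lop"
  assumes "\<And>v w. u (v + w) = u v * u w"
  shows "evl u (p * p') = evl u p * evl u p'"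
proof (induct p rule: pm_induct)
  case (single c b)
  show ?case
  proof (induct p' rule: pm_induct)
    case (single d b')
    have "(cst c * bas b) * (cst d * bas b') = cst (c * d) * bas (b + b')"
      by (simp add: cst_mult_bas mult_single)
    then show ?case
      by (simp add: evl_scale assms sc_mult mult.assoc sc_commute_left [of "u _"])
  qed (simp add: distrib_left evl_add)
qed (simp add: distrib_right evl_add)

lemma evl_mult_anti:
  fixes u :: "'w::monoid_add \<Rightarrow> ('b::monoid_add, 'k::comm_ring_1) lop"
  assumes "\<And>v w. u (v + w) = u w * u v"
  shows "evl u (p * p') = evl u p' * evl u p"
proof (induct p rule: pm_induct)
  case (single c b)
  show ?case
  proof (induct p' rule: pm_induct)
    case (single d b')
    have "(cst c * bas b) * (cst d * bas b') = cst (d * c) * bas (b + b')"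
      by (simp add: cst_mult_bas mult_single mult.commute)
    then show ?case
      by (simp add: evl_scale assms sc_mult mult.assoc sc_commute_left [of "u _"])
  qed (simp add: distrib_left distrib_right evl_add)
qed (simp add: distrib_left distrib_right evl_add)

definition wordL :: "('g \<Rightarrow> ('b::monoid_add, 'k::comm_ring_1) lop) \<Rightarrow> 'g list \<Rightarrow> ('b, 'k) lop" where
  "wordL P w = prod_list (map P w)"

text \<open>The leftmost letter acts first, as with \<open>fold\<close> in \<open>right_act\<close>;
  hence concatenation turns into the reversed product.\<close>

definition wordR :: "('g \<Rightarrow> ('b::monoid_add, 'k::comm_ring_1) lop) \<Rightarrow> 'g list \<Rightarrow> ('b, 'k) lop" where
  "wordR P w = prod_list (map P (rev w))"

lemma wordL_simps [simp]:
  "wordL P [] = 1" "wordL P 0 = 1" "wordL P (g # w) = P g * wordL P w"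
  "wordL P (v @ w) = wordL P v * wordL P w" "wordL P (v + w) = wordL P v * wordL P w"
  by (simp_all add: wordL_def plus_list_def zero_list_def)

lemma wordR_simps [simp]:
  "wordR P [] = 1" "wordR P 0 = 1" "wordR P (g # w) = wordR P w * P g"
  "wordR P (v @ w) = wordR P w * wordR P v" "wordR P (v + w) = wordR P w * wordR P v"
  by (simp_all add: wordR_def plus_list_def zero_list_def)

lemmas evl_wordL_mult [simp] = evl_mult[of "wordL P" for P, OF wordL_simps(5)]
lemmas evl_wordR_mult [simp] = evl_mult_anti[of "wordR P" for P, OF wordR_simps(5)]

lemma evl_word_gen [simp]: "evl (wordL P) (gen g) = P g" "evl (wordR P) (gen g) = P g"
  by (simp_all add: gen_def)

lemma evl_word_cst [simp]: "evl (wordL P) (cst c) = sc c" "evl (wordR P) (cst c) = sc c"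
  by (simp_all add: evl_cst)

lemma evl_word_1 [simp]: "evl (wordL P) 1 = 1" "evl (wordR P) 1 = 1"
  using evl_word_cst[of P 1] by simp_all

lemma foldr_app: "foldr (\<lambda>g. app (P g)) w v = app (wordL P w) v"
  by (induct w) auto

lemma left_act_app: "left_act (\<lambda>g. app (P g)) p v = app (evl (wordL P) p) v"
  by (simp add: left_act_def foldr_app app_evl)

section \<open>The free algebra as a ring, and its quotients\<close>

lemma keys_uminus: "Poly_Mapping.keys (- p) = Poly_Mapping.keys (p :: 'a \<Rightarrow>\<^sub>0 'k::comm_ring_1)"
  by (auto simp: in_keys_iff)

lemma keys_mult_list:
  "w \<in> Poly_Mapping.keys (p * p') \<Longrightarrow>
    \<exists>a\<in>Poly_Mapping.keys p. \<exists>b\<in>Poly_Mapping.keys p'. w = a @ b"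
  using keys_mult[of p p'] unfolding plus_list_def by blast

lemma free_algebra_simps [simp]:
  "mult (free_algebra S) = (*)" "one (free_algebra S) = 1"
  "zero (free_algebra S) = 0" "add (free_algebra S) = (+)"
  by (simp_all add: free_algebra_def)

lemma carrier_free_algebra:
  "p \<in> carrier (free_algebra S) \<longleftrightarrow> (\<forall>w\<in>Poly_Mapping.keys p. set w \<subseteq> S)"
  by (simp add: free_algebra_def)

lemma cst_closed: "cst c \<in> carrier (free_algebra S)"
  by (auto simp: carrier_free_algebra cst_def zero_list_def split: if_splits)

lemma add_closed:
  "p \<in> carrier (free_algebra S) \<Longrightarrow> p' \<in> carrier (free_algebra S) \<Longrightarrow> p + p' \<in> carrier (free_algebra S)"
  using keys_add[of p p'] by (auto simp: carrier_free_algebra)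

lemma mult_closed:
  assumes "p \<in> carrier (free_algebra S)" "p' \<in> carrier (free_algebra S)"
  shows "p * p' \<in> carrier (free_algebra S)"
  unfolding carrier_free_algebra
proof
  fix w assume "w \<in> Poly_Mapping.keys (p * p')"
  then obtain a b where "a \<in> Poly_Mapping.keys p" "b \<in> Poly_Mapping.keys p'" "w = a @ b"
    using keys_mult_list by blast
  with assms show "set w \<subseteq> S" by (auto simp: carrier_free_algebra)
qed

lemma uminus_closed: "p \<in> carrier (free_algebra S) \<Longrightarrow> - p \<in> carrier (free_algebra S)"
  for p :: "'g list \<Rightarrow>\<^sub>0 'k::comm_ring_1"
  by (simp add: carrier_free_algebra keys_uminus)

lemma free_algebra_closed [intro]:
  fixes p p' :: "'g list \<Rightarrow>\<^sub>0 'k::comm_ring_1"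
  shows "0 \<in> carrier (free_algebra S)" "1 \<in> carrier (free_algebra S)"
  "cst c \<in> carrier (free_algebra S)"
  "set w \<subseteq> S \<Longrightarrow> bas w \<in> carrier (free_algebra S)"
  "g \<in> S \<Longrightarrow> gen g \<in> carrier (free_algebra S)"
  "p \<in> carrier (free_algebra S) \<Longrightarrow> p' \<in> carrier (free_algebra S) \<Longrightarrow> p + p' \<in> carrier (free_algebra S)"
  "p \<in> carrier (free_algebra S) \<Longrightarrow> p' \<in> carrier (free_algebra S) \<Longrightarrow> p * p' \<in> carrier (free_algebra S)"
  "p \<in> carrier (free_algebra S) \<Longrightarrow> p' \<in> carrier (free_algebra S) \<Longrightarrow> p - p' \<in> carrier (free_algebra S)"
  "p \<in> carrier (free_algebra S) \<Longrightarrow> - p \<in> carrier (free_algebra S)"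
  using add_closed[of p S "- p'"] cst_closed[of 1 S]
  by (simp_all add: add_closed mult_closed uminus_closed cst_closed)
    (simp_all add: carrier_free_algebra gen_def)

lemma ring_free_algebra: "ring (free_algebra S)"
proof (rule ringI)
  show "abelian_group (free_algebra S)"
  proof (rule abelian_groupI)
    fix x assume "x \<in> carrier (free_algebra S)"
    then show "\<exists>y\<in>carrier (free_algebra S). y \<oplus>\<^bsub>free_algebra S\<^esub> x = \<zero>\<^bsub>free_algebra S\<^esub>"
      by (intro bexI[of _ "- x"]) auto
  qed (auto simp: algebra_simps)
  show "monoid (free_algebra S)"
    by (rule monoidI) (auto simp: algebra_simps)
qed (auto simp: algebra_simps)

text \<open>Generation takes place in the free algebra, where an induction meets polynomials instead
  of cosets; additive inverses come from the scalar -1.\<close>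

inductive_set subalg :: "('g list \<Rightarrow>\<^sub>0 'k::comm_ring_1) set \<Rightarrow> ('g list \<Rightarrow>\<^sub>0 'k) set"
  for X where
  cst: "cst c \<in> subalg X"
| incl: "x \<in> X \<Longrightarrow> x \<in> subalg X"
| add: "p \<in> subalg X \<Longrightarrow> p' \<in> subalg X \<Longrightarrow> p + p' \<in> subalg X"
| mult: "p \<in> subalg X \<Longrightarrow> p' \<in> subalg X \<Longrightarrow> p * p' \<in> subalg X"

lemma subalg_uminus: "p \<in> subalg X \<Longrightarrow> - p \<in> subalg X"
  using subalg.mult[OF subalg.cst[of "- 1"], of p] by (simp add: cst_uminus)

lemma subalg_one: "1 \<in> subalg X"
  using subalg.cst[of 1] by simp

lemma subalg_closed: "p \<in> subalg X \<Longrightarrow> X \<subseteq> carrier (free_algebra S) \<Longrightarrow> p \<in> carrier (free_algebra S)"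
  by (induct rule: subalg.induct) auto

context
  fixes S :: "'g set" and R :: "('g list \<Rightarrow>\<^sub>0 'k::comm_ring_1) set"
  assumes R: "R \<subseteq> carrier (free_algebra S)"
begin

lemma ideal_rels: "ideal (genideal (free_algebra S) R) (free_algebra S)"
  using ring.genideal_ideal[OF ring_free_algebra R] .

lemma cls_hom: "cls S R \<in> ring_hom (free_algebra S) (presented_algebra S R)"
  using ideal.rcos_ring_hom[OF ideal_rels] unfolding cls_def presented_algebra_def by simp

lemma ring_presented: "ring (presented_algebra S R)"
  using ideal.quotient_is_ring[OF ideal_rels] by (simp add: presented_algebra_def)

lemma cls_uminus:
  assumes "p \<in> carrier (free_algebra S)"
  shows "cls S R (- p) = a_inv (presented_algebra S R) (cls S R p)"
proof -
  interpret F: ring "free_algebra S" by (rule ring_free_algebra)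
  interpret Q: ring "presented_algebra S R" by (rule ring_presented)
  have p: "cls S R p \<in> carrier (presented_algebra S R)" "cls S R (- p) \<in> carrier (presented_algebra S R)"
    using assms ring_hom_closed[OF cls_hom] by blast+
  have "\<zero>\<^bsub>presented_algebra S R\<^esub> = cls S R 0"
    using ring_hom_zero[OF cls_hom ring_free_algebra ring_presented] by simp
  also have "\<dots> = cls S R (- p + p)" by simp
  also have "\<dots> = cls S R (- p) \<oplus>\<^bsub>presented_algebra S R\<^esub> cls S R p"
    using ring_hom_add[OF cls_hom, of "- p" p] assms by auto
  finally show ?thesis
    using p Q.minus_equality by metis
qed

lemma carrier_presented: "carrier (presented_algebra S R) = cls S R ` carrier (free_algebra S)"
  by (auto simp: presented_algebra_def FactRing_def A_RCOSETS_def' cls_def)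

text \<open>Taking classes is a ring homomorphism, so it commutes with generation; the Levi
  subalgebra can thus be handled through representatives in the free algebra.\<close>

lemma generated_subalgebra_eq:
  assumes X: "X \<subseteq> carrier (free_algebra S)"
  shows "generated_subalgebra S R X = cls S R ` subalg X"
proof (intro equalityI subsetI)
  fix x assume "x \<in> generated_subalgebra S R X"
  then show "x \<in> cls S R ` subalg X"
    unfolding generated_subalgebra_def
  proof induct
    case one
    have "\<one>\<^bsub>presented_algebra S R\<^esub> = cls S R 1"
      using ring_hom_one[OF cls_hom] by simp
    then show ?case using subalg_one by blast
  next
    case (incl h)
    then show ?case by (auto intro: subalg.intros)
  next
    case (a_inv h)
    then obtain p where "p \<in> subalg X" "h = cls S R p" by blast
    then show ?case using cls_uminus[of p] subalg_uminus[of p X] subalg_closed[OF _ X, of p]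
      by (metis image_eqI)
  next
    case (eng_add h1 h2)
    then obtain p p' where "p \<in> subalg X" "p' \<in> subalg X" "h1 = cls S R p" "h2 = cls S R p'" by blast
    then show ?case
      using ring_hom_add[OF cls_hom, of p p'] subalg_closed[OF _ X] subalg.add[of p X p']
      by (metis free_algebra_simps(4) image_eqI)
  next
    case (eng_mult h1 h2)
    then obtain p p' where "p \<in> subalg X" "p' \<in> subalg X" "h1 = cls S R p" "h2 = cls S R p'" by blast
    then show ?case
      using ring_hom_mult[OF cls_hom, of p p'] subalg_closed[OF _ X] subalg.mult[of p X p']
      by (metis free_algebra_simps(1) image_eqI)
  qed
next
  fix x assume "x \<in> cls S R ` subalg X"
  then obtain p where p: "p \<in> subalg X" "x = cls S R p" by blast
  from p(1) have "cls S R p \<in> generated_subalgebra S R X"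
    unfolding generated_subalgebra_def
  proof induct
    case (add p p')
    then show ?case
      using ring_hom_add[OF cls_hom, of p p'] subalg_closed[OF _ X] generate_ring.eng_add
      by (metis free_algebra_simps(4))
  next
    case (mult p p')
    then show ?case
      using ring_hom_mult[OF cls_hom, of p p'] subalg_closed[OF _ X] generate_ring.eng_mult
      by (metis free_algebra_simps(1))
  qed (auto intro: generate_ring.incl)
  then show "x \<in> generated_subalgebra S R X" using p by simp
qed

text \<open>The elements evaluated to 0 form a two-sided ideal, whether evaluation preserves or
  reverses products, and \<open>genideal\<close> is the least ideal containing the
  relations.\<close>

lemma evl_rels_ideal:
  fixes u :: "'g list \<Rightarrow> ('b::monoid_add, 'k) lop"
  assumes mult: "(\<forall>v w. u (v + w) = u v * u w) \<or> (\<forall>v w. u (v + w) = u w * u v)"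
    and rels: "\<And>p. p \<in> R \<Longrightarrow> evl u p = 0"
    and p: "p \<in> genideal (free_algebra S) R"
  shows "evl u p = 0"
proof -
  let ?K = "{p \<in> carrier (free_algebra S). evl u p = 0}"
  have m: "evl u (x * y) = 0" if "evl u x = 0 \<or> evl u y = 0" for x y
  proof -
    have "evl u (x * y) = evl u x * evl u y \<or> evl u (x * y) = evl u y * evl u x"
      using mult evl_mult[of u x y] evl_mult_anti[of u x y] by metis
    with that show ?thesis by auto
  qed
  interpret F: ring "free_algebra S" by (rule ring_free_algebra)
  have inv: "\<ominus>\<^bsub>free_algebra S\<^esub> x = - x" if "x \<in> carrier (free_algebra S)" for x
    using F.minus_equality[of "- x" x] that by auto
  have "ideal ?K (free_algebra S)"
  proof (rule idealI[OF ring_free_algebra])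
    show "subgroup ?K (add_monoid (free_algebra S))"
    proof (rule F.add.subgroupI)
      fix a assume "a \<in> ?K"
      then show "\<ominus>\<^bsub>free_algebra S\<^esub> a \<in> ?K" using inv[of a] by (auto simp: evl_uminus)
    next
      show "?K \<noteq> {}" using free_algebra_closed(1)[of S] evl_0[of u] by blast
    qed (auto simp: evl_add)
  qed (auto simp: m)
  moreover have "R \<subseteq> ?K" using R rels by auto
  ultimately have "genideal (free_algebra S) R \<subseteq> ?K"
    by (rule F.genideal_minimal)
  with p show ?thesis by blast
qed

text \<open>All representatives of a coset evaluate to the same operator, so the set inside
  \<open>the_elem\<close> is a singleton. Agreement with evaluation is asked only on
  \<open>W\<close>, since \<rho> may behave differently elsewhere.\<close>

lemma induced_cls:
  fixes u :: "'g list \<Rightarrow> ('b::monoid_add, 'k) lop"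
  assumes mult: "(\<forall>v w. u (v + w) = u v * u w) \<or> (\<forall>v w. u (v + w) = u w * u v)"
    and rels: "\<And>p. p \<in> R \<Longrightarrow> evl u p = 0"
    and \<rho>: "\<And>p v. p \<in> carrier (free_algebra S) \<Longrightarrow> v \<in> W \<Longrightarrow> \<rho> p v = app (evl u p) v"
    and p: "p \<in> carrier (free_algebra S)"
  shows "induced W \<rho> (cls S R p) = restrict (app (evl u p)) W"
proof -
  let ?I = "genideal (free_algebra S) R"
  have I: "?I \<subseteq> carrier (free_algebra S)" and 0: "0 \<in> ?I"
    using ideal.Icarr[OF ideal_rels] additive_subgroup.zero_closed[OF ideal.axioms(1)[OF ideal_rels]]
    by (blast, simp)
  have *: "restrict (\<rho> (a + p)) W = restrict (app (evl u p)) W" if "a \<in> ?I" for a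
  proof -
    have "a + p \<in> carrier (free_algebra S)" using I that p by blast
    moreover have "evl u (a + p) = evl u p"
      using evl_rels_ideal[OF mult rels that] by (simp add: evl_add)
    ultimately show ?thesis using \<rho> by (auto simp: restrict_def fun_eq_iff)
  qed
  have "cls S R p = (\<lambda>a. a + p) ` ?I"
    by (auto simp: cls_def a_r_coset_def')
  then have "(\<lambda>p. restrict (\<rho> p) W) ` cls S R p = {restrict (app (evl u p)) W}"
    using * 0 by (auto simp: image_image)
  then show ?thesis by (simp add: induced_def)
qed

end

subsection \<open>Families of operators satisfying the quantum group relations\<close>

definition qserre :: "'k::field \<Rightarrow> ('b::monoid_add, 'k) lop \<Rightarrow> ('b, 'k) lop \<Rightarrow> bool" where
  "qserre q x y \<longleftrightarrow> x * x * y - sc (q + inverse q) * (x * y * x) + y * x * x = 0"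

lemma sc_sc_left: "sc c * (sc d * A) = sc (c * d) * A"
  by (simp add: sc_mult mult.assoc)

text \<open>The mixed terms cancel in pairs or triples because \<open>f\<close>, \<open>f'\<close> commute with \<open>a\<close>, \<open>a'\<close> up to powers of \<open>q\<close>.\<close>

lemma qserre_add:
  fixes a a' f f' :: "('b::monoid_add, 'k::field) lop"
  assumes q: "q \<noteq> 0" and s: "qserre q a a'" "qserre q f f'"
    and fa: "f * a = sc (inverse q * inverse q) * (a * f)"
    and fa': "f * a' = sc q * (a' * f)" and f'a: "f' * a = sc q * (a * f')"
  shows "qserre q (a + f) (a' + f')"
proof -
  define t where "t = q + inverse q"
  have l: "f * (a * z) = sc (inverse q * inverse q) * (a * (f * z))"
    "f * (a' * z) = sc q * (a' * (f * z))" "f' * (a * z) = sc q * (a * (f' * z))" for z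
    using fa fa' f'a by (simp_all add: mult.assoc [symmetric])
  note r = l fa fa' f'a sc_commute_left[of a] sc_commute_left[of a'] sc_commute_left[of f]
    sc_commute_left[of f'] sc_sc_left mult.assoc
  have e: "1 - t * q + q * q = 0" "1 - t * inverse q + inverse q * inverse q = 0"
    "q - t + inverse q = 0"
    using q by (simp_all add: t_def field_simps)
  have 1: "a * a * f' - sc t * (a * f' * a) + f' * a * a = 0"
  proof -
    have "a * a * f' - sc t * (a * f' * a) + f' * a * a = sc (1 - t * q + q * q) * (a * (a * f'))"
      by (simp only: sc_add sc_diff) (simp add: r algebra_simps)
    then show ?thesis using e by simp
  qed
  have 2: "a * f * a' - sc t * (a * a' * f) + a' * a * f + (f * a * a' - sc t * (f * a' * a) + a' * f * a) = 0"
  proof -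
    have c: "sc (inverse q * inverse q) * (sc q * x) = sc (inverse q) * x"
      "sc q * (sc (inverse q * inverse q) * x) = sc (inverse q) * x"  for x :: "('b, 'k) lop"
    proof -
      have "inverse q * inverse q * q = inverse q" "q * (inverse q * inverse q) = inverse q"
        using q by simp_all
      then show "sc (inverse q * inverse q) * (sc q * x) = sc (inverse q) * x"
        "sc q * (sc (inverse q * inverse q) * x) = sc (inverse q) * x"
        by (simp_all only: sc_sc_left)
    qed
    have "a * f * a' - sc t * (a * a' * f) + a' * a * f + (f * a * a' - sc t * (f * a' * a) + a' * f * a) =
       sc (q - t + inverse q) * (a * (a' * f)) +
       sc (1 - t * inverse q + inverse q * inverse q) * (a' * (a * f))"
      by (simp only: sc_add sc_diff sc_mult[of t] mult.assoc l fa fa' f'a c sc_commute_left[of a] sc_commute_left[of a'] sc_commute_left[of f]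
    sc_commute_left[of f']) (simp add: algebra_simps)
    then show ?thesis using e by simp
  qed
  have 3: "f * f * a' - sc t * (f * a' * f) + a' * f * f = 0"
  proof -
    have "f * f * a' - sc t * (f * a' * f) + a' * f * f = sc (1 - t * q + q * q) * (a' * (f * f))"
      by (simp only: sc_add sc_diff) (simp add: r algebra_simps)
    then show ?thesis using e by simp
  qed
  have 4: "a * f * f' - sc t * (a * f' * f) + f' * a * f + (f * a * f' - sc t * (f * f' * a) + f' * f * a) = 0"
  proof -
    have c: "sc (inverse q * inverse q) * (sc q * x) = sc (inverse q) * x"
      "sc q * (sc (inverse q * inverse q) * x) = sc (inverse q) * x"  for x :: "('b, 'k) lop"
    proof -
      have "inverse q * inverse q * q = inverse q" "q * (inverse q * inverse q) = inverse q"
        using q by simp_all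
      then show "sc (inverse q * inverse q) * (sc q * x) = sc (inverse q) * x"
        "sc q * (sc (inverse q * inverse q) * x) = sc (inverse q) * x"
        by (simp_all only: sc_sc_left)
    qed
    have "a * f * f' - sc t * (a * f' * f) + f' * a * f + (f * a * f' - sc t * (f * f' * a) + f' * f * a) =
       sc (q - t + inverse q) * (a * (f' * f)) +
       sc (1 - t * inverse q + inverse q * inverse q) * (a * (f * f'))"
      by (simp only: sc_add sc_diff sc_mult[of t] mult.assoc l fa fa' f'a c sc_commute_left[of a] sc_commute_left[of a'] sc_commute_left[of f]
    sc_commute_left[of f']) (simp add: algebra_simps)
    then show ?thesis using e by simp
  qed
  have "(a + f) * (a + f) * (a' + f') - sc t * ((a + f) * (a' + f') * (a + f)) + (a' + f') * (a + f) * (a + f)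
    = (a * a * a' - sc t * (a * a' * a) + a' * a * a) + (f * f * f' - sc t * (f * f' * f) + f' * f * f)
      + (a * a * f' - sc t * (a * f' * a) + f' * a * a)
      + (a * f * a' - sc t * (a * a' * f) + a' * a * f + (f * a * a' - sc t * (f * a' * a) + a' * f * a))
      + (f * f * a' - sc t * (f * a' * f) + a' * f * f)
      + (a * f * f' - sc t * (a * f' * f) + f' * a * f + (f * a * f' - sc t * (f * f' * a) + f' * f * a))"
    by (simp add: algebra_simps)
  also have "\<dots> = 0"
    using s 1 2 3 4 by (simp add: qserre_def t_def)
  finally show ?thesis by (simp add: qserre_def t_def)
qed

text \<open>The commuting operators collect into a common right factor \<open>k * (k * k')\<close>
  of all three terms.\<close>

lemma qserre_mult:
  fixes e e' k k' :: "('b::monoid_add, 'k::field) lop"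
  assumes s: "qserre q e e'" and c: "k * e = e * k" "k * e' = e' * k" "k' * e = e * k'" "k' * e' = e' * k'" "k * k' = k' * k"
  shows "qserre q (e * k) (e' * k')"
proof -
  have l: "k * (e * z) = e * (k * z)" "k * (e' * z) = e' * (k * z)" "k' * (e * z) = e * (k' * z)"
     "k' * (e' * z) = e' * (k' * z)" "k' * (k * z) = k * (k' * z)" for z
    using c by (metis mult.assoc)+
  have "e * k * (e * k) * (e' * k') - sc t * (e * k * (e' * k') * (e * k)) + e' * k' * (e * k) * (e * k)
     = (e * e * e' - sc t * (e * e' * e) + e' * e * e) * (k * (k * k'))" for t
    by (simp add: mult.assoc l c distrib_right left_diff_distrib)
  then show ?thesis using s by (simp add: qserre_def)
qed

text \<open>The indices range over all integers, so no range conditions have to be carried along;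
  the natural operators satisfy the relations for every index. Conjugation by K is written as
  commutation up to a scalar, which is the form suited to rewriting.\<close>

definition uq_fam :: "'k::field \<Rightarrow> (uq_gen \<Rightarrow> ('b::monoid_add, 'k) lop) \<Rightarrow> bool" where
  "uq_fam q P \<longleftrightarrow>
     (\<forall>i. P (GenK i) * P (GenKinv i) = 1 \<and> P (GenKinv i) * P (GenK i) = 1) \<and>
     (\<forall>i j. P (GenK i) * P (GenK j) = P (GenK j) * P (GenK i)) \<and>
     (\<forall>i j. P (GenK i) * P (GenE j) = sc (q powi cartan i j) * (P (GenE j) * P (GenK i))) \<and>
     (\<forall>i j. P (GenK i) * P (GenF j) = sc (q powi (- cartan i j)) * (P (GenF j) * P (GenK i))) \<and>
     (\<forall>i j. P (GenE i) * P (GenF j) - P (GenF j) * P (GenE i) =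
       (if i = j then sc (inverse (q - inverse q)) * (P (GenK i) - P (GenKinv i)) else 0)) \<and>
     (\<forall>i j. \<bar>i - j\<bar> = 1 \<longrightarrow> qserre q (P (GenE i)) (P (GenE j)) \<and> qserre q (P (GenF i)) (P (GenF j))) \<and>
     (\<forall>i j. \<bar>i - j\<bar> > 1 \<longrightarrow> P (GenE i) * P (GenE j) = P (GenE j) * P (GenE i) \<and>
        P (GenF i) * P (GenF j) = P (GenF j) * P (GenF i))"

lemma uq_famD:
  assumes "uq_fam q P"
  shows "P (GenK i) * P (GenKinv i) = 1" "P (GenKinv i) * P (GenK i) = 1"
    "P (GenK i) * P (GenK j) = P (GenK j) * P (GenK i)"
    "P (GenK i) * P (GenE j) = sc (q powi cartan i j) * (P (GenE j) * P (GenK i))"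
    "P (GenK i) * P (GenF j) = sc (q powi (- cartan i j)) * (P (GenF j) * P (GenK i))"
    "P (GenE i) * P (GenF j) - P (GenF j) * P (GenE i) =
       (if i = j then sc (inverse (q - inverse q)) * (P (GenK i) - P (GenKinv i)) else 0)"
    "\<bar>i - j\<bar> = 1 \<Longrightarrow> qserre q (P (GenE i)) (P (GenE j))"
    "\<bar>i - j\<bar> = 1 \<Longrightarrow> qserre q (P (GenF i)) (P (GenF j))"
    "\<bar>i - j\<bar> > 1 \<Longrightarrow> P (GenE i) * P (GenE j) = P (GenE j) * P (GenE i)"
    "\<bar>i - j\<bar> > 1 \<Longrightarrow> P (GenF i) * P (GenF j) = P (GenF j) * P (GenF i)"
  using assms unfolding uq_fam_def by blast+

lemma qcommute_inverse:
  fixes x y y' :: "('b::monoid_add, 'k::field) lop"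
  assumes "y * y' = 1" "y' * y = 1" and "c \<noteq> 0" and "y * x = sc c * (x * y)"
  shows "y' * x = sc (inverse c) * (x * y')"
proof -
  have "x * y' = y' * (y * x) * y'"
    using assms(2) by (simp add: mult.assoc [symmetric])
  also have "\<dots> = sc c * (y' * x * (y * y'))"
    by (simp add: assms(4) sc_commute_left[of y'] mult.assoc)
  finally have "x * y' = sc c * (y' * x)"
    using assms(1) by simp
  then have "sc (inverse c) * (x * y') = sc (inverse c) * sc c * (y' * x)"
    by (simp add: mult.assoc)
  also have "sc (inverse c) * sc c = (1 :: ('b, 'k) lop)"
    using assms(3) by (simp add: sc_mult [symmetric])
  finally show ?thesis by simp
qed

text \<open>The relations mention \<open>K_i^-1\<close> mainly as an inverse; its commutation rules
  are those of \<open>K_i\<close> with inverted scalars.\<close>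

lemma uq_fam_Kinv:
  assumes P: "uq_fam q P" and q: "q \<noteq> 0"
  shows "P (GenKinv i) * P (GenE j) = sc (q powi (- cartan i j)) * (P (GenE j) * P (GenKinv i))"
    "P (GenKinv i) * P (GenF j) = sc (q powi cartan i j) * (P (GenF j) * P (GenKinv i))"
    "P (GenKinv i) * P (GenK j) = P (GenK j) * P (GenKinv i)"
    "P (GenKinv i) * P (GenKinv j) = P (GenKinv j) * P (GenKinv i)"
proof -
  note D = uq_famD[OF P]
  show "P (GenKinv i) * P (GenE j) = sc (q powi (- cartan i j)) * (P (GenE j) * P (GenKinv i))"
    using qcommute_inverse[OF D(1,2) _ D(4)] q by (simp add: power_int_minus)
  show "P (GenKinv i) * P (GenF j) = sc (q powi cartan i j) * (P (GenF j) * P (GenKinv i))"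
    using qcommute_inverse[OF D(1,2) _ D(5)] q by (simp add: power_int_minus)
  show 1: "P (GenKinv i) * P (GenK j) = P (GenK j) * P (GenKinv i)" for i j
    using qcommute_inverse[OF D(1,2), of 1 i "P (GenK j)"] D(3) by simp
  show "P (GenKinv i) * P (GenKinv j) = P (GenKinv j) * P (GenKinv i)"
    using qcommute_inverse[OF D(1,2), of 1 i "P (GenKinv j)"] 1[of j i] by simp
qed

text \<open>The comultiplication evaluated in two families: left tensor factors act through
  \<open>P\<close>, right ones through \<open>Q\<close>. It is meant for families that commute with
  each other.\<close>

fun coprod :: "(uq_gen \<Rightarrow> ('b::monoid_add, 'k::field) lop) \<Rightarrow> (uq_gen \<Rightarrow> ('b, 'k) lop) \<Rightarrow>
    uq_gen \<Rightarrow> ('b, 'k) lop" where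
  "coprod P Q (GenE i) = Q (GenE i) + P (GenE i) * Q (GenKinv i)"
| "coprod P Q (GenF i) = P (GenF i) + P (GenK i) * Q (GenF i)"
| "coprod P Q (GenK i) = P (GenK i) * Q (GenK i)"
| "coprod P Q (GenKinv i) = P (GenKinv i) * Q (GenKinv i)"

lemma coprod_assoc: "coprod (coprod P Q) R = coprod P (coprod Q R)"
proof
  fix g show "coprod (coprod P Q) R g = coprod P (coprod Q R) g"
    by (cases g) (simp_all add: algebra_simps)
qed

text \<open>The two summands of each coproduct commute up to powers of \<open>q\<close>, so the
  Serre relations reduce to \<open>qserre_add\<close>; the other relations follow by moving
  operators of \<open>Q\<close> past operators of \<open>P\<close>.\<close>

lemma uq_fam_coprod:
  fixes P Q :: "uq_gen \<Rightarrow> ('b::monoid_add, 'k::field) lop"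
  assumes q: "q \<noteq> 0" and P: "uq_fam q P" and Q: "uq_fam q Q"
    and comm: "\<And>g h. Q g * P h = P h * Q g"
  shows "uq_fam q (coprod P Q)"
proof -
  note DP = uq_famD[OF P] uq_fam_Kinv[OF P q] and DQ = uq_famD[OF Q] uq_fam_Kinv[OF Q q]
  have comml: "Q g * (P h * z) = P h * (Q g * z)" for g h z
    by (metis comm mult.assoc)
  note cm = comm comml mult.assoc
  have scl: "P g * (sc c * z) = sc c * (P g * z)" "Q g * (sc c * z) = sc c * (Q g * z)" for g c z
    by (rule sc_commute_left)+
  have serreE: "qserre q (coprod P Q (GenE i)) (coprod P Q (GenE j))" if "\<bar>i - j\<bar> = 1" for i j
    unfolding coprod.simps
  proof (rule qserre_add[OF q DQ(7)[OF that] qserre_mult[OF DP(7)[OF that]]])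
    have c: "cartan i j = -1" "cartan j i = -1" "cartan i i = 2" using that by (auto simp: cartan_def)
    show "P (GenE i) * Q (GenKinv i) * Q (GenE i) = sc (inverse q * inverse q) * (Q (GenE i) * (P (GenE i) * Q (GenKinv i)))"
      using q by (simp add: cm scl DQ(11) c power_int_minus power2_eq_square)
    show "P (GenE i) * Q (GenKinv i) * Q (GenE j) = sc q * (Q (GenE j) * (P (GenE i) * Q (GenKinv i)))"
      using q by (simp add: cm scl DQ(11) c)
    show "P (GenE j) * Q (GenKinv j) * Q (GenE i) = sc q * (Q (GenE i) * (P (GenE j) * Q (GenKinv j)))"
      using q by (simp add: cm scl DQ(11) c)
  qed (simp_all add: comm DQ(14)[of i j])
  have serreF: "qserre q (coprod P Q (GenF i)) (coprod P Q (GenF j))" if "\<bar>i - j\<bar> = 1" for i j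
    unfolding coprod.simps
  proof (rule qserre_add[OF q DP(8)[OF that]])
    have c: "cartan i j = -1" "cartan j i = -1" "cartan i i = 2" using that by (auto simp: cartan_def)
    show "qserre q (P (GenK i) * Q (GenF i)) (P (GenK j) * Q (GenF j))"
      \<comment> \<open>\<open>qserre_mult\<close> wants the F operator in front, so the commuting
        factors are exchanged first.\<close>
      unfolding comm [symmetric]
      by (rule qserre_mult[OF DQ(8)[OF that]]) (simp_all add: comm DP(3)[of i j])
    show "P (GenK i) * Q (GenF i) * P (GenF i) = sc (inverse q * inverse q) * (P (GenF i) * (P (GenK i) * Q (GenF i)))"
      using q by (simp add: mult.assoc comm) (simp add: mult.assoc [symmetric] DP(5) c power_int_minus power2_eq_square)
    show "P (GenK i) * Q (GenF i) * P (GenF j) = sc q * (P (GenF j) * (P (GenK i) * Q (GenF i)))"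
      using q by (simp add: mult.assoc comm) (simp add: mult.assoc [symmetric] DP(5) c)
    show "P (GenK j) * Q (GenF j) * P (GenF i) = sc q * (P (GenF i) * (P (GenK j) * Q (GenF j)))"
      using q by (simp add: mult.assoc comm) (simp add: mult.assoc [symmetric] DP(5) c)
  qed
  have KK: "coprod P Q (GenK i) * coprod P Q (GenKinv i) = 1" "coprod P Q (GenKinv i) * coprod P Q (GenK i) = 1" for i
    using DP(1,2)[of i] DQ(1,2)[of i] by (simp_all add: cm)
  have KPE: "P (GenK i) * (P (GenE j) * z) = sc (q powi cartan i j) * (P (GenE j) * (P (GenK i) * z))"
    "P (GenK i) * (P (GenF j) * z) = sc (q powi (- cartan i j)) * (P (GenF j) * (P (GenK i) * z))"
    "P (GenK i) * (P (GenK j) * z) = P (GenK j) * (P (GenK i) * z)" for i j z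
    by (simp_all only: mult.assoc [symmetric] DP(3)[of i j] DP(4,5))
  have KK': "coprod P Q (GenK i) * coprod P Q (GenK j) = coprod P Q (GenK j) * coprod P Q (GenK i)" for i j
    by (simp add: cm DQ(3)[of i j] KPE(3)[of i j])
  have KQE: "Q (GenK i) * Q (GenE j) = sc (q powi cartan i j) * (Q (GenE j) * Q (GenK i))" 
    "Q (GenK i) * Q (GenF j) = sc (q powi (- cartan i j)) * (Q (GenF j) * Q (GenK i))" 
    "Q (GenK i) * Q (GenKinv j) = Q (GenKinv j) * Q (GenK i)"  for i j
    using DQ(4,5)[of i j] DQ(13)[of j i] by auto
  have KE: "coprod P Q (GenK i) * coprod P Q (GenE j) =
      sc (q powi cartan i j) * (coprod P Q (GenE j) * coprod P Q (GenK i))" for i j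
    by (simp add: cm distrib_left distrib_right KQE KPE scl)
  have KF: "coprod P Q (GenK i) * coprod P Q (GenF j) =
      sc (q powi (- cartan i j)) * (coprod P Q (GenF j) * coprod P Q (GenK i))" for i j
    by (simp add: cm distrib_left distrib_right KQE KPE scl)
  have EE: "coprod P Q (GenE i) * coprod P Q (GenE j) = coprod P Q (GenE j) * coprod P Q (GenE i)"
    if "\<bar>i - j\<bar> > 1" for i j
  proof -
    have c: "cartan i j = 0" "cartan j i = 0" using that by (auto simp: cartan_def)
    have l: "P (GenE i) * (P (GenE j) * z) = P (GenE j) * (P (GenE i) * z)" for z
      using DP(9)[OF that] by (metis mult.assoc)
    show ?thesis
      using DQ(11)[of i j] DQ(11)[of j i] c
      by (simp add: cm distrib_left distrib_right l DQ(9)[OF that] DQ(14)[of i j])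
  qed
  have FF: "coprod P Q (GenF i) * coprod P Q (GenF j) = coprod P Q (GenF j) * coprod P Q (GenF i)"
    if "\<bar>i - j\<bar> > 1" for i j
  proof -
    have c: "cartan i j = 0" "cartan j i = 0" using that by (auto simp: cartan_def)
    show ?thesis
      using KPE(2)[of i j] KPE(2)[of j i] c
      by (simp add: cm distrib_left distrib_right KPE(3)[of i j] DP(10)[OF that] DQ(10)[OF that])
  qed
  have EF: "coprod P Q (GenE i) * coprod P Q (GenF j) - coprod P Q (GenF j) * coprod P Q (GenE i) =
       (if i = j then sc (inverse (q - inverse q)) * (coprod P Q (GenK i) - coprod P Q (GenKinv i)) else 0)" for i j
  proof -
    \<comment> \<open>The mixed term that does not cancel by mere commutation of \<open>P\<close>
      with \<open>Q\<close>: moving \<open>E_i\<close> past \<open>K_j\<close> and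
      \<open>K_i^-1\<close> past \<open>F_j\<close> produces inverse powers of \<open>q\<close>,
      because the Cartan matrix is symmetric.\<close>
    have "P (GenE i) * (Q (GenKinv i) * (P (GenK j) * Q (GenF j))) =
        sc (q powi cartan i j) * (sc (q powi (- cartan j i)) * (P (GenK j) * (Q (GenF j) * (P (GenE i) * Q (GenKinv i)))))"
    proof -
      have c: "q powi cartan j i * (q powi (- cartan j i)) = 1"
        using q by (simp add: power_int_minus)
      have "P (GenE i) * P (GenK j) = sc (q powi (- cartan j i)) * (P (GenK j) * P (GenE i))"
        by (simp add: DP(4) sc_sc_left mult.commute c)
      then have "P (GenE i) * (P (GenK j) * z) = sc (q powi (- cartan j i)) * (P (GenK j) * (P (GenE i) * z))" for z
        by (simp only: mult.assoc [symmetric])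
      then show ?thesis
        by (simp add: cm DQ(12) scl sc_sc_left mult.commute)
    qed
    moreover have "cartan i j = cartan j i" by (auto simp: cartan_def)
    ultimately have *: "P (GenE i) * (Q (GenKinv i) * (P (GenK j) * Q (GenF j))) =
        P (GenK j) * (Q (GenF j) * (P (GenE i) * Q (GenKinv i)))"
      using q by (simp add: sc_sc_left power_int_minus)
    have "coprod P Q (GenE i) * coprod P Q (GenF j) - coprod P Q (GenF j) * coprod P Q (GenE i)
       = P (GenK j) * (Q (GenE i) * Q (GenF j) - Q (GenF j) * Q (GenE i))
         + (P (GenE i) * P (GenF j) - P (GenF j) * P (GenE i)) * Q (GenKinv i)"
      using * by (simp add: algebra_simps cm)
    also have "\<dots> = (if i = j then sc (inverse (q - inverse q)) * (coprod P Q (GenK i) - coprod P Q (GenKinv i)) else 0)"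
      by (simp add: DP(6) DQ(6) algebra_simps scl)
    finally show ?thesis .
  qed
  show ?thesis
    unfolding uq_fam_def using KK KK' KE KF EF serreE serreF EE FF by blast
qed

lemma evl_uq_rels:
  assumes P: "uq_fam q P" and q: "q \<noteq> 0" and p: "p \<in> uq_rels q r"
  shows "evl (wordL P) p = 0"
proof -
  note D = uq_famD[OF P]
  have c: "sc c * P x * P y = sc c * (P x * P y)" for c x y by (simp add: mult.assoc)
  have KE: "P (GenK i) * P (GenE j) * P (GenKinv i) = sc (q powi cartan i j) * P (GenE j)" for i j
    by (simp add: D(4) mult.assoc D(1))
  have KF: "P (GenK i) * P (GenF j) * P (GenKinv i) = sc (q powi (- cartan i j)) * P (GenF j)" for i j
    by (simp add: D(5) mult.assoc D(1))
  have serre: "evl (wordL P) p = 0" if "p \<in> serre q (\<lambda>i. gen (X i)) I"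
    "\<And>i j. \<bar>i - j\<bar> = 1 \<Longrightarrow> qserre q (P (X i)) (P (X j))"
    "\<And>i j. \<bar>i - j\<bar> > 1 \<Longrightarrow> P (X i) * P (X j) = P (X j) * P (X i)" for p X I
    using that(1) unfolding serre_def
    by (auto simp: evl_add evl_diff evl_scale that(2)[unfolded qserre_def] that(3))
  show ?thesis
    using p unfolding uq_rels_def Let_def
    by (elim UnE; (elim serre)?)
      (auto simp: evl_add evl_diff evl_scale D(1,2) KE KF D(6) intro: D(3,7,8,9,10))
qed

subsection \<open>Operators at a single tensor position\<close>

lemma app_lin: "app A (lin u v) = lin (\<lambda>b. app A (u b)) v"
  by (simp add: lin_def app_linear)

lemma lin_app: "lin u (app A v) = lin (\<lambda>b. lin u (app A (bas b))) v"
proof (induct v rule: pm_induct)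
  case (single c b)
  then show ?case by (simp add: app_scale lin_scale)
qed (simp add: app_add lin_add)

lemma lin_lin_commute: "lin (\<lambda>a. lin (\<lambda>b. u a b) w) v = lin (\<lambda>b. lin (\<lambda>a. u a b) v) w"
proof -
  show ?thesis
    unfolding lin_def sum_distrib_left
    by (subst sum.swap) (simp add: mult.assoc [symmetric] cst_commute [of "cst _"])
qed

lemma lin_cong: "(\<And>b. b \<in> Poly_Mapping.keys v \<Longrightarrow> u b = u' b) \<Longrightarrow> lin u v = lin u' v"
  by (simp add: lin_def)

lemma lin_0 [simp]: "lin u 0 = 0" "lin (\<lambda>_. 0) v = 0"
  by (simp_all add: lin_def)

definition site :: "nat \<Rightarrow> (rat, 'k::comm_ring_1) lop \<Rightarrow> (rat list, 'k) lop" where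
  "site p Y = Lin (\<lambda>f. if p < length f then lin (\<lambda>a. bas (f[p := a])) (app Y (bas (f ! p))) else 0)"

text \<open>\<open>site p 1\<close> vanishes on words without a position \<open>p\<close>; this
  projection completes it to the identity.\<close>

definition short :: "nat \<Rightarrow> (rat list, 'k::comm_ring_1) lop" where
  "short p = Lin (\<lambda>f. if p < length f then 0 else bas f)"

lemma app_site: "app (site p Y) (bas f) =
    (if p < length f then lin (\<lambda>a. bas (f[p := a])) (app Y (bas (f ! p))) else 0)"
  by (simp add: site_def)

lemma app_short: "app (short p) (bas f) = (if p < length f then 0 else bas f)"
  by (simp add: short_def)

lemma site_add: "site p (X + Y) = site p X + site p Y"
  by (rule lop_eqI) (simp add: app_site lin_add)

lemma lin_uminus: "lin u (- v) = - lin u v" for v :: "'b::monoid_add \<Rightarrow>\<^sub>0 'k::comm_ring_1"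
  using lin_scale[of u "- 1" v] by (simp add: cst_uminus)

lemma lin_diff: "lin u (v - w) = lin u v - lin u w" for v :: "'b::monoid_add \<Rightarrow>\<^sub>0 'k::comm_ring_1"
  using lin_add[of u v "- w"] by (simp add: lin_uminus)

lemma site_diff: "site p (X - Y) = site p X - site p Y"
  by (rule lop_eqI) (simp add: app_site lin_diff)

lemma site_scale: "site p (sc c * X) = sc c * site p X"
  by (rule lop_eqI) (simp add: app_site lin_scale)

lemma site_0 [simp]: "site p 0 = 0"
  by (rule lop_eqI) (simp add: app_site)

lemma site_mult: "site p X * site p Y = site p (X * Y)"
proof (rule lop_eqI)
  fix f
  show "app (site p X * site p Y) (bas f) = app (site p (X * Y)) (bas f)"
  proof (cases "p < length f")
    case True
    have "lin (\<lambda>b. bas (f[p := b])) (app X (app Y (bas (f ! p))))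
       = lin (\<lambda>a. lin (\<lambda>b. bas (f[p := b])) (app X (bas a))) (app Y (bas (f ! p)))"
      by (rule lin_app)
    then show ?thesis using True by (simp add: app_site app_lin)
  qed (simp add: app_site)
qed

lemma site_commute:
  assumes "p \<noteq> p'"
  shows "site p X * site p' Y = site p' Y * site p X"
proof (rule lop_eqI)
  fix f
  show "app (site p X * site p' Y) (bas f) = app (site p' Y * site p X) (bas f)"
  proof (cases "p < length f \<and> p' < length f")
    case True
    then have "app (site p X * site p' Y) (bas f) =
       lin (\<lambda>a. lin (\<lambda>b. bas (f[p' := a, p := b])) (app X (bas (f ! p)))) (app Y (bas (f ! p')))"
      using assms by (simp add: app_site app_lin)
    also have "\<dots> = lin (\<lambda>b. lin (\<lambda>a. bas (f[p' := a, p := b])) (app Y (bas (f ! p')))) (app X (bas (f ! p)))"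
      by (rule lin_lin_commute)
    also have "\<dots> = lin (\<lambda>b. lin (\<lambda>a. bas (f[p := b, p' := a])) (app Y (bas (f ! p')))) (app X (bas (f ! p)))"
      using assms by (simp add: list_update_swap)
    also have "\<dots> = app (site p' Y * site p X) (bas f)"
      using True assms by (simp add: app_site app_lin)
    finally show ?thesis .
  next
    case False
    then show ?thesis by (auto simp: app_site app_lin)
  qed
qed

lemma site_short: "site p X * short p = 0" "short p * site p X = 0" "short p * short p = short p"
  by (rule lop_eqI; simp add: app_site app_short app_lin)+

lemma site_1: "site p 1 + short p = 1"
  by (rule lop_eqI) (simp add: app_site app_short)

lemma site_short_commute: "site p X * short p' = short p' * site p X" if "p \<noteq> p'"
  by (rule lop_eqI) (auto simp: app_site app_short app_lin)

lemma short_commute: "short p * short p' = short p' * short p"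
  by (rule lop_eqI) (simp add: app_short)

text \<open>
  Lists without a position \<open>p\<close> carry the scalar \<open>c\<close>.  With the counit as \<open>c\<close> this keeps the
  defining relations valid on all of the free module on lists.
\<close>

definition aug :: "nat \<Rightarrow> 'k \<Rightarrow> (rat, 'k) lop \<Rightarrow> (rat list, 'k::comm_ring_1) lop" where
  "aug p c Y = site p Y + sc c * short p"

lemma aug_add: "aug p c X + aug p d Y = aug p (c + d) (X + Y)"
  by (simp add: aug_def site_add sc_add algebra_simps)

lemma aug_diff: "aug p c X - aug p d Y = aug p (c - d) (X - Y)"
  by (simp add: aug_def site_diff sc_diff algebra_simps)

lemma aug_mult: "aug p c X * aug p d Y = aug p (c * d) (X * Y)"
proof -
  have "sc c * short p * (sc d * short p) = sc (c * d) * (short p :: (rat list, 'a) lop)"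
    by (simp add: mult.assoc sc_commute_left[of "short p"] site_short sc_mult)
  moreover have "site p X * (sc d * short p) = 0" "sc c * short p * site p Y = 0"
    by (simp_all add: sc_commute_left[of "site p X"] site_short mult.assoc)
  ultimately show ?thesis by (simp add: aug_def distrib_left distrib_right site_mult)
qed

lemma aug_scale: "sc e * aug p c X = aug p (e * c) (sc e * X)"
  by (simp add: aug_def site_scale distrib_left sc_mult mult.assoc)

lemma aug_1 [simp]: "aug p 1 1 = 1"
  by (simp add: aug_def site_1)

lemma aug_0 [simp]: "aug p 0 0 = 0"
  by (simp add: aug_def)

lemma aug_commute:
  assumes "p \<noteq> p'"
  shows "aug p c X * aug p' d Y = aug p' d Y * aug p c X"
proof -
  have l: "site p X * (short p' * z) = short p' * (site p X * z)"
    "short p * (site p' Y * z) = site p' Y * (short p * z)" for z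
    using site_short_commute[OF assms, of X] site_short_commute[OF assms[symmetric], of Y]
    by (simp_all add: mult.assoc [symmetric])
  show ?thesis
    using assms
    by (simp add: aug_def distrib_left distrib_right mult.assoc sc_commute_left[of "site _ _"]
      sc_commute_left[of "short _"] site_commute[of p p'] site_short_commute[of p p'] l short_commute[of p p']
      site_short_commute[of p' p, symmetric] sc_sc_left mult.commute[of c d])
qed

text \<open>Integer labels for the half-integers: \<open>E_i\<close> and \<open>F_i\<close> link
  \<open>hf i\<close> with \<open>hf (i + 1)\<close>, and negation becomes
  \<open>i \<mapsto> 1 - i\<close>.\<close>

definition hf :: "int \<Rightarrow> rat" where
  "hf i = of_int i - 1/2"

lemma hf_eq [simp]: "hf i = hf j \<longleftrightarrow> i = j"
  by (simp add: hf_def)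

lemma hf_eqs: "of_int i - 1/2 = hf i" "of_int i + 1/2 = hf (i + 1)"
  by (simp_all add: hf_def)

fun natop_basis :: "'k::field \<Rightarrow> uq_gen \<Rightarrow> rat \<Rightarrow> (rat \<Rightarrow>\<^sub>0 'k)" where
  "natop_basis q (GenE i) j = (if j = hf (i + 1) then bas (hf i) else 0)"
| "natop_basis q (GenF i) j = (if j = hf i then bas (hf (i + 1)) else 0)"
| "natop_basis q (GenK i) j =
     cst (if j = hf i then q else if j = hf (i + 1) then inverse q else 1) * bas j"
| "natop_basis q (GenKinv i) j =
     cst (if j = hf i then inverse q else if j = hf (i + 1) then q else 1) * bas j"

definition natop :: "'k::field \<Rightarrow> uq_gen \<Rightarrow> (rat, 'k) lop" where
  "natop q g = Lin (natop_basis q g)"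

lemma app_natop: "app (natop q g) (bas j) = natop_basis q g j"
  by (simp add: natop_def)

fun counit :: "uq_gen \<Rightarrow> 'k::field" where
  "counit (GenE i) = 0" | "counit (GenF i) = 0" | "counit (GenK i) = 1" | "counit (GenKinv i) = 1"

definition sitefam :: "'k::field \<Rightarrow> nat \<Rightarrow> uq_gen \<Rightarrow> (rat list, 'k) lop" where
  "sitefam q p g = aug p (counit g) (natop q g)"

text \<open>A product of two E operators, or of two F operators, can be nonzero only for
  neighbouring indices in one order, so every cubic monomial of a Serre relation vanishes by
  itself.\<close>

lemma uq_fam_natop:
  assumes q: "q \<noteq> 0" and qq: "q \<noteq> inverse q"
  shows "uq_fam q (natop q)"
proof -
  have E: "natop q (GenE i) * natop q (GenE j) = 0" if "j \<noteq> i + 1" for i j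
    using that by (intro lop_eqI) (simp add: app_natop)
  have F: "natop q (GenF i) * natop q (GenF j) = 0" if "i \<noteq> j + 1" for i j
    using that by (intro lop_eqI) (simp add: app_natop)
  have "natop q (GenE i) * (natop q (GenE j) * natop q (GenE i)) = 0" for i j
    using E[of j i] E[of i j] by (cases "j = i + 1") (simp_all add: mult.assoc [symmetric])
  moreover have "natop q (GenF i) * (natop q (GenF j) * natop q (GenF i)) = 0" for i j
    using F[of j i] F[of i j] by (cases "j = i + 1") (simp_all add: mult.assoc [symmetric])
  ultimately have serre: "qserre q (natop q (GenE i)) (natop q (GenE j))"
    "qserre q (natop q (GenF i)) (natop q (GenF j))" for i j
    by (simp_all add: qserre_def E F) (simp_all add: mult.assoc E F)
  have K: "natop q (GenK i) * natop q (GenKinv i) = 1" "natop q (GenKinv i) * natop q (GenK i) = 1" for i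
    using q by (intro lop_eqI; auto simp: app_natop app_scale cst_mult_assoc)+
  have KK: "natop q (GenK i) * natop q (GenK j) = natop q (GenK j) * natop q (GenK i)" for i j
    using q by (intro lop_eqI; auto simp: app_natop app_scale cst_mult_assoc)
  have pw: "q powi 2 = q * q" "q powi - 2 = inverse q * inverse q" "q powi - 1 = inverse q"
    "inverse q * (q * q) = q" "q * (inverse q * inverse q) = inverse q"
    "q * q * inverse q = q" "inverse q * inverse q * q = inverse q" "inverse q * q\<^sup>2 = q"
    using q by (simp_all add: power2_eq_square power_int_minus)
  have KE: "natop q (GenK i) * natop q (GenE j) = sc (q powi cartan i j) * (natop q (GenE j) * natop q (GenK i))" for i j
    using q by (intro lop_eqI)
      (auto simp: app_natop app_scale cst_mult_assoc cartan_def pw)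
  have KF: "natop q (GenK i) * natop q (GenF j) = sc (q powi (- cartan i j)) * (natop q (GenF j) * natop q (GenK i))" for i j
    using q by (intro lop_eqI)
      (auto simp: app_natop app_scale cst_mult_assoc cartan_def pw)
  have EF: "natop q (GenE i) * natop q (GenF j) - natop q (GenF j) * natop q (GenE i) =
       (if i = j then sc (inverse (q - inverse q)) * (natop q (GenK i) - natop q (GenKinv i)) else 0)" for i j
  proof (cases "i = j")
    case True
    have *: "cst (inverse (q - inverse q)) * (cst q * v - cst (inverse q) * v) = v"
      "cst (inverse (q - inverse q)) * (cst (inverse q) * v - cst q * v) = - v" for v :: "rat \<Rightarrow>\<^sub>0 'a"
    proof -
      have "cst (inverse (q - inverse q)) * (cst q * v - cst (inverse q) * v)
        = cst (inverse (q - inverse q) * (q - inverse q)) * v"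
        by (simp only: cst_mult cst_diff mult.assoc left_diff_distrib)
      then show "cst (inverse (q - inverse q)) * (cst q * v - cst (inverse q) * v) = v"
        using qq by simp
      then show "cst (inverse (q - inverse q)) * (cst (inverse q) * v - cst q * v) = - v"
        by (metis minus_diff_eq mult_minus_right)
    qed
    show ?thesis
      unfolding True by (intro lop_eqI) (auto simp: app_natop *)
  next
    case False
    then show ?thesis
      by (intro lop_eqI) (auto simp: app_natop)
  qed
  have comm: "natop q (GenE i) * natop q (GenE j) = natop q (GenE j) * natop q (GenE i)"
    "natop q (GenF i) * natop q (GenF j) = natop q (GenF j) * natop q (GenF i)" if "1 < \<bar>i - j\<bar>" for i j
  proof -
    have "i \<noteq> j + 1" "j \<noteq> i + 1" using that by auto
    then show "natop q (GenE i) * natop q (GenE j) = natop q (GenE j) * natop q (GenE i)"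
      "natop q (GenF i) * natop q (GenF j) = natop q (GenF j) * natop q (GenF i)"
      using E[of i j] E[of j i] F[of i j] F[of j i] by metis+
  qed
  show ?thesis
    unfolding uq_fam_def using K KK KE KF EF serre comm by blast
qed

text \<open>\<open>aug p\<close> respects sums, products and scalars in the pair of a number and a
  one-site operator, so a relation holds once the counit and the natural operators satisfy it
  separately.\<close>

lemma uq_fam_sitefam:
  assumes q: "q \<noteq> 0" and qq: "q \<noteq> inverse q"
  shows "uq_fam q (sitefam q p)"
proof -
  note D = uq_famD[OF uq_fam_natop[OF q qq]]
  note a = aug_mult aug_scale aug_diff aug_add
  show ?thesis
    unfolding uq_fam_def sitefam_def qserre_def
  proof (intro conjI allI impI)
    fix i j :: int
    assume *: "\<bar>i - j\<bar> = 1"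
    from D(7)[OF *, unfolded qserre_def] D(8)[OF *, unfolded qserre_def]
    show "aug p (counit (GenE i)) (natop q (GenE i)) * aug p (counit (GenE i)) (natop q (GenE i)) *
        aug p (counit (GenE j)) (natop q (GenE j)) -
      sc (q + inverse q) * (aug p (counit (GenE i)) (natop q (GenE i)) *
        aug p (counit (GenE j)) (natop q (GenE j)) * aug p (counit (GenE i)) (natop q (GenE i))) +
      aug p (counit (GenE j)) (natop q (GenE j)) * aug p (counit (GenE i)) (natop q (GenE i)) *
        aug p (counit (GenE i)) (natop q (GenE i)) = 0"
      "aug p (counit (GenF i)) (natop q (GenF i)) * aug p (counit (GenF i)) (natop q (GenF i)) *
        aug p (counit (GenF j)) (natop q (GenF j)) -
      sc (q + inverse q) * (aug p (counit (GenF i)) (natop q (GenF i)) *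
        aug p (counit (GenF j)) (natop q (GenF j)) * aug p (counit (GenF i)) (natop q (GenF i))) +
      aug p (counit (GenF j)) (natop q (GenF j)) * aug p (counit (GenF i)) (natop q (GenF i)) *
        aug p (counit (GenF i)) (natop q (GenF i)) = 0"
      by (simp_all add: a)
  next
    fix i j :: int
    assume *: "1 < \<bar>i - j\<bar>"
    show "aug p (counit (GenE i)) (natop q (GenE i)) * aug p (counit (GenE j)) (natop q (GenE j)) =
      aug p (counit (GenE j)) (natop q (GenE j)) * aug p (counit (GenE i)) (natop q (GenE i))"
      "aug p (counit (GenF i)) (natop q (GenF i)) * aug p (counit (GenF j)) (natop q (GenF j)) =
      aug p (counit (GenF j)) (natop q (GenF j)) * aug p (counit (GenF i)) (natop q (GenF i))"
      by (simp_all add: a D(9,10)[OF *])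
  next
    fix i j
    show "aug p (counit (GenK i)) (natop q (GenK i)) * aug p (counit (GenK j)) (natop q (GenK j)) =
      aug p (counit (GenK j)) (natop q (GenK j)) * aug p (counit (GenK i)) (natop q (GenK i))"
      by (simp add: a D(3)[of i j])
  qed (simp_all add: a D(1,2,4,5,6))
qed

lemma sitefam_commute: "p \<noteq> p' \<Longrightarrow> sitefam q p g * sitefam q p' h = sitefam q p' h * sitefam q p g"
  unfolding sitefam_def by (rule aug_commute)

text \<open>The counit is neutral for \<open>coprod\<close>, so the iteration may start with no
  tensor factor at all.\<close>

primrec fam :: "'k::field \<Rightarrow> nat \<Rightarrow> uq_gen \<Rightarrow> (rat list, 'k) lop" where
  "fam q 0 = (\<lambda>g. sc (counit g))"
| "fam q (Suc n) = coprod (fam q n) (sitefam q n)"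

lemma fam_commute:
  assumes "\<And>p g. p < n \<Longrightarrow> A * sitefam q p g = sitefam q p g * A"
  shows "A * fam q n g = fam q n g * A"
  using assms
proof (induct n arbitrary: g)
  case 0
  then show ?case by (simp add: sc_commute)
next
  case (Suc n)
  have 1: "A * fam q n h = fam q n h * A" "A * sitefam q n h = sitefam q n h * A" for h
    using Suc by simp_all
  have 2: "A * (fam q n h * z) = fam q n h * (A * z)" for h z
    using 1 by (simp add: mult.assoc [symmetric])
  show ?case by (cases g) (simp_all add: distrib_left distrib_right 1 2 mult.assoc)
qed

lemma uq_fam_fam:
  assumes q: "q \<noteq> 0" and qq: "q \<noteq> inverse q"
  shows "uq_fam q (fam q n)"
proof (induct n)
  case 0
  show ?case
    by (simp add: uq_fam_def qserre_def mult.assoc sc_mult [symmetric])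
next
  case (Suc n)
  then show ?case
    using q qq by (auto intro!: uq_fam_coprod uq_fam_sitefam fam_commute sitefam_commute)
qed

subsection \<open>The action on tensor space as an iterated coproduct\<close>

definition sp :: "'b set \<Rightarrow> ('b \<Rightarrow>\<^sub>0 'k::comm_ring_1) set" where
  "sp S = {v. Poly_Mapping.keys v \<subseteq> S}"

lemma sp_bas: "b \<in> S \<Longrightarrow> bas b \<in> sp S"
  by (simp add: sp_def)

lemma sp_0: "0 \<in> sp S"
  by (simp add: sp_def)

lemma sp_add: "v \<in> sp S \<Longrightarrow> w \<in> sp S \<Longrightarrow> v + w \<in> sp S"
  using keys_add[of v w] by (auto simp: sp_def)

lemma sp_scale: "v \<in> sp S \<Longrightarrow> cst c * v \<in> sp S"
proof -
  have "Poly_Mapping.keys (cst c * v) \<subseteq> Poly_Mapping.keys v"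
    by (auto simp: in_keys_iff)
  then show "v \<in> sp S \<Longrightarrow> cst c * v \<in> sp S" by (auto simp: sp_def)
qed

lemma sp_uminus: "v \<in> sp S \<Longrightarrow> - v \<in> sp S"
  by (simp add: sp_def keys_uminus)

lemma sp_diff: "v \<in> sp S \<Longrightarrow> w \<in> sp S \<Longrightarrow> v - w \<in> sp S"
  using sp_add[of v S "- w"] sp_uminus[of w S] by simp

lemma sp_sum: "(\<And>x. x \<in> X \<Longrightarrow> g x \<in> sp S) \<Longrightarrow> sum g X \<in> sp S"
  by (induct X rule: infinite_finite_induct) (auto simp: sp_0 sp_add)

lemma sp_lin: "(\<And>b. b \<in> Poly_Mapping.keys v \<Longrightarrow> u b \<in> sp S) \<Longrightarrow> lin u v \<in> sp S"
  unfolding lin_def by (intro sp_sum sp_scale)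

lemmas sp_closed = sp_bas sp_0 sp_add sp_scale sp_uminus sp_diff

lemma sp_induct [consumes 1, case_names zero single add]:
  fixes v :: "'b::monoid_add \<Rightarrow>\<^sub>0 'k::comm_ring_1"
  assumes "v \<in> sp S" "P 0" "\<And>c b. b \<in> S \<Longrightarrow> P (cst c * bas b)" "\<And>v w. P v \<Longrightarrow> P w \<Longrightarrow> P (v + w)"
  shows "P v"
proof -
  have "P (\<Sum>b\<in>T. cst (Poly_Mapping.lookup v b) * bas b)" if "finite T" "T \<subseteq> S" for T
    using that by induct (auto intro: assms)
  from this[of "Poly_Mapping.keys v"] pm_expand[of "Poly_Mapping.keys v" v] assms(1) show ?thesis
    by (simp add: sp_def)
qed

lemma app_eq_on:
  assumes "\<And>b. b \<in> S \<Longrightarrow> app A (bas b) = app B (bas b)" and "v \<in> sp S"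
  shows "app A v = app B v"
  using assms(2) by (induct rule: sp_induct) (simp_all add: app_linear assms(1))

definition pres :: "'b set \<Rightarrow> ('b::monoid_add, 'k::comm_ring_1) lop \<Rightarrow> bool" where
  "pres S A \<longleftrightarrow> (\<forall>b\<in>S. app A (bas b) \<in> sp S)"

lemma pres_app: "pres S A \<Longrightarrow> v \<in> sp S \<Longrightarrow> app A v \<in> sp S"
  by (subst app_expand, rule sp_lin) (auto simp: pres_def sp_def)

lemma pres_closed:
  "pres S 0" "pres S 1" "pres S (sc c)" "pres S A \<Longrightarrow> pres S B \<Longrightarrow> pres S (A + B)"
  "pres S A \<Longrightarrow> pres S B \<Longrightarrow> pres S (A - B)" "pres S A \<Longrightarrow> pres S B \<Longrightarrow> pres S (A * B)"
  using pres_app[of S A] by (auto simp: pres_def intro: sp_closed)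

lemma pres_sum: "(\<And>x. x \<in> X \<Longrightarrow> pres S (g x)) \<Longrightarrow> pres S (sum g X)"
  by (induct X rule: infinite_finite_induct) (auto intro: pres_closed)

lemma pres_evl:
  assumes "\<And>w. w \<in> Poly_Mapping.keys p \<Longrightarrow> pres S (u w)"
  shows "pres S (evl u p)"
  unfolding evl_def using assms by (intro pres_sum pres_closed)

lemma pres_wordL: "(\<And>g. g \<in> set w \<Longrightarrow> pres S (P g)) \<Longrightarrow> pres S (wordL P w)"
  by (induct w) (auto intro: pres_closed)

lemma pres_wordR: "(\<And>g. g \<in> set w \<Longrightarrow> pres S (P g)) \<Longrightarrow> pres S (wordR P w)"
  by (induct w) (auto intro: pres_closed)

lemma wordL_agree:
  assumes "\<And>g. g \<in> set w \<Longrightarrow> pres S (P g)"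
    and "\<And>g b. g \<in> set w \<Longrightarrow> b \<in> S \<Longrightarrow> app (P g) (bas b) = app (P' g) (bas b)" and "v \<in> sp S"
  shows "app (wordL P w) v = app (wordL P' w) v"
  using assms
proof (induct w)
  case (Cons g w)
  have "app (P g) (app (wordL P w) v) = app (P' g) (app (wordL P w) v)"
    by (rule app_eq_on[of S, OF _ pres_app[OF pres_wordL]]) (use Cons in auto)
  with Cons show ?case by simp
qed simp

definition Len :: "nat \<Rightarrow> rat list set" where
  "Len n = {f. length f = n}"

lemma lin_mult_right: "lin (\<lambda>a. u a * x) v = lin u v * x"
  by (simp add: lin_def sum_distrib_right mult.assoc)

lemma lin_mult_left: "lin (\<lambda>a. x * u a) v = x * lin u v"
  by (simp add: lin_def sum_distrib_left cst_commute_left)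

lemma aug_pres_Len: "pres (Len n) (aug p c Y)"
  unfolding pres_def aug_def
  by (auto simp: app_site app_short Len_def intro!: sp_closed sp_lin)

lemma sitefam_pres_Len: "pres (Len n) (sitefam q p g)"
  unfolding sitefam_def by (rule aug_pres_Len)

lemma coprod_pres:
  assumes "\<And>g. pres S (P g)" "\<And>g. pres S (Q g)"
  shows "pres S (coprod P Q g)"
  using assms by (cases g) (auto intro!: pres_closed)

lemma fam_pres_Len: "pres (Len n) (fam q k g)"
  by (induct k arbitrary: g) (auto intro: pres_closed coprod_pres sitefam_pres_Len)

lemma aug_mult_left:
  assumes "u \<in> sp (Len n)" "p < n"
  shows "app (aug p c Y) (u * v) = app (aug p c Y) u * v"
  using assms(1)
proof (induct rule: sp_induct)
  case (single d f)
  then have "app (aug p c Y) (bas f * v) = app (aug p c Y) (bas f) * v"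
  proof (induct v rule: pm_induct)
    case (single e h)
    have "app (aug p c Y) (bas (f @ h)) = app (aug p c Y) (bas f) * bas h"
      using single assms(2)
      by (simp add: aug_def app_site app_short Len_def nth_append list_update_append)
        (simp add: bas_append lin_mult_right)
    then show ?case by (simp add: cst_commute_left[of "bas f"] app_scale bas_append cst_commute_left[of "app _ _"])
  qed (simp add: distrib_left app_add)
  then show ?case by (simp add: app_scale mult.assoc)
qed (simp_all add: distrib_right app_add)

lemma aug_mult_right:
  assumes "u \<in> sp (Len n)"
  shows "app (aug (n + p) c Y) (u * v) = u * app (aug p c Y) v"
  using assms
proof (induct rule: sp_induct)
  case (single d f)
  then have "app (aug (n + p) c Y) (bas f * v) = bas f * app (aug p c Y) v"
  proof (induct v rule: pm_induct)
    case (single e h)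
    have "app (aug (n + p) c Y) (bas (f @ h)) = bas f * app (aug p c Y) (bas h)"
      using single
      by (simp add: aug_def app_site app_short Len_def nth_append list_update_append)
        (simp add: bas_append lin_mult_left cst_commute_left[of "bas f"])
    then show ?case by (simp add: cst_commute_left[of "bas f"] app_scale bas_append)
  qed (simp add: distrib_left app_add)
  then show ?case by (simp add: app_scale mult.assoc)
qed (simp_all add: distrib_right app_add)

lemma fam_mult_left:
  assumes "u \<in> sp (Len n)" "k \<le> n"
  shows "app (fam q k g) (u * v) = app (fam q k g) u * v"
  using assms
proof (induct k arbitrary: g u v)
  case 0
  then show ?case by (simp add: mult.assoc)
next
  case (Suc k)
  have "app (sitefam q k g) (u * v) = app (sitefam q k g) u * v" for g
    unfolding sitefam_def using Suc.prems by (intro aug_mult_left) auto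
  moreover have "app (sitefam q k g) u \<in> sp (Len n)" for g
    using Suc.prems by (intro pres_app sitefam_pres_Len)
  ultimately show ?case
    using Suc by (cases g) (simp_all add: distrib_right)
qed

lemma fam_word_mult_left:
  assumes "u \<in> sp (Len n)" "k \<le> n"
  shows "app (wordL (fam q k) w) (u * v) = app (wordL (fam q k) w) u * v"
proof (induct w)
  case (Cons g w)
  have "app (wordL (fam q k) w) u \<in> sp (Len n)"
    using assms by (intro pres_app pres_wordL fam_pres_Len)
  with Cons assms show ?case by (simp add: fam_mult_left)
qed simp

lemma sitefam_word_mult_right:
  assumes "u \<in> sp (Len n)"
  shows "app (wordL (sitefam q n) w) (u * v) = u * app (wordL (sitefam q 0) w) v"
  using assms aug_mult_right[of u n 0]
  by (induct w) (auto simp: sitefam_def)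

text \<open>\<open>nat_rep\<close> reads only the head of a word, so the comparison with the action
  at position 0 is confined to words of length one.\<close>

lemma nat_rep_site:
  assumes "v \<in> sp (Len 1)"
  shows "nat_rep q p v = app (evl (wordL (sitefam q 0)) p) v"
proof -
  define nop where "nop = (\<lambda>g. Lin (\<lambda>f. nat_rep_basis q g (hd f)))"
  have 1: "app (nop g) (bas b) = app (sitefam q 0 g) (bas b)" if b: "b \<in> Len 1" for g b
  proof -
    obtain a where "b = [a]" using b by (auto simp: Len_def length_Suc_conv)
    then show ?thesis
      by (cases g) (simp_all add: nop_def sitefam_def aug_def app_site app_short app_natop gen_def hf_eqs
          lin_scale)
  qed
  have 2: "pres (Len 1) (nop g)" for g
    using 1 sitefam_pres_Len[of 1 q 0 g] by (simp add: pres_def)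
  have "nat_rep q p v = app (evl (wordL nop) p) v"
    by (simp add: nat_rep_def nop_def app_Lin [symmetric] left_act_app)
  also have "\<dots> = app (evl (wordL (sitefam q 0)) p) v"
    unfolding app_evl by (intro lin_cong wordL_agree[of _ "Len 1"] 1 2 assms)
  finally show ?thesis .
qed

lemma evl_lin: "evl \<Theta> (lin u p) = evl (\<lambda>w. evl \<Theta> (u w)) p"
  for p :: "'c \<Rightarrow>\<^sub>0 'k::comm_ring_1"
proof -
  have "evl \<Theta> (sum g S) = (\<Sum>x\<in>S. evl \<Theta> (g x))" for g and S :: "'c set"
    by (induct S rule: infinite_finite_induct) (auto simp: evl_add)
  then show ?thesis by (simp add: lin_def evl_def[of _ p] evl_scale)
qed

lemma wordL_commute:
  assumes "\<And>g. A * P g = P g * A"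
  shows "A * wordL P w = wordL P w * A"
proof (induct w)
  case (Cons g w)
  have "A * (P g * wordL P w) = P g * (A * wordL P w)"
    by (simp add: mult.assoc [symmetric] assms)
  with Cons show ?case by (simp add: mult.assoc)
qed simp

text \<open>Both sides are multiplicative in \<open>p\<close>, the left one because the two families
  commute, and on letters they agree by the shape of \<open>coprod\<close>.\<close>

lemma evl_comult:
  fixes P Q :: "uq_gen \<Rightarrow> ('b::monoid_add, 'k::field) lop"
  assumes comm: "\<And>g h. Q g * P h = P h * Q g"
  defines "\<Theta> \<equiv> \<lambda>(a, b). wordL P a * wordL Q b"
  shows "evl \<Theta> (comult p) = evl (wordL (coprod P Q)) p"
proof -
  have sw: "wordL Q b * wordL P a = wordL P a * wordL Q b" for a b
  proof -
    have "wordL P a * Q g = Q g * wordL P a" for g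
      by (rule wordL_commute[OF comm, symmetric])
    then show ?thesis by (rule wordL_commute[symmetric])
  qed
  have mult: "\<Theta> (x + y) = \<Theta> x * \<Theta> y" for x y
  proof (cases x; cases y)
    fix a b c d assume *: "x = (a, b)" "y = (c, d)"
    then have "\<Theta> (x + y) = wordL P a * (wordL P c * wordL Q b) * wordL Q d"
      by (simp add: \<Theta>_def mult.assoc)
    also have "\<dots> = \<Theta> x * \<Theta> y"
      unfolding sw [symmetric] using * by (simp add: \<Theta>_def mult.assoc)
    finally show ?thesis .
  qed
  have gen: "evl \<Theta> (comult_gen g) = coprod P Q g" for g
    by (cases g) (simp_all add: \<Theta>_def evl_add)
  have "evl \<Theta> (prod_list (map comult_gen w)) = wordL (coprod P Q) w" for w
  proof (induct w)
    case Nil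
    have "\<Theta> 0 = 1" by (simp add: \<Theta>_def zero_prod_def)
    then show ?case using evl_cst[of \<Theta> 1] by simp
  next
    case (Cons g w)
    have "evl \<Theta> (comult_gen g * prod_list (map comult_gen w))
        = evl \<Theta> (comult_gen g) * evl \<Theta> (prod_list (map comult_gen w))"
      by (rule evl_mult[OF mult])
    then show ?case by (simp only: list.map prod_list.Cons Cons gen wordL_simps)
  qed
  then show ?thesis by (simp add: comult_def evl_lin)
qed

text \<open>Induction splits off the last factor: the leading positions see only the old family, and
  position \<open>Suc n\<close>, counted from 0, only the new one-site action.\<close>

lemma tensor_rep_fam:
  assumes "v \<in> sp (Len (Suc n))"
  shows "tensor_rep q n p v = app (evl (wordL (fam q (Suc n))) p) v"
  using assms
proof (induct n arbitrary: p v)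
  case 0
  have "fam q (Suc 0) = sitefam q 0"
  proof
    fix g show "fam q (Suc 0) g = sitefam q 0 g" by (cases g) simp_all
  qed
  with nat_rep_site[of v q p] 0 show ?case by (simp del: fam.simps)
next
  case (Suc n)
  define \<Theta> where "\<Theta> = (\<lambda>(a, b). wordL (fam q (Suc n)) a * wordL (sitefam q (Suc n)) b)"
  have sf: "sitefam q (Suc n) g * fam q (Suc n) h = fam q (Suc n) h * sitefam q (Suc n) g" for g h
    by (rule fam_commute) (auto intro: sitefam_commute)
  have 2: "evl \<Theta> (comult p) = evl (wordL (fam q (Suc (Suc n)))) p"
    unfolding \<Theta>_def fam.simps(2)[of q "Suc n"] by (rule evl_comult[OF sf])
  have ot: "op_tensor (Suc n) (tensor_rep q n (bas a)) (nat_rep q (bas b)) v = lin (\<lambda>f. app (\<Theta> (a, b)) (bas f)) v" for a b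
    unfolding op_tensor_def
  proof (rule lin_cong)
    fix f assume "f \<in> Poly_Mapping.keys v"
    then have f: "length f = Suc (Suc n)"
      using Suc.prems by (auto simp: sp_def Len_def)
    have t: "bas (take (Suc n) f) \<in> sp (Len (Suc n))" "bas (drop (Suc n) f) \<in> sp (Len 1)"
      using f by (auto intro!: sp_bas simp: Len_def)
    have "app (\<Theta> (a, b)) (bas f) = app (\<Theta> (a, b)) (bas (take (Suc n) f) * bas (drop (Suc n) f))"
      by (simp add: bas_append [symmetric])
    also have "\<dots> = app (wordL (fam q (Suc n)) a) (bas (take (Suc n) f)) * app (wordL (sitefam q 0) b) (bas (drop (Suc n) f))"
      by (simp add: \<Theta>_def sitefam_word_mult_right[OF t(1)] fam_word_mult_left[OF t(1) le_refl] del: fam.simps)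
    finally show "tensor_rep q n (bas a) (bas (take (Suc n) f)) * nat_rep q (bas b) (bas (drop (Suc n) f))
        = app (\<Theta> (a, b)) (bas f)"
      by (simp add: Suc.hyps[OF t(1)] nat_rep_site[OF t(2)] del: fam.simps)
  qed
  have "tensor_rep q (Suc n) p v = app (evl \<Theta> (comult p)) v"
    unfolding app_evl tensor_rep.simps ot
    by (rule lin_cong) (simp add: case_prod_unfold app_expand[symmetric])
  with 2 show ?case by simp
qed

section \<open>Basis words of tensor space and the map \<open>Phi\<close> on classes\<close>

definition Om :: "nat \<Rightarrow> nat \<Rightarrow> rat list set" where
  "Om N n = {f. length f = n \<and> set f \<subseteq> half_idx N}"

lemma tensor_space_sp: "tensor_space N n = sp (Om N n)"
  by (auto simp: tensor_space_def sp_def Om_def)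

lemma sp_mono: "S \<subseteq> T \<Longrightarrow> sp S \<subseteq> sp T"
  by (auto simp: sp_def)

lemma uq_rels_closed: "uq_rels q r \<subseteq> carrier (free_algebra (uq_gens r))"
proof -
  have g: "UE i \<in> carrier (free_algebra (uq_gens r))" "UF i \<in> carrier (free_algebra (uq_gens r))"
    "UK i \<in> carrier (free_algebra (uq_gens r))" "UKinv i \<in> carrier (free_algebra (uq_gens r))"
    if "i \<in> int_idx (r + 1)" for i
    using that by (auto simp: uq_gens_def intro!: free_algebra_closed(5))
  show ?thesis
    unfolding uq_rels_def Let_def serre_def
    by (auto intro!: free_algebra_closed g)
qed

lemma Phi_cls:
  fixes q :: "'k::field"
  assumes q: "q \<noteq> 0" "q \<noteq> inverse q" and m: "m \<ge> 1" and p: "p \<in> carrier (free_algebra (uq_gens r))"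
  shows "Phi q r m (cls (uq_gens r) (uq_rels q r) p) =
    restrict (app (evl (wordL (fam q m)) p)) (tensor_space (2*r + 4) m)"
  unfolding Phi_def
proof (rule induced_cls[OF uq_rels_closed])
  fix p :: "uq_gen list \<Rightarrow>\<^sub>0 'k" and v :: "rat list \<Rightarrow>\<^sub>0 'k" assume "v \<in> tensor_space (2*r + 4) m"
  then have "v \<in> sp (Len (Suc (m - 1)))"
    using m sp_mono[of "Om (2*r+4) m" "Len m"] by (auto simp: tensor_space_sp Om_def Len_def)
  from tensor_rep_fam[OF this, of q p] m
  show "tensor_rep q (m - 1) p v = app (evl (wordL (fam q m)) p) v" by simp
next
  show "evl (wordL (fam q m)) p = 0" if "p \<in> uq_rels q r" for p
    using evl_uq_rels[OF uq_fam_fam[OF q] q(1) that] .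
qed (use p in auto)

subsection \<open>Hecke operators\<close>

text \<open>The label set is not symmetric about 0 because \<open>hf\<close> shifts by one
  half.\<close>

lemma half_idx_hf: "half_idx (2 * s) = hf ` {1 - int s..int s}"
proof -
  have "(\<lambda>k. of_nat k - (of_nat (2 * s) - 1) / 2 :: rat) k = hf (int k + 1 - int s)" for k
    by (simp add: hf_def field_simps)
  then have "half_idx (2 * s) = hf ` ((\<lambda>k. int k + 1 - int s) ` {..<2 * s})"
    unfolding half_idx_def image_image by (intro image_cong) auto
  also have "(\<lambda>k. int k + 1 - int s) ` {..<2 * s} = {1 - int s..int s}"
  proof (intro equalityI subsetI)
    fix x assume "x \<in> {1 - int s..int s}"
    then show "x \<in> (\<lambda>k. int k + 1 - int s) ` {..<2 * s}"
      by (intro image_eqI[of _ _ "nat (x + int s - 1)"]) auto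
  qed auto
  finally show ?thesis .
qed

lemma hf_uminus: "- hf i = hf (1 - i)"
  by (simp add: hf_def)

lemma hf_less [simp]: "hf i < hf j \<longleftrightarrow> i < j"
  by (simp add: hf_def)

lemma hf_pos [simp]: "0 < hf i \<longleftrightarrow> 1 \<le> i"
proof -
  have "0 < hf i \<longleftrightarrow> (1 :: rat) < of_int (2 * i)" by (simp add: hf_def mult.commute)
  also have "\<dots> \<longleftrightarrow> 1 < 2 * i" by (rule of_int_1_less_iff)
  finally show ?thesis by auto
qed

lemma half_idx_uminus: "x \<in> half_idx (2 * s) \<Longrightarrow> - x \<in> half_idx (2 * s)"
  unfolding half_idx_hf by (auto simp: hf_uminus)

lemma half_idx_nonzero: "x \<in> half_idx (2 * s) \<Longrightarrow> x \<noteq> 0"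
proof -
  assume "x \<in> half_idx (2 * s)"
  then obtain i where "x = hf i" by (auto simp: half_idx_hf)
  then have "0 < x \<or> 0 < - x" by (auto simp: hf_uminus)
  then show "x \<noteq> 0" by auto
qed

text \<open>Words outside the tensor space carry the scalar \<open>q^-1\<close>. This is a
  one-dimensional representation of the Hecke algebra, so the relations hold on the whole free
  module.\<close>

definition hop :: "'k::field \<Rightarrow> nat \<Rightarrow> nat \<Rightarrow> nat \<Rightarrow> (rat list, 'k) lop" where
  "hop q N l i = Lin (\<lambda>f. if f \<in> Om N l then hecke_op_basis q i f else cst (inverse q) * bas f)"

lemma app_hop: "app (hop q N l i) (bas f) =
    (if f \<in> Om N l then hecke_op_basis q i f else cst (inverse q) * bas f)"
  by (simp add: hop_def)

lemma hecke_op_Suc: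
  assumes "length u = i"
  shows "hecke_op_basis q (Suc i) (u @ a # b # w) =
    (if a = b then cst (inverse q) * bas (u @ a # b # w)
     else if a < b then bas (u @ b # a # w)
     else bas (u @ b # a # w) + cst (inverse q - q) * bas (u @ a # b # w))"
  using assms by (simp add: hecke_op_basis_def Let_def nth_append list_update_append)

lemma hecke_op_0:
  "hecke_op_basis q 0 (a # w) =
    (if a > 0 then bas (- a # w) else bas (- a # w) + cst (inverse q - q) * bas (a # w))"
  by (simp add: hecke_op_basis_def Let_def)

lemma hop_Suc:
  assumes "length u = i" "u @ a # b # w \<in> Om N l"
  shows "app (hop q N l (Suc i)) (bas (u @ a # b # w)) =
    (if a = b then cst (inverse q) * bas (u @ a # b # w)
     else if a < b then bas (u @ b # a # w)
     else bas (u @ b # a # w) + cst (inverse q - q) * bas (u @ a # b # w))"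
  using assms by (simp only: app_hop hecke_op_Suc if_True)

lemma hop_Suc2:
  assumes "length u + length v = i" "u @ v @ a # b # w \<in> Om N l"
  shows "app (hop q N l (Suc i)) (bas (u @ v @ a # b # w)) =
    (if a = b then cst (inverse q) * bas (u @ v @ a # b # w)
     else if a < b then bas (u @ v @ b # a # w)
     else bas (u @ v @ b # a # w) + cst (inverse q - q) * bas (u @ v @ a # b # w))"
  using hop_Suc[of "u @ v" i a b w N l q] assms by simp

lemma hop_0:
  assumes "a # w \<in> Om N l"
  shows "app (hop q N l 0) (bas (a # w)) =
    (if a > 0 then bas (- a # w) else bas (- a # w) + cst (inverse q - q) * bas (a # w))"
  using assms by (simp only: app_hop hecke_op_0 if_True)

lemma Om_split:
  assumes "f \<in> Om N l" "Suc i < l"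
  obtains u a b w where "f = u @ a # b # w" "length u = i"
proof -
  have l: "length f = l" using assms by (simp add: Om_def)
  have "f = take i f @ f ! i # drop (Suc i) f"
    using assms l by (intro id_take_nth_drop) auto
  also have "drop (Suc i) f = f ! Suc i # drop (Suc (Suc i)) f"
    using assms l by (intro Cons_nth_drop_Suc[symmetric]) auto
  finally show ?thesis using that[of "take i f"] assms l by auto
qed

lemma hop_pres:
  assumes "i < l"
  shows "pres (Om (2 * s) l) (hop q (2 * s) l i)"
  unfolding pres_def
proof
  fix f assume f: "f \<in> Om (2 * s) l"
  show "app (hop q (2 * s) l i) (bas f) \<in> sp (Om (2 * s) l)"
  proof (cases i)
    case 0
    then obtain a w where "f = a # w" using f assms by (cases f) (auto simp: Om_def)
    with f 0 show ?thesis
      by (auto simp: hop_0 Om_def half_idx_uminus intro!: sp_closed)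
  next
    case (Suc j)
    then obtain u a b w where "f = u @ a # b # w" "length u = j"
      using f assms by (auto elim: Om_split)
    with f Suc show ?thesis
      by (auto simp: hop_Suc Om_def intro!: sp_closed)
  qed
qed

text \<open>The type B relations, with the quadratic one solved for the square.\<close>

definition hecke_fam :: "'k::field \<Rightarrow> nat \<Rightarrow> (nat \<Rightarrow> ('b::monoid_add, 'k) lop) \<Rightarrow> bool" where
  "hecke_fam q l P \<longleftrightarrow>
     (\<forall>i<l. P i * P i = 1 + sc (inverse q - q) * P i) \<and>
     (\<forall>i. 1 \<le> i \<and> i + 1 < l \<longrightarrow> P i * P (i + 1) * P i = P (i + 1) * P i * P (i + 1)) \<and>
     (\<forall>i j. i + 1 < j \<and> j < l \<longrightarrow> P i * P j = P j * P i) \<and>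
     (2 \<le> l \<longrightarrow> P 0 * P 1 * P 0 * P 1 = P 1 * P 0 * P 1 * P 0)"

lemma evl_hecke_rels:
  assumes P: "hecke_fam q l P" and q: "q \<noteq> 0" and h: "\<And>i. i < l \<Longrightarrow> evl (wordR P') (h i) = P i"
    and p: "p \<in> hecke_rels_for q l h"
  shows "evl (wordR P') p = 0"
proof -
  have quad: "(P i + sc q) * (P i - sc (inverse q)) = 0" if "i < l" for i
  proof -
    have "(P i + sc q) * (P i - sc (inverse q)) = P i * P i + sc (q - inverse q) * P i - sc (q * inverse q)"
      by (simp add: algebra_simps sc_commute[of "P i"] sc_mult sc_diff)
    also have "P i * P i = 1 - sc (q - inverse q) * P i"
      using P that by (simp add: hecke_fam_def sc_diff algebra_simps)
    finally show ?thesis using q by simp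
  qed
  have comm: "P i * P j = P j * P i" if "\<bar>int i - int j\<bar> > 1" "i < l" "j < l" for i j
  proof -
    have "i + 1 < j \<or> j + 1 < i" using that by auto
    then show ?thesis using P that unfolding hecke_fam_def by metis
  qed
  have 3: "P i * P (i + 1) * P i = P (i + 1) * P i * P (i + 1)" if "1 \<le> i" "i + 1 < l" for i
    using P that unfolding hecke_fam_def by blast
  have 4: "P 0 * P 1 * P 0 * P 1 = P 1 * P 0 * P 1 * P 0" if "2 \<le> l"
    using P that unfolding hecke_fam_def by blast
  show ?thesis
    using p unfolding hecke_rels_for_def
  proof (elim UnE)
    assume "p \<in> {(h i - cst (inverse q)) * (h i + cst q) |i. i < l}"
    then show ?thesis using quad by (auto simp: evl_diff evl_add h)
  next
    assume "p \<in> {h i * h (i + 1) * h i - h (i + 1) * h i * h (i + 1) |i. 1 \<le> i \<and> i + 1 < l}"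
    then obtain i where i: "p = h i * h (i + 1) * h i - h (i + 1) * h i * h (i + 1)" "1 \<le> i" "i + 1 < l" by blast
    then show ?thesis using 3[of i] by (simp add: evl_diff h mult.assoc)
  next
    assume "p \<in> {h i * h j - h j * h i |i j. i < l \<and> j < l \<and> 1 < \<bar>int i - int j\<bar>}"
    then obtain i j where i: "p = h i * h j - h j * h i" "i < l" "j < l" "1 < \<bar>int i - int j\<bar>" by blast
    then show ?thesis using comm[of i j] by (simp add: evl_diff h)
  next
    assume "p \<in> (if 2 \<le> l then {h 0 * h 1 * h 0 * h 1 - h 1 * h 0 * h 1 * h 0} else {})"
    then show ?thesis using 4 h[of 0] h[of 1] by (auto simp: evl_diff mult.assoc split: if_splits)
  qed
qed

lemma Om_swap: "u @ a # b # w \<in> Om N l \<Longrightarrow> u @ b # a # w \<in> Om N l"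
  by (auto simp: Om_def)

text \<open>Every relation moves at most four letters, and a Hecke operator depends only on the
  order or the sign of the letters it moves; comparing these letters exhausts the cases.\<close>

lemma hecke_fam_hop:
  fixes q :: "'k::field"
  assumes q: "q \<noteq> 0"
  shows "hecke_fam q l (hop q (2 * s) l)"
proof -
  let ?N = "2 * s"
  let ?h = "hop q ?N l"
  define z where "z = inverse q - q"
  \<comment> \<open>\<open>q^-1\<close> is a root of \<open>x^2 = 1 + z x\<close>; this treats equal
    neighbours as well as words outside the tensor space.\<close>
  have "inverse q * inverse q = 1 + z * inverse q"
    using q by (simp add: z_def field_simps)
  then have PP: "cst (inverse q) * (cst (inverse q) * X) = X + cst z * (cst (inverse q) * X)" for X :: "rat list \<Rightarrow>\<^sub>0 'k"
    by (simp add: cst_mult_assoc cst_add distrib_right)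
  have Pz: "cst (inverse q) * (cst z * X) = cst z * (cst (inverse q) * X)" for X :: "rat list \<Rightarrow>\<^sub>0 'k"
    by (simp add: cst_mult_assoc mult.commute)
  note S = hop_Suc[where q = q, folded z_def] and S2 = hop_Suc2[where q = q, folded z_def]
    and H0 = hop_0[where q = q, folded z_def]
  note al = app_add app_scale distrib_left PP Pz add_ac
  have S1: "app (?h (Suc (Suc i))) (bas (u @ x # a # b # w)) =
    (if a = b then cst (inverse q) * bas (u @ x # a # b # w)
     else if a < b then bas (u @ x # b # a # w)
     else bas (u @ x # b # a # w) + cst z * bas (u @ x # a # b # w))"
    if "length u = i" "u @ x # a # b # w \<in> Om ?N l" for u x a b w i
    using S2[of u "[x]" "Suc i" a b w ?N l] that by simp
  have off: "app (?h i) (bas f) = cst (inverse q) * bas f" if "f \<notin> Om ?N l" for i f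
    using that by (simp add: app_hop)
  \<comment> \<open>A letter 0 would be fixed by negation and would violate the quadratic relation
    of \<open>H_0\<close> whenever \<open>z\<close> is nonzero.\<close>
  have nz: "a \<noteq> 0" if "u @ a # w \<in> Om ?N l" for u a w
    using that half_idx_nonzero by (auto simp: Om_def)
  have neg: "u @ (- a) # w \<in> Om ?N l" if "u @ a # w \<in> Om ?N l" for u a w
    using that half_idx_uminus by (auto simp: Om_def)
  have quad: "?h i * ?h i = 1 + sc z * ?h i" if lt: "i < l" for i
  proof (rule lop_eqI)
    fix f
    show "app (?h i * ?h i) (bas f) = app (1 + sc z * ?h i) (bas f)"
    proof (cases "f \<in> Om ?N l")
      case True
      show ?thesis
      proof (cases i)
        case 0
        then obtain a w where f: "f = a # w" using True lt by (cases f) (auto simp: Om_def)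
        have "- a # w \<in> Om ?N l" "a \<noteq> 0" using neg[of "[]" a w] nz[of "[]" a w] True f by auto
        with True show ?thesis unfolding f 0 by (auto simp: H0 al)
      next
        case (Suc j)
        then obtain u a b w where f: "f = u @ a # b # w" "length u = j"
          using True lt by (auto elim: Om_split)
        with True Om_swap[of u a b w ?N l] show ?thesis unfolding Suc f(1) using f(2) by (auto simp: S al)
      qed
    qed (simp add: off al)
  qed
  have braid: "?h (Suc i) * ?h (Suc (Suc i)) * ?h (Suc i) = ?h (Suc (Suc i)) * ?h (Suc i) * ?h (Suc (Suc i))"
    if lt: "Suc (Suc i) < l" for i
  proof (rule lop_eqI)
    fix f
    show "app (?h (Suc i) * ?h (Suc (Suc i)) * ?h (Suc i)) (bas f) =
        app (?h (Suc (Suc i)) * ?h (Suc i) * ?h (Suc (Suc i))) (bas f)"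
    proof (cases "f \<in> Om ?N l")
      case True
      then obtain u a b w' where f: "f = u @ a # b # w'" "length u = i"
        using lt by (auto elim: Om_split[where i = i])
      with True lt obtain c w where w': "w' = c # w" by (cases w') (auto simp: Om_def)
      have O: "u @ a # b # c # w \<in> Om ?N l" "u @ b # a # c # w \<in> Om ?N l" "u @ a # c # b # w \<in> Om ?N l"
        "u @ b # c # a # w \<in> Om ?N l" "u @ c # a # b # w \<in> Om ?N l" "u @ c # b # a # w \<in> Om ?N l"
        using True f w' by (auto simp: Om_def)
      show ?thesis
        unfolding f w' using f(2) O
        by (cases a b rule: linorder_cases; cases b c rule: linorder_cases; cases a c rule: linorder_cases)
          (simp_all add: S S1 al)
    qed (simp add: off al)
  qed
  have comm: "?h i * ?h j = ?h j * ?h i" if lt: "i + 1 < j" "j < l" for i j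
  proof (rule lop_eqI)
    fix f
    obtain k where k: "j = Suc k" using lt by (cases j) auto
    show "app (?h i * ?h j) (bas f) = app (?h j * ?h i) (bas f)"
    proof (cases "f \<in> Om ?N l")
      case True
      then obtain f1 c d w where f: "f = f1 @ c # d # w" "length f1 = k"
        using lt k by (auto elim: Om_split[where i = k])
      show ?thesis
      proof (cases i)
        case 0
        with f lt k obtain a v where f1: "f1 = a # v" by (cases f1) auto
        have S': "app (?h (Suc k)) (bas (a # v @ c # d # w)) =
          (if c = d then cst (inverse q) * bas (a # v @ c # d # w)
           else if c < d then bas (a # v @ d # c # w)
           else bas (a # v @ d # c # w) + cst z * bas (a # v @ c # d # w))"
          if "a # v @ c # d # w \<in> Om ?N l" for a c d
          using S2[of "[a]" v k c d w ?N l] that f f1 by simp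
        have O: "x # v @ c # d # w \<in> Om ?N l" "x # v @ d # c # w \<in> Om ?N l" if "x \<in> {a, - a}" for x
          using True that f f1 half_idx_uminus by (auto simp: Om_def)
        show ?thesis
          unfolding f f1 0 k append_Cons using O[of a] O[of "- a"]
          by (cases c d rule: linorder_cases; cases "0 < a") (simp_all add: S' H0 al)
      next
        case (Suc n)
        then obtain u a b v where f1: "f1 = u @ a # b # v" "length u = n"
        proof -
          have "f1 \<in> Om ?N k" "Suc n < k" using True f lt Suc k by (auto simp: Om_def)
          then show ?thesis using that by (auto elim: Om_split)
        qed
        have S': "app (?h (Suc k)) (bas (u @ a # b # v @ c # d # w)) =
          (if c = d then cst (inverse q) * bas (u @ a # b # v @ c # d # w)
           else if c < d then bas (u @ a # b # v @ d # c # w)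
           else bas (u @ a # b # v @ d # c # w) + cst z * bas (u @ a # b # v @ c # d # w))"
          if "u @ a # b # v @ c # d # w \<in> Om ?N l" for a b c d
          using S2[of u "a # b # v" k c d w ?N l] that f f1 by simp
        have O: "u @ a # b # v @ c # d # w \<in> Om ?N l" "u @ a # b # v @ d # c # w \<in> Om ?N l"
          "u @ b # a # v @ c # d # w \<in> Om ?N l" "u @ b # a # v @ d # c # w \<in> Om ?N l"
          using True f f1 by (auto simp: Om_def)
        have "app (?h (Suc n) * ?h (Suc k)) (bas (u @ a # b # v @ c # d # w))
           = app (?h (Suc k) * ?h (Suc n)) (bas (u @ a # b # v @ c # d # w))"
          using O f1(2)
          by (cases a b rule: linorder_cases; cases c d rule: linorder_cases) (simp_all add: S' S al)
        then show ?thesis unfolding f f1 Suc k by simp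
      qed
    qed (simp add: off app_scale)
  qed
  have b2: "?h 0 * ?h 1 * ?h 0 * ?h 1 = ?h 1 * ?h 0 * ?h 1 * ?h 0" if lt: "2 \<le> l"
  proof (rule lop_eqI)
    fix f
    show "app (?h 0 * ?h 1 * ?h 0 * ?h 1) (bas f) = app (?h 1 * ?h 0 * ?h 1 * ?h 0) (bas f)"
    proof (cases "f \<in> Om ?N l")
      case True
      then obtain u a b w where f: "f = u @ a # b # w" "length u = 0"
        using lt by (auto elim: Om_split[where i = 0])
      have O: "x # y # w \<in> Om ?N l" "y # x # w \<in> Om ?N l" if "x \<in> {a, - a}" "y \<in> {b, - b}" for x y
        using True f that half_idx_uminus by (auto simp: Om_def)
      note O' = O[of a b] O[of "- a" b] O[of a "- b"] O[of "- a" "- b"]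
      have n: "a \<noteq> 0" "b \<noteq> 0" using True f nz[of "[]" a "b # w"] nz[of "[a]" b w] by auto
      have S': "app (?h (Suc 0)) (bas (a # b # w)) =
          (if a = b then cst (inverse q) * bas (a # b # w)
           else if a < b then bas (b # a # w)
           else bas (b # a # w) + cst z * bas (a # b # w))"
          if "a # b # w \<in> Om ?N l" for a b
          using S[of "[]" 0 a b w ?N l] that by simp
      have "app (?h 0 * ?h 1 * ?h 0 * ?h 1) (bas (a # b # w)) = app (?h 1 * ?h 0 * ?h 1 * ?h 0) (bas (a # b # w))"
        using O' n
        by (cases "0 < a"; cases "0 < b"; cases a b rule: linorder_cases; cases a "- b" rule: linorder_cases)
          (simp_all add: S' H0 al)
      with f show ?thesis by simp
    qed (simp add: off al)
  qed
  have braid': "?h i * ?h (i + 1) * ?h i = ?h (i + 1) * ?h i * ?h (i + 1)"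
    if "1 \<le> i" "i + 1 < l" for i
    using braid[of "i - 1"] that by simp
  show ?thesis
    unfolding hecke_fam_def unfolding z_def [symmetric] using quad braid' comm b2 by blast
qed

lemma hecke_rels_for_closed:
  assumes "\<And>i. i < l \<Longrightarrow> h i \<in> carrier (free_algebra S)"
  shows "hecke_rels_for q l h \<subseteq> carrier (free_algebra S)"
  using assms unfolding hecke_rels_for_def by (auto intro!: free_algebra_closed)

text \<open>Agreement on an invariant subspace suffices, since no intermediate vector leaves
  it.\<close>

lemma right_act_agree:
  assumes P: "\<And>g. g \<in> G \<Longrightarrow> pres S (P g)"
    and eq: "\<And>g v. g \<in> G \<Longrightarrow> v \<in> sp S \<Longrightarrow> op g v = app (P g) v"
    and p: "p \<in> carrier (free_algebra G)" and v: "v \<in> sp S"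
  shows "right_act op p v = app (evl (wordR P) p) v"
proof -
  have "fold op w v = app (wordR P w) v" if "set w \<subseteq> G" "v \<in> sp S" for w v
    using that
  proof (induct w arbitrary: v)
    case (Cons g w)
    then show ?case using eq[of g v] pres_app[OF P, of g v] by simp
  qed simp
  then show ?thesis
    unfolding right_act_def app_evl using p v
    by (intro lin_cong) (auto simp: carrier_free_algebra)
qed

lemma Psi_cls:
  fixes q :: "'k::field"
  assumes q: "q \<noteq> 0" and p: "p \<in> carrier (free_algebra {..<l})"
  shows "Psi q (2 * s) l (hecke_cls q l p) =
    restrict (app (evl (wordR (hop q (2 * s) l)) p)) (tensor_space (2 * s) l)"
  unfolding Psi_def hecke_cls_def
proof (rule induced_cls)
  show "hecke_rels_for q l gen \<subseteq> carrier (free_algebra {..<l})"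
    by (rule hecke_rels_for_closed) auto
  show "evl (wordR (hop q (2 * s) l)) p = 0" if "p \<in> hecke_rels_for q l gen" for p
    using evl_hecke_rels[OF hecke_fam_hop[OF q] q _ that] by simp
next
  fix p :: "nat list \<Rightarrow>\<^sub>0 'k" and v :: "rat list \<Rightarrow>\<^sub>0 'k"
  assume p: "p \<in> carrier (free_algebra {..<l})" and v: "v \<in> tensor_space (2 * s) l"
  show "right_act (\<lambda>i. lin (hecke_op_basis q i)) p v = app (evl (wordR (hop q (2 * s) l)) p) v"
  proof (rule right_act_agree[OF hop_pres _ p])
    fix i and v :: "rat list \<Rightarrow>\<^sub>0 'k"
    assume "v \<in> sp (Om (2 * s) l)"
    then have "app (Lin (hecke_op_basis q i)) v = app (hop q (2 * s) l i) v"
      by (rule app_eq_on[rotated]) (simp add: app_hop)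
    then show "lin (hecke_op_basis q i) v = app (hop q (2 * s) l i) v"
      by (simp add: app_Lin)
  qed (use v in \<open>auto simp: tensor_space_sp\<close>)
qed (use p in auto)

subsection \<open>Reduced words in the symmetric group\<close>

definition invs :: "nat \<Rightarrow> (nat \<Rightarrow> nat) \<Rightarrow> (nat \<times> nat) set" where
  "invs l \<sigma> = {(a, b). 1 \<le> a \<and> a < b \<and> b \<le> l \<and> \<sigma> b < \<sigma> a}"

lemma finite_invs: "finite (invs l \<sigma>)"
  by (rule finite_subset[of _ "{..l} \<times> {..l}"]) (auto simp: invs_def)

lemma simple_refl_invol [simp]: "simple_refl i (simple_refl i x) = x" "simple_refl i \<circ> simple_refl i = id"
  by (auto simp: simple_refl_def)

lemma simple_refl_apply:
  "simple_refl i x = (if x = i then i + 1 else if x = i + 1 then i else x)"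
  by (simp add: simple_refl_def Transposition.transpose_def)

lemma comp_simple_refl_cancel [simp]: "\<sigma> \<circ> simple_refl i \<circ> simple_refl i = \<sigma>"
  by (simp add: comp_assoc)

lemma simple_refl_permutes: "1 \<le> i \<Longrightarrow> i < l \<Longrightarrow> simple_refl i permutes {1..l}"
  unfolding simple_refl_def by (rule permutes_swap_id) auto

text \<open>Composing with \<open>s_i\<close> on the right exchanges the positions \<open>i\<close>
  and \<open>i + 1\<close>. Applying \<open>s_i\<close> to both coordinates carries old inversions
  to new ones, and \<open>(i, i + 1)\<close> is the only pair added.\<close>

lemma card_invs_ascent:
  assumes i: "1 \<le> i" "i < l" and up: "\<sigma> i < \<sigma> (i + 1)"
  shows "card (invs l (\<sigma> \<circ> simple_refl i)) = Suc (card (invs l \<sigma>))"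
proof -
  let ?s = "simple_refl i"
  let ?\<phi> = "map_prod ?s ?s"
  have \<phi>: "inj_on ?\<phi> X" for X
    by (rule inj_on_inverseI[of _ ?\<phi>]) (auto simp: map_prod_def)
  have mem: "(a, b) \<in> invs l (\<sigma> \<circ> ?s) \<longleftrightarrow> (a, b) = (i, i + 1) \<or> (?s a, ?s b) \<in> invs l \<sigma>" for a b
    using i up unfolding invs_def
    by (cases "a = i \<or> a = i + 1"; cases "b = i \<or> b = i + 1") (auto simp: simple_refl_apply)
  have "invs l (\<sigma> \<circ> ?s) = insert (i, i + 1) (?\<phi> ` invs l \<sigma>)"
  proof (intro equalityI subsetI)
    fix x assume "x \<in> invs l (\<sigma> \<circ> ?s)"
    then obtain a b where x: "x = (a, b)" "(a, b) = (i, i + 1) \<or> (?s a, ?s b) \<in> invs l \<sigma>"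
      using mem by (cases x) auto
    have "(a, b) = ?\<phi> (?s a, ?s b)" by simp
    with x show "x \<in> insert (i, i + 1) (?\<phi> ` invs l \<sigma>)" by (metis image_eqI insert_iff)
  next
    fix x assume "x \<in> insert (i, i + 1) (?\<phi> ` invs l \<sigma>)"
    then show "x \<in> invs l (\<sigma> \<circ> ?s)" using mem by auto
  qed
  moreover have "(i, i + 1) \<notin> ?\<phi> ` invs l \<sigma>"
  proof
    assume "(i, i + 1) \<in> ?\<phi> ` invs l \<sigma>"
    then obtain a b where "(a, b) \<in> invs l \<sigma>" "i = ?s a" "i + 1 = ?s b" by auto
    then have "a = ?s i" "b = ?s (i + 1)" by (metis simple_refl_invol(1))+
    then have "a = i + 1" "b = i" by (simp_all add: simple_refl_apply)
    with \<open>(a, b) \<in> invs l \<sigma>\<close> show False by (auto simp: invs_def)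
  qed
  ultimately show ?thesis
    using card_image[OF \<phi>, of "invs l \<sigma>"] by (simp add: finite_invs)
qed

lemma card_invs_descent:
  assumes i: "1 \<le> i" "i < l" and down: "\<sigma> (i + 1) < \<sigma> i"
  shows "card (invs l \<sigma>) = Suc (card (invs l (\<sigma> \<circ> simple_refl i)))"
  using card_invs_ascent[OF i, of "\<sigma> \<circ> simple_refl i"] down by (simp add: simple_refl_apply)

lemma refl_word_append: "refl_word (v @ w) = refl_word v \<circ> refl_word w"
  by (induct v) (auto simp: refl_word_def)

lemma refl_word_simps [simp]: "refl_word [] = id" "refl_word (i # w) = simple_refl i \<circ> refl_word w"
  by (simp_all add: refl_word_def)

lemma refl_word_permutes: "set w \<subseteq> {1..<l} \<Longrightarrow> refl_word w permutes {1..l}"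
proof (induct w)
  case (Cons i w)
  then have "refl_word w permutes {1..l}" "1 \<le> i" "i < l" by auto
  then show ?case
    unfolding refl_word_simps by (intro permutes_compose simple_refl_permutes)
qed (simp add: permutes_id)

lemma permutes_descent_or_ascent:
  fixes \<sigma> :: "nat \<Rightarrow> nat"
  assumes "\<sigma> permutes {1..l}"
  shows "\<sigma> (i + 1) < \<sigma> i \<or> \<sigma> i < \<sigma> (i + 1)"
proof -
  have "\<sigma> (i + 1) \<noteq> \<sigma> i"
    using inj_eq[OF permutes_inj[OF assms], of "i + 1" i] by simp
  then show ?thesis by linarith
qed

text \<open>Each further letter changes the number of inversions by one, upwards or
  downwards.\<close>

lemma card_invs_refl_word: "set w \<subseteq> {1..<l} \<Longrightarrow> card (invs l (refl_word w)) \<le> length w"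
proof (induct w rule: rev_induct)
  case Nil
  have "invs l (refl_word []) = {}" by (auto simp: invs_def)
  then show ?case by (simp only: card.empty)
next
  case (snoc i w)
  then have i: "1 \<le> i" "i < l" and p: "refl_word w permutes {1..l}"
    using refl_word_permutes by auto
  have c: "card (invs l (refl_word w \<circ> simple_refl i)) \<le> Suc (card (invs l (refl_word w)))"
    using permutes_descent_or_ascent[OF p, of i]
  proof
    assume "refl_word w (i + 1) < refl_word w i"
    from card_invs_descent[OF i this] show ?thesis by linarith
  next
    assume "refl_word w i < refl_word w (i + 1)"
    from card_invs_ascent[OF i this] show ?thesis by linarith
  qed
  have "refl_word (w @ [i]) = refl_word w \<circ> simple_refl i"
    by (simp only: refl_word_append refl_word_simps comp_id)
  moreover from c snoc have "card (invs l (refl_word w \<circ> simple_refl i)) \<le> length (w @ [i])" by simp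
  ultimately show ?case by (simp only:)
qed

text \<open>Without a descent \<sigma> increases on \<open>{1..l}\<close>, and an increasing
  permutation of an interval is the identity.\<close>

lemma ex_descent:
  fixes \<sigma> :: "nat \<Rightarrow> nat"
  assumes p: "\<sigma> permutes {1..l}" and "\<sigma> \<noteq> id"
  obtains i where "1 \<le> i" "i < l" "\<sigma> (i + 1) < \<sigma> i"
proof (rule ccontr)
  assume "\<not> thesis"
  with that permutes_descent_or_ascent[OF p] have up: "\<sigma> i < \<sigma> (i + 1)" if "1 \<le> i" "i < l" for i
    using \<open>1 \<le> i\<close> \<open>i < l\<close> by metis
  have ge: "x \<le> \<sigma> x" if "1 \<le> x" "x \<le> l" for x
    using that
  proof (induct x rule: nat_induct_at_least)
    case base
    have "\<sigma> 1 \<in> {1..l}" using permutes_in_image[OF p] base by auto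
    then show ?case by auto
  next
    case (Suc n)
    then show ?case using up[of n] by auto
  qed
  \<comment> \<open>Induction downwards from the right end \<open>l\<close>, with \<open>k\<close>
    as the distance from it.\<close>
  have le: "\<sigma> (l - k) \<le> l - k" if "k < l" for k
    using that
  proof (induct k)
    case 0
    then have "\<sigma> l \<in> {1..l}" using permutes_in_image[OF p] by auto
    then show ?case by auto
  next
    case (Suc k)
    then have "\<sigma> (l - Suc k) < \<sigma> (l - Suc k + 1)" by (intro up) auto
    moreover have "l - Suc k + 1 = l - k" using Suc by simp
    ultimately show ?case using Suc by simp
  qed
  have "\<sigma> x = x" for x
  proof (cases "x \<in> {1..l}")
    case True
    then show ?thesis using ge[of x] le[of "l - x"] by auto
  next
    case False
    then show ?thesis using permutes_not_in[OF p] by blast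
  qed
  with assms(2) show False by auto
qed

text \<open>Removing descents one at a time, as in bubble sort, reaches the identity after as many
  steps as there are inversions.\<close>

lemma ex_word_card_invs:
  assumes "\<sigma> permutes {1..l}"
  shows "\<exists>w. set w \<subseteq> {1..<l} \<and> refl_word w = \<sigma> \<and> length w = card (invs l \<sigma>)"
  using assms
proof (induct "card (invs l \<sigma>)" arbitrary: \<sigma> rule: less_induct)
  case less
  show ?case
  proof (cases "\<sigma> = id")
    case True
    then have "invs l \<sigma> = {}" by (auto simp: invs_def)
    with True show ?thesis by (intro exI[of _ "[]"]) auto
  next
    case False
    then obtain i where i: "1 \<le> i" "i < l" "\<sigma> (i + 1) < \<sigma> i"
      using ex_descent[OF less.prems] by blast
    have "\<sigma> \<circ> simple_refl i permutes {1..l}"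
      using permutes_compose[OF simple_refl_permutes less.prems] i by blast
    with less.hyps[of "\<sigma> \<circ> simple_refl i"] card_invs_descent[OF i] obtain w where
      "set w \<subseteq> {1..<l}" "refl_word w = \<sigma> \<circ> simple_refl i" "Suc (length w) = card (invs l \<sigma>)"
      by auto
    with i show ?thesis by (intro exI[of _ "w @ [i]"]) (auto simp: refl_word_append)
  qed
qed

text \<open>The lower bound holds for every word, and removal of descents supplies a word attaining
  it.\<close>

lemma cox_length_card_invs:
  assumes "\<sigma> permutes {1..l}"
  shows "cox_length l \<sigma> = card (invs l \<sigma>)"
  unfolding cox_length_def
proof (rule Least_equality)
  show "\<exists>w. length w = card (invs l \<sigma>) \<and> set w \<subseteq> {1..<l} \<and> refl_word w = \<sigma>"
    using ex_word_card_invs[OF assms] by blast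
qed (auto simp: card_invs_refl_word)

lemma reduced_expr_iff:
  assumes "\<sigma> permutes {1..l}"
  shows "reduced_expr l \<sigma> w \<longleftrightarrow> set w \<subseteq> {1..<l} \<and> refl_word w = \<sigma> \<and> length w = card (invs l \<sigma>)"
  by (simp add: reduced_expr_def cox_length_card_invs[OF assms])

lemma ex_reduced_expr: "\<sigma> permutes {1..l} \<Longrightarrow> \<exists>w. reduced_expr l \<sigma> w"
  using ex_word_card_invs by (simp add: reduced_expr_iff)

text \<open>If the last letter were an ascent of \<sigma>, the shorter word would represent a
  permutation with more inversions than it has letters.\<close>

lemma reduced_expr_snoc:
  assumes p: "\<sigma> permutes {1..l}" and r: "reduced_expr l \<sigma> (w @ [i])"
  shows "1 \<le> i" "i < l" "\<sigma> (i + 1) < \<sigma> i" "reduced_expr l (\<sigma> \<circ> simple_refl i) w"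
    "\<sigma> \<circ> simple_refl i permutes {1..l}" "card (invs l \<sigma>) = Suc (card (invs l (\<sigma> \<circ> simple_refl i)))"
proof -
  have w: "set w \<subseteq> {1..<l}" and l: "Suc (length w) = card (invs l \<sigma>)" and e: "refl_word w \<circ> simple_refl i = \<sigma>"
    using r by (auto simp: reduced_expr_iff[OF p] refl_word_append)
  show i: "1 \<le> i" "i < l" using r by (auto simp: reduced_expr_iff[OF p])
  show p': "\<sigma> \<circ> simple_refl i permutes {1..l}"
    using permutes_compose[OF simple_refl_permutes p] i by blast
  have e': "refl_word w = \<sigma> \<circ> simple_refl i" using e by auto
  have le: "card (invs l (\<sigma> \<circ> simple_refl i)) \<le> length w"
    using card_invs_refl_word[OF w] e' by simp
  show d: "\<sigma> (i + 1) < \<sigma> i"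
    using permutes_descent_or_ascent[OF p, of i]
  proof
    assume "\<sigma> i < \<sigma> (i + 1)"
    from card_invs_ascent[OF i this] le l show ?thesis by linarith
  qed
  show c: "card (invs l \<sigma>) = Suc (card (invs l (\<sigma> \<circ> simple_refl i)))"
    by (rule card_invs_descent[OF i d])
  show "reduced_expr l (\<sigma> \<circ> simple_refl i) w"
    using w e' l c by (simp add: reduced_expr_iff[OF p'])
qed

text \<open>
  Matsumoto's theorem.  If the reduced words end in \<open>i \<noteq> j\<close>, both are compared with reduced words
  that end in the longest element of the parabolic subgroup generated by \<open>s\<^sub>i\<close> and \<open>s\<^sub>j\<close>.
\<close>

lemma reduced_expr_unique:
  assumes P: "hecke_fam q l P" and p: "\<sigma> permutes {1..l}"
    and "reduced_expr l \<sigma> v" "reduced_expr l \<sigma> w"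
  shows "wordR P v = wordR P w"
  using assms(2-)
proof (induct "card (invs l \<sigma>)" arbitrary: \<sigma> v w rule: less_induct)
  case less
  note p = less.prems(1)
  have far: "wordR P (v @ [i]) = wordR P (w @ [j])"
    if v: "reduced_expr l \<sigma> (v @ [i])" and w: "reduced_expr l \<sigma> (w @ [j])" and ij: "i + 1 < j" for v w i j
  proof -
    note V = reduced_expr_snoc[OF p v] and W = reduced_expr_snoc[OF p w]
    let ?\<tau> = "\<sigma> \<circ> simple_refl i \<circ> simple_refl j"
    have \<tau>: "?\<tau> = \<sigma> \<circ> simple_refl j \<circ> simple_refl i"
      using ij by (auto simp: simple_refl_apply fun_eq_iff)
    have p\<tau>: "?\<tau> permutes {1..l}"
      using permutes_compose[OF simple_refl_permutes V(5)] W by blast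
    have c: "card (invs l (\<sigma> \<circ> simple_refl i)) = Suc (card (invs l ?\<tau>))"
      by (rule card_invs_descent) (use V W ij in \<open>auto simp: simple_refl_apply\<close>)
    obtain t where t: "set t \<subseteq> {1..<l}" "refl_word t = ?\<tau>" "length t = card (invs l ?\<tau>)"
      using ex_word_card_invs[OF p\<tau>] by blast
    have "reduced_expr l (\<sigma> \<circ> simple_refl i) (t @ [j])"
      using t V W c by (auto simp: reduced_expr_iff refl_word_append)
    moreover have "reduced_expr l (\<sigma> \<circ> simple_refl j) (t @ [i])"
      using t V W c \<tau> by (auto simp: reduced_expr_iff refl_word_append)
    ultimately have "wordR P v = P j * wordR P t" "wordR P w = P i * wordR P t"
      using less.hyps[OF _ V(5) V(4), of "t @ [j]"] less.hyps[OF _ W(5) W(4), of "t @ [i]"] V(6) W(6) by auto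
    moreover have "P i * P j = P j * P i"
      using P ij W(2) unfolding hecke_fam_def by blast
    ultimately show ?thesis by (simp add: mult.assoc [symmetric])
  qed
  have near: "wordR P (v @ [i]) = wordR P (w @ [j])"
    if v: "reduced_expr l \<sigma> (v @ [i])" and w: "reduced_expr l \<sigma> (w @ [j])" and ij: "j = i + 1" for v w i j
  proof -
    note V = reduced_expr_snoc[OF p v] and W = reduced_expr_snoc[OF p w]
    let ?\<rho> = "\<sigma> \<circ> simple_refl i \<circ> simple_refl j"
    let ?\<tau> = "?\<rho> \<circ> simple_refl i"
    have \<tau>: "?\<tau> = \<sigma> \<circ> simple_refl j \<circ> simple_refl i \<circ> simple_refl j"
      using ij by (auto simp: simple_refl_apply fun_eq_iff)
    have p\<rho>: "?\<rho> permutes {1..l}"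
      using permutes_compose[OF simple_refl_permutes V(5)] W by blast
    have p\<tau>: "?\<tau> permutes {1..l}"
      using permutes_compose[OF simple_refl_permutes p\<rho>] V by blast
    have c: "card (invs l (\<sigma> \<circ> simple_refl i)) = Suc (card (invs l ?\<rho>))"
      by (rule card_invs_descent) (use V W ij in \<open>auto simp: simple_refl_apply\<close>)
    have c': "card (invs l ?\<rho>) = Suc (card (invs l ?\<tau>))"
      by (rule card_invs_descent) (use V W ij in \<open>auto simp: simple_refl_apply\<close>)
    obtain t where t: "set t \<subseteq> {1..<l}" "refl_word t = ?\<tau>" "length t = card (invs l ?\<tau>)"
      using ex_word_card_invs[OF p\<tau>] by blast
    have "?\<tau> \<circ> simple_refl i \<circ> simple_refl j = \<sigma> \<circ> simple_refl i"
      by simp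
    then have "reduced_expr l (\<sigma> \<circ> simple_refl i) (t @ [i, j])"
      using t V W c c' by (auto simp: reduced_expr_iff refl_word_append comp_assoc)
    moreover have "?\<tau> \<circ> simple_refl j \<circ> simple_refl i = \<sigma> \<circ> simple_refl j"
      unfolding \<tau> by simp
    then have "reduced_expr l (\<sigma> \<circ> simple_refl j) (t @ [j, i])"
      using t V W c c' by (auto simp: reduced_expr_iff refl_word_append comp_assoc)
    ultimately have "wordR P v = P j * P i * wordR P t" "wordR P w = P i * P j * wordR P t"
      using less.hyps[OF _ V(5) V(4), of "t @ [i, j]"] less.hyps[OF _ W(5) W(4), of "t @ [j, i]"] V(6) W(6)
      by (auto simp: mult.assoc)
    moreover have "P i * P j * P i = P j * P i * P j"
      using P ij V(1) W(2) unfolding hecke_fam_def by blast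
    ultimately show ?thesis by (simp add: mult.assoc [symmetric])
  qed
  show ?case
  proof (cases v rule: rev_cases)
    case Nil
    have "length v = card (invs l \<sigma>)" "length w = card (invs l \<sigma>)"
      using less.prems reduced_expr_iff[OF p] by blast+
    with Nil show ?thesis by simp
  next
    case v: (snoc v' i)
    then obtain w' j where w: "w = w' @ [j]"
      using less.prems by (cases w rule: rev_cases) (auto simp: reduced_expr_iff)
    note V = reduced_expr_snoc[OF p less.prems(2)[unfolded v]]
      and W = reduced_expr_snoc[OF p less.prems(3)[unfolded w]]
    consider "i = j" | "i + 1 = j" | "j + 1 = i" | "i + 1 < j" | "j + 1 < i" by linarith
    then show ?thesis
    proof cases
      case 1
      then show ?thesis
        using less.hyps[OF _ V(5) V(4), of w'] V(6) W(4) v w by simp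
    next
      case 2
      then show ?thesis using near less.prems v w by blast
    next
      case 3
      have "wordR P (w' @ [j]) = wordR P (v' @ [i])"
        by (rule near[OF less.prems(3)[unfolded w] less.prems(2)[unfolded v]]) (use 3 in simp)
      then show ?thesis unfolding v w by (rule sym)
    next
      case 4
      then show ?thesis using far less.prems v w by blast
    next
      case 5
      have "wordR P (w' @ [j]) = wordR P (v' @ [i])"
        by (rule far[OF less.prems(3)[unfolded w] less.prems(2)[unfolded v]]) (use 5 in simp)
      then show ?thesis unfolding v w by (rule sym)
    qed
  qed
qed

subsection \<open>The duplex Hecke algebra on tensor space\<close>

lemma hecke_fam_mono: "hecke_fam q m P \<Longrightarrow> l \<le> m \<Longrightarrow> hecke_fam q l P"
  unfolding hecke_fam_def by (meson less_le_trans order_trans)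

text \<open>The same choice as in \<open>hecke_elt\<close>, so that the operator of this Hecke
  element is \<open>wordR\<close> of this very word.\<close>

definition red_word :: "nat \<Rightarrow> (nat \<Rightarrow> nat) \<Rightarrow> nat list" where
  "red_word l \<sigma> = (SOME w. reduced_expr l \<sigma> w)"

lemma red_word: "\<sigma> permutes {1..l} \<Longrightarrow> reduced_expr l \<sigma> (red_word l \<sigma>)"
  unfolding red_word_def using ex_reduced_expr by (rule someI_ex)

lemma set_red_word: "\<sigma> permutes {1..l} \<Longrightarrow> set (red_word l \<sigma>) \<subseteq> {1..<l}"
  using red_word unfolding reduced_expr_def by blast

lemma red_word_id: "red_word l id = []"
proof -
  have "reduced_expr l id (red_word l id)" by (rule red_word) (rule permutes_id)
  moreover have "invs l id = {}" by (auto simp: invs_def)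
  ultimately show ?thesis by (simp add: reduced_expr_iff[OF permutes_id])
qed

definition hecke_word :: "(nat \<Rightarrow> ('b::monoid_add, 'k::field) lop) \<Rightarrow> nat \<Rightarrow> (nat \<Rightarrow> nat) \<Rightarrow> ('b, 'k) lop" where
  "hecke_word P l \<sigma> = wordR P (red_word l \<sigma>)"

lemma hecke_word_eq:
  "hecke_fam q l P \<Longrightarrow> \<sigma> permutes {1..l} \<Longrightarrow> reduced_expr l \<sigma> w \<Longrightarrow> hecke_word P l \<sigma> = wordR P w"
  unfolding hecke_word_def using reduced_expr_unique red_word by blast

text \<open>The reversal in \<open>wordR\<close> turns right multiplication by \<open>s_i\<close>
  into left multiplication by \<open>P i\<close>. If the length drops, \<sigma> is itself the
  lengthening of \<open>\<sigma> \<circ> simple_refl i\<close>, and the quadratic relation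
  applies.\<close>

lemma hecke_word_right:
  assumes P: "hecke_fam q l P" and p: "\<sigma> permutes {1..l}" and i: "0 < i" "i < l"
  shows "cox_length l (\<sigma> \<circ> simple_refl i) = cox_length l \<sigma> + 1 \<Longrightarrow>
      P i * hecke_word P l \<sigma> = hecke_word P l (\<sigma> \<circ> simple_refl i)"
    "cox_length l (\<sigma> \<circ> simple_refl i) + 1 = cox_length l \<sigma> \<Longrightarrow>
      P i * hecke_word P l \<sigma> = hecke_word P l (\<sigma> \<circ> simple_refl i) + sc (inverse q - q) * hecke_word P l \<sigma>"
proof -
  have up: "P i * hecke_word P l \<sigma> = hecke_word P l (\<sigma> \<circ> simple_refl i)"
    if p: "\<sigma> permutes {1..l}" and c: "cox_length l (\<sigma> \<circ> simple_refl i) = cox_length l \<sigma> + 1" for \<sigma>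
  proof -
    have p': "\<sigma> \<circ> simple_refl i permutes {1..l}"
      using permutes_compose[OF simple_refl_permutes p] i by auto
    have "reduced_expr l (\<sigma> \<circ> simple_refl i) (red_word l \<sigma> @ [i])"
      unfolding reduced_expr_def
    proof (intro conjI)
      show "refl_word (red_word l \<sigma> @ [i]) = \<sigma> \<circ> simple_refl i"
        using red_word[OF p] by (simp only: reduced_expr_def refl_word_append refl_word_simps comp_id)
      show "length (red_word l \<sigma> @ [i]) = cox_length l (\<sigma> \<circ> simple_refl i)"
        using red_word[OF p] unfolding c reduced_expr_def by simp
    qed (use red_word[OF p] i in \<open>auto simp: reduced_expr_def\<close>)
    from hecke_word_eq[OF P p' this] show ?thesis by (simp add: hecke_word_def)
  qed
  show "cox_length l (\<sigma> \<circ> simple_refl i) = cox_length l \<sigma> + 1 \<Longrightarrow>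
      P i * hecke_word P l \<sigma> = hecke_word P l (\<sigma> \<circ> simple_refl i)"
    by (rule up[OF p])
  assume c: "cox_length l (\<sigma> \<circ> simple_refl i) + 1 = cox_length l \<sigma>"
  let ?\<tau> = "\<sigma> \<circ> simple_refl i"
  have p': "?\<tau> permutes {1..l}"
    using permutes_compose[OF simple_refl_permutes p] i by auto
  have e: "?\<tau> \<circ> simple_refl i = \<sigma>" by (rule comp_simple_refl_cancel)
  have u: "P i * hecke_word P l ?\<tau> = hecke_word P l \<sigma>"
    using up[OF p'] c unfolding e by metis
  have "P i * hecke_word P l \<sigma> = (P i * P i) * hecke_word P l ?\<tau>"
    by (simp only: u [symmetric] mult.assoc)
  also have "P i * P i = 1 + sc (inverse q - q) * P i"
    using P i unfolding hecke_fam_def by blast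
  also have "(1 + sc (inverse q - q) * P i) * hecke_word P l ?\<tau>
      = hecke_word P l ?\<tau> + sc (inverse q - q) * hecke_word P l \<sigma>"
    by (simp only: distrib_right mult.assoc u mult_1_left)
  finally show "P i * hecke_word P l \<sigma> = hecke_word P l ?\<tau> + sc (inverse q - q) * hecke_word P l \<sigma>" .
qed

lemma hecke_word_left:
  assumes P: "hecke_fam q l P" and p: "\<sigma> permutes {1..l}" and i: "0 < i" "i < l"
  shows "cox_length l (simple_refl i \<circ> \<sigma>) = cox_length l \<sigma> + 1 \<Longrightarrow>
      hecke_word P l \<sigma> * P i = hecke_word P l (simple_refl i \<circ> \<sigma>)"
    "cox_length l (simple_refl i \<circ> \<sigma>) + 1 = cox_length l \<sigma> \<Longrightarrow>
      hecke_word P l \<sigma> * P i = hecke_word P l (simple_refl i \<circ> \<sigma>) + sc (inverse q - q) * hecke_word P l \<sigma>"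
proof -
  have up: "hecke_word P l \<sigma> * P i = hecke_word P l (simple_refl i \<circ> \<sigma>)"
    if p: "\<sigma> permutes {1..l}" and c: "cox_length l (simple_refl i \<circ> \<sigma>) = cox_length l \<sigma> + 1" for \<sigma>
  proof -
    have p': "simple_refl i \<circ> \<sigma> permutes {1..l}"
      using permutes_compose[OF p simple_refl_permutes] i by auto
    have "reduced_expr l (simple_refl i \<circ> \<sigma>) (i # red_word l \<sigma>)"
      unfolding reduced_expr_def
    proof (intro conjI)
      show "refl_word (i # red_word l \<sigma>) = simple_refl i \<circ> \<sigma>"
        using red_word[OF p] by (simp only: reduced_expr_def refl_word_simps)
      show "length (i # red_word l \<sigma>) = cox_length l (simple_refl i \<circ> \<sigma>)"
        using red_word[OF p] unfolding c reduced_expr_def by simp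
    qed (use red_word[OF p] i in \<open>auto simp: reduced_expr_def\<close>)
    from hecke_word_eq[OF P p' this] show ?thesis by (simp add: hecke_word_def)
  qed
  show "cox_length l (simple_refl i \<circ> \<sigma>) = cox_length l \<sigma> + 1 \<Longrightarrow>
      hecke_word P l \<sigma> * P i = hecke_word P l (simple_refl i \<circ> \<sigma>)"
    by (rule up[OF p])
  assume c: "cox_length l (simple_refl i \<circ> \<sigma>) + 1 = cox_length l \<sigma>"
  let ?\<tau> = "simple_refl i \<circ> \<sigma>"
  have p': "?\<tau> permutes {1..l}"
    using permutes_compose[OF p simple_refl_permutes] i by auto
  have e: "simple_refl i \<circ> ?\<tau> = \<sigma>" by (auto simp: fun_eq_iff)
  have u: "hecke_word P l ?\<tau> * P i = hecke_word P l \<sigma>"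
    using up[OF p'] c unfolding e by metis
  have "hecke_word P l \<sigma> * P i = hecke_word P l ?\<tau> * (P i * P i)"
    by (simp only: u [symmetric] mult.assoc)
  also have "P i * P i = 1 + sc (inverse q - q) * P i"
    using P i unfolding hecke_fam_def by blast
  also have "hecke_word P l ?\<tau> * (1 + sc (inverse q - q) * P i)
      = hecke_word P l ?\<tau> + sc (inverse q - q) * hecke_word P l \<sigma>"
    by (simp only: distrib_left sc_commute_left u mult_1_right)
  finally show "hecke_word P l \<sigma> * P i = hecke_word P l ?\<tau> + sc (inverse q - q) * hecke_word P l \<sigma>" .
qed

lemma hecke_word_simple_refl:
  assumes "hecke_fam q l P" "0 < i" "i < l"
  shows "hecke_word P l (simple_refl i) = P i"
proof -
  have p: "simple_refl i permutes {1..l}" using assms by (intro simple_refl_permutes) auto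
  have "invs l id = {}" by (auto simp: invs_def)
  then have "card (invs l (id \<circ> simple_refl i)) = 1"
    using card_invs_ascent[of i l id] assms by simp
  then have "reduced_expr l (simple_refl i) [i]"
    using assms by (simp add: reduced_expr_iff[OF p])
  from hecke_word_eq[OF assms(1) p this] show ?thesis by simp
qed

definition blk :: "nat \<Rightarrow> nat \<Rightarrow> nat \<Rightarrow> rat list set" where
  "blk r m l = {f \<in> Om (2 * (r + 2)) m. set (take l f) \<subseteq> half_idx (2 * (r + 1)) \<and>
     drop l f = replicate (m - l) (hf (int r + 2))}"

text \<open>The operator of the generator \<open>x_id^(l)\<close>.\<close>

definition Pr :: "nat \<Rightarrow> nat \<Rightarrow> nat \<Rightarrow> (rat list, 'k::field) lop" where
  "Pr r m l = Lin (\<lambda>f. if f \<in> blk r m l then bas f else 0)"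

lemma app_Pr: "app (Pr r m l) (bas f) = (if f \<in> blk r m l then bas f else 0)"
  by (simp add: Pr_def)

lemma blk_top:
  assumes f: "u @ a # b # w \<in> blk r m l" and l: "l \<le> length u"
  shows "a = b"
proof -
  have e: "drop l u @ a # b # w = replicate (m - l) (hf (int r + 2))" using assms by (simp add: blk_def)
  have "a \<in> set (drop l u @ a # b # w)" "b \<in> set (drop l u @ a # b # w)" by simp_all
  then show "a = b" unfolding e by simp
qed

text \<open>Only an exchange across the boundary after the first \<open>l\<close> letters can leave
  the block: to its right all letters are equal, and to its left the inner letters are
  unordered.\<close>

lemma blk_swap:
  assumes f: "u @ a # b # w \<in> blk r m l" and ne: "Suc (length u) \<noteq> l"
  shows "u @ b # a # w \<in> blk r m l"
proof (cases "l \<le> length u")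
  case True
  with blk_top[OF f] have "a = b" by simp
  with f show ?thesis by simp
next
  case False
  then obtain k where "l = length u + Suc (Suc k)" using ne
    by (metis Suc_leI le_Suc_ex le_neq_implies_less not_le_imp_less add_Suc add_Suc_right)
  with f show ?thesis by (auto simp: blk_def Om_swap)
qed

lemma Pr_commute_hop:
  assumes i: "0 < i" "i < m" "i \<noteq> l"
  shows "hop q (2 * (r + 2)) m i * Pr r m l = Pr r m l * hop q (2 * (r + 2)) m i"
proof (rule lop_eqI)
  fix f
  let ?h = "hop q (2 * (r + 2)) m"
  show "app (?h i * Pr r m l) (bas f) = app (Pr r m l * ?h i) (bas f)"
  proof (cases "f \<in> Om (2 * (r + 2)) m")
    case True
    obtain j where j: "i = Suc j" using i by (cases i) auto
    then obtain u a b w where f: "f = u @ a # b # w" "length u = j"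
      using i True by (auto elim: Om_split[where i = j])
    have "u @ a # b # w \<in> blk r m l \<longleftrightarrow> u @ b # a # w \<in> blk r m l"
      using blk_swap[of u a b w r m l] blk_swap[of u b a w r m l] i j f by auto
    moreover have "app (?h (Suc j)) (bas (u @ a # b # w)) =
      (if a = b then cst (inverse q) * bas (u @ a # b # w) else if a < b then bas (u @ b # a # w)
       else bas (u @ b # a # w) + cst (inverse q - q) * bas (u @ a # b # w))"
      using True unfolding f(1) by (rule hop_Suc[OF f(2)])
    ultimately show ?thesis
      unfolding f(1) j by (auto simp: app_Pr app_linear)
  next
    case False
    then have "f \<notin> blk r m l" by (simp add: blk_def)
    with False show ?thesis by (simp add: app_hop app_Pr app_linear)
  qed
qed

lemma hop_Pr_top:
  assumes i: "l < i" "i < m"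
  shows "hop q (2 * (r + 2)) m i * Pr r m l = sc (inverse q) * Pr r m l"
proof (rule lop_eqI)
  fix f
  show "app (hop q (2 * (r + 2)) m i * Pr r m l) (bas f) = app (sc (inverse q) * Pr r m l) (bas f)"
  proof (cases "f \<in> blk r m l")
    case True
    then have O: "f \<in> Om (2 * (r + 2)) m" by (simp add: blk_def)
    obtain j where j: "i = Suc j" using i by (cases i) auto
    then obtain u a b w where f: "f = u @ a # b # w" "length u = j"
      using i O by (auto elim: Om_split[where i = j])
    have "a = b" using blk_top True f i j by auto
    then have "app (hop q (2 * (r + 2)) m i) (bas f) = cst (inverse q) * bas f"
      using hop_Suc[OF f(2) O[unfolded f(1)]] unfolding f(1) j by simp
    then show ?thesis using True by (simp add: app_Pr)
  qed (simp add: app_Pr)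
qed

text \<open>Position \<open>l\<close>, counted from 0, holds the top letter in the block of
  \<open>l\<close> and an inner letter in the block of \<open>k\<close>.\<close>

lemma blk_disjoint_less: "l < k \<Longrightarrow> k \<le> m \<Longrightarrow> f \<in> blk r m l \<Longrightarrow> f \<notin> blk r m k"
proof
  assume l: "l < k" "k \<le> m" and f: "f \<in> blk r m l" "f \<in> blk r m k"
  have len: "length f = m" using f by (simp add: blk_def Om_def)
  have "f ! l = drop l f ! 0" using l len by simp
  also have "\<dots> = hf (int r + 2)" using f l unfolding blk_def by simp
  finally have "f ! l = hf (int r + 2)" .
  moreover have "f ! l \<in> set (take k f)" using l len by (metis in_set_conv_nth length_take min.absorb2 nth_take)
  ultimately have "hf (int r + 2) \<in> half_idx (2 * (r + 1))" using f by (auto simp: blk_def)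
  then show False unfolding half_idx_hf by auto
qed

lemma Pr_mult:
  assumes "l \<le> m" "k \<le> m"
  shows "Pr r m l * Pr r m k = (if l = k then Pr r m l else 0)"
proof (rule lop_eqI)
  fix f
  have "f \<notin> blk r m l \<or> f \<notin> blk r m k" if "l \<noteq> k"
  proof (cases "l < k")
    case True
    then show ?thesis using blk_disjoint_less assms by blast
  next
    case False
    then have "k < l" using that by simp
    then show ?thesis using blk_disjoint_less assms by blast
  qed
  then show "app (Pr r m l * Pr r m k) (bas f) = app (if l = k then Pr r m l else 0) (bas f)"
    by (cases "l = k") (auto simp: app_Pr)
qed

text \<open>A permutation of the first \<open>l\<close> letters uses only
  \<open>H_1, ..., H_(l-1)\<close>, so its word may be evaluated with the Hecke operators of the
  full tensor space once the block has been cut out.\<close>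

fun hhP :: "'k::field \<Rightarrow> nat \<Rightarrow> nat \<Rightarrow> hh_gen \<Rightarrow> (rat list, 'k) lop" where
  "hhP q r m (GenT i) = hop q (2 * (r + 2)) m i"
| "hhP q r m (GenX l \<sigma>) = hecke_word (hop q (2 * (r + 2)) m) l \<sigma> * Pr r m l"

lemma hh_rels_closed: "hh_rels q m \<subseteq> carrier (free_algebra (hh_gens m))"
proof -
  have T: "HT i \<in> carrier (free_algebra (hh_gens m))" if "i < m" for i
    using that by (auto simp: hh_gens_def)
  have X: "HX l \<sigma> \<in> carrier (free_algebra (hh_gens m))" if "l \<le> m" "\<sigma> permutes {1..l}" for l \<sigma>
    using that by (auto simp: hh_gens_def)
  have sp: "simple_refl i permutes {1..l}" if "0 < i" "i < l" for i l
    using that by (intro simple_refl_permutes) auto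
  have pc: "\<sigma> \<circ> simple_refl i permutes {1..l}" "simple_refl i \<circ> \<sigma> permutes {1..l}"
    if "\<sigma> permutes {1..l}" "0 < i" "i < l" for i l \<sigma>
    using sp[OF that(2,3)] that(1) by (blast intro: permutes_compose)+
  have 0: "hecke_rels_for q m HT \<subseteq> carrier (free_algebra (hh_gens m))"
    by (rule hecke_rels_for_closed[OF T])
  show ?thesis
    unfolding hh_rels_def
    apply (intro Un_least 0)
             apply (safe)
             apply (intro free_algebra_closed(3,6,7,8) T X sp pc; simp)+
    done
qed

lemma Pr_commute_hecke_word:
  assumes "\<sigma> permutes {1..l}" "l \<le> m"
  shows "hecke_word (hop q (2 * (r + 2)) m) l \<sigma> * Pr r m l = Pr r m l * hecke_word (hop q (2 * (r + 2)) m) l \<sigma>"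
proof -
  have "wordR (hop q (2 * (r + 2)) m) w * Pr r m l = Pr r m l * wordR (hop q (2 * (r + 2)) m) w"
    if "set w \<subseteq> {1..<l}" for w
    using that
  proof (induct w)
    case (Cons i w)
    then have "hop q (2 * (r + 2)) m i * Pr r m l = Pr r m l * hop q (2 * (r + 2)) m i"
      using assms by (intro Pr_commute_hop) auto
    with Cons show ?case by (simp only: wordR_simps mult.assoc) (simp add: mult.assoc [symmetric])
  qed simp
  then show ?thesis unfolding hecke_word_def using set_red_word[OF assms(1)] by blast
qed

text \<open>The projection commutes with all \<open>H_i\<close> occurring in words for
  \<open>l\<close>. Hence the relations of the \<open>x\<close> generators reduce to the
  multiplication rules of Hecke words, to the orthogonality of the projections, and to the scalar
  \<open>q^-1\<close> on equal top letters.\<close>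

lemma evl_hh_rels:
  fixes q :: "'k::field"
  assumes q: "q \<noteq> 0" and p: "p \<in> hh_rels q m"
  shows "evl (wordR (hhP q r m)) p = 0"
proof -
  let ?A = "hop q (2 * (r + 2)) m"
  let ?W = "hecke_word ?A"
  let ?E = "evl (wordR (hhP q r m))"
  have H: "hecke_fam q l ?A" if "l \<le> m" for l
    using hecke_fam_mono[OF hecke_fam_hop[OF q] that] .
  have W: "?W l (simple_refl i) = ?A i" if "l \<le> m" "0 < i" "i < l" for l i
    using hecke_word_simple_refl[OF H] that by blast
  have WP: "?W l \<sigma> * Pr r m l = Pr r m l * ?W l \<sigma>" if "l \<le> m" "\<sigma> permutes {1..l}" for l \<sigma>
    using Pr_commute_hecke_word that by blast
  have AP: "?A i * Pr r m l = Pr r m l * ?A i" if "0 < i" "i < m" "i \<noteq> l" for i l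
    using Pr_commute_hop that by blast
  have PP: "Pr r m l * (Pr r m l * z) = Pr r m l * (z :: (rat list, 'k) lop)" if "l \<le> m" for l z
    using Pr_mult[OF that that, of r] by (metis mult.assoc)
  have XX: "(?W l \<sigma> * Pr r m l) * (?W l \<gamma> * Pr r m l) = ?W l \<sigma> * ?W l \<gamma> * Pr r m l"
    if "l \<le> m" "\<gamma> permutes {1..l}" for l \<sigma> \<gamma>
    using WP[OF that] PP[OF that(1)] by (simp add: mult.assoc)
  have AX: "?A i * (?W l \<sigma> * Pr r m l) = ?A i * ?W l \<sigma> * Pr r m l" for i l \<sigma>
    by (simp add: mult.assoc)
  have XA: "(?W l \<sigma> * Pr r m l) * ?A i = ?W l \<sigma> * ?A i * Pr r m l" if "0 < i" "i < m" "i \<noteq> l" for i l \<sigma>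
    using AP[OF that] by (simp add: mult.assoc)
  have sp: "simple_refl i permutes {1..l}" if "0 < i" "i < l" for i l
    using that by (intro simple_refl_permutes) auto
  show ?thesis
    using p unfolding hh_rels_def
  proof (elim UnE)
    assume "p \<in> hecke_rels_for q m HT"
    then show ?thesis
      using evl_hecke_rels[OF H[OF order_refl] q, of "hhP q r m" HT] by simp
  next
    assume "p \<in> {HX l \<sigma> * HX l (simple_refl i) - HX l (\<sigma> \<circ> simple_refl i) | l \<sigma> i.
        l \<le> m \<and> \<sigma> permutes {1..l} \<and> 0 < i \<and> i < l \<and>
        cox_length l (\<sigma> \<circ> simple_refl i) = cox_length l \<sigma> + 1}"
    then obtain l \<sigma> i where e: "p = HX l \<sigma> * HX l (simple_refl i) - HX l (\<sigma> \<circ> simple_refl i)"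
      and *: "l \<le> m" "\<sigma> permutes {1..l}" "0 < i" "i < l"
      and c: "cox_length l (\<sigma> \<circ> simple_refl i) = cox_length l \<sigma> + 1" by blast
    show ?thesis
      unfolding e evl_diff evl_wordR_mult evl_word_gen hhP.simps
      by (simp only: XX[OF *(1,2)]) (simp only: W[OF *(1,3,4)] hecke_word_right(1)[OF H[OF *(1)] *(2,3,4) c] diff_self)
  next
    assume "p \<in> {HX l \<sigma> * HX l (simple_refl i)
        - (HX l (\<sigma> \<circ> simple_refl i) + cst (inverse q - q) * HX l \<sigma>) | l \<sigma> i.
        l \<le> m \<and> \<sigma> permutes {1..l} \<and> 0 < i \<and> i < l \<and>
        cox_length l (\<sigma> \<circ> simple_refl i) + 1 = cox_length l \<sigma>}"
    then obtain l \<sigma> i where e: "p = HX l \<sigma> * HX l (simple_refl i)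
        - (HX l (\<sigma> \<circ> simple_refl i) + cst (inverse q - q) * HX l \<sigma>)"
      and *: "l \<le> m" "\<sigma> permutes {1..l}" "0 < i" "i < l"
      and c: "cox_length l (\<sigma> \<circ> simple_refl i) + 1 = cox_length l \<sigma>" by blast
    show ?thesis
      unfolding e evl_diff evl_add evl_scale evl_wordR_mult evl_word_gen hhP.simps
      by (simp only: XX[OF *(1,2)]) (simp only: W[OF *(1,3,4)] hecke_word_right(2)[OF H[OF *(1)] *(2,3,4) c]
        distrib_right mult.assoc diff_self)
  next
    assume "p \<in> {HX l (simple_refl i) * HX l \<sigma> - HX l (simple_refl i \<circ> \<sigma>) | l \<sigma> i.
        l \<le> m \<and> \<sigma> permutes {1..l} \<and> 0 < i \<and> i < l \<and>
        cox_length l (simple_refl i \<circ> \<sigma>) = cox_length l \<sigma> + 1}"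
    then obtain l \<sigma> i where e: "p = HX l (simple_refl i) * HX l \<sigma> - HX l (simple_refl i \<circ> \<sigma>)"
      and *: "l \<le> m" "\<sigma> permutes {1..l}" "0 < i" "i < l"
      and c: "cox_length l (simple_refl i \<circ> \<sigma>) = cox_length l \<sigma> + 1" by blast
    show ?thesis
      unfolding e evl_diff evl_wordR_mult evl_word_gen hhP.simps
      by (simp only: XX[OF *(1) sp[OF *(3,4)]]) (simp only: W[OF *(1,3,4)] hecke_word_left(1)[OF H[OF *(1)] *(2,3,4) c] diff_self)
  next
    assume "p \<in> {HX l (simple_refl i) * HX l \<sigma>
        - (HX l (simple_refl i \<circ> \<sigma>) + cst (inverse q - q) * HX l \<sigma>) | l \<sigma> i.
        l \<le> m \<and> \<sigma> permutes {1..l} \<and> 0 < i \<and> i < l \<and>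
        cox_length l (simple_refl i \<circ> \<sigma>) + 1 = cox_length l \<sigma>}"
    then obtain l \<sigma> i where e: "p = HX l (simple_refl i) * HX l \<sigma>
        - (HX l (simple_refl i \<circ> \<sigma>) + cst (inverse q - q) * HX l \<sigma>)"
      and *: "l \<le> m" "\<sigma> permutes {1..l}" "0 < i" "i < l"
      and c: "cox_length l (simple_refl i \<circ> \<sigma>) + 1 = cox_length l \<sigma>" by blast
    show ?thesis
      unfolding e evl_diff evl_add evl_scale evl_wordR_mult evl_word_gen hhP.simps
      by (simp only: XX[OF *(1) sp[OF *(3,4)]]) (simp only: W[OF *(1,3,4)] hecke_word_left(2)[OF H[OF *(1)] *(2,3,4) c]
        distrib_right mult.assoc diff_self)
  next
    assume "p \<in> {HX l \<sigma> * HX k \<gamma> | l \<sigma> k \<gamma>.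
        l \<le> m \<and> \<sigma> permutes {1..l} \<and> k \<le> m \<and> \<gamma> permutes {1..k} \<and> l \<noteq> k}"
    then obtain l \<sigma> k \<gamma> where e: "p = HX l \<sigma> * HX k \<gamma>"
      and *: "l \<le> m" "\<sigma> permutes {1..l}" "k \<le> m" "l \<noteq> k" by blast
    have "(?W k \<gamma> * Pr r m k) * (?W l \<sigma> * Pr r m l) = ?W k \<gamma> * (Pr r m k * Pr r m l) * ?W l \<sigma>"
      unfolding WP[OF *(1,2)] by (simp only: mult.assoc)
    also have "Pr r m k * Pr r m l = (0 :: (rat list, 'k) lop)" using Pr_mult[OF *(3,1)] *(4) by simp
    finally show ?thesis
      unfolding e evl_wordR_mult evl_word_gen hhP.simps by simp
  next
    assume "p \<in> {HT i * HX l \<sigma> - HX l (simple_refl i) * HX l \<sigma> | l \<sigma> i.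
        l \<le> m \<and> \<sigma> permutes {1..l} \<and> 0 < i \<and> i < l}"
    then obtain l \<sigma> i where e: "p = HT i * HX l \<sigma> - HX l (simple_refl i) * HX l \<sigma>"
      and *: "l \<le> m" "\<sigma> permutes {1..l}" "0 < i" "i < l" by blast
    have im: "i < m" "i \<noteq> l" using * by auto
    show ?thesis
      unfolding e evl_diff evl_wordR_mult evl_word_gen hhP.simps
      by (simp only: XX[OF *(1) sp[OF *(3,4)]]) (simp only: W[OF *(1,3,4)] XA[OF *(3) im] diff_self)
  next
    assume "p \<in> {HX l \<sigma> * HT i - HX l \<sigma> * HX l (simple_refl i) | l \<sigma> i.
        l \<le> m \<and> \<sigma> permutes {1..l} \<and> 0 < i \<and> i < l}"
    then obtain l \<sigma> i where e: "p = HX l \<sigma> * HT i - HX l \<sigma> * HX l (simple_refl i)"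
      and *: "l \<le> m" "\<sigma> permutes {1..l}" "0 < i" "i < l" by blast
    show ?thesis
      unfolding e evl_diff evl_wordR_mult evl_word_gen hhP.simps
      by (simp only: XX[OF *(1,2)]) (simp only: W[OF *(1,3,4)] AX diff_self)
  next
    assume "p \<in> {HT i * HX l \<sigma> - cst (inverse q) * HX l \<sigma> | l \<sigma> i.
        l \<le> m \<and> \<sigma> permutes {1..l} \<and> l < i \<and> i < m}"
    then obtain l \<sigma> i where e: "p = HT i * HX l \<sigma> - cst (inverse q) * HX l \<sigma>"
      and *: "l \<le> m" "\<sigma> permutes {1..l}" "l < i" "i < m" by blast
    have "(?W l \<sigma> * Pr r m l) * ?A i = ?W l \<sigma> * (?A i * Pr r m l)"
      using * by (simp only: mult.assoc) (subst AP, auto)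
    also have "\<dots> = sc (inverse q) * (?W l \<sigma> * Pr r m l)"
      by (simp only: hop_Pr_top[OF *(3,4)] sc_commute_left)
    finally show ?thesis
      unfolding e evl_diff evl_scale evl_wordR_mult evl_word_gen hhP.simps by simp
  next
    assume "p \<in> {HX l \<sigma> * HT i - cst (inverse q) * HX l \<sigma> | l \<sigma> i.
        l \<le> m \<and> \<sigma> permutes {1..l} \<and> l < i \<and> i < m}"
    then obtain l \<sigma> i where e: "p = HX l \<sigma> * HT i - cst (inverse q) * HX l \<sigma>"
      and *: "l \<le> m" "\<sigma> permutes {1..l}" "l < i" "i < m" by blast
    have "?A i * (?W l \<sigma> * Pr r m l) = sc (inverse q) * (?W l \<sigma> * Pr r m l)"
      unfolding WP[OF *(1,2)] by (simp only: mult.assoc [symmetric] hop_Pr_top[OF *(3,4)])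
    then show ?thesis
      unfolding e evl_diff evl_scale evl_wordR_mult evl_word_gen hhP.simps by simp
  qed
qed

text \<open>For \<open>0 < i < l\<close> the operator looks only at two neighbouring letters of the
  first part, so the tail is carried along unchanged.\<close>

lemma hop_mult_left:
  assumes u: "u \<in> sp (Om N' l)" and d: "\<And>g. g \<in> Om N' l \<Longrightarrow> g @ d \<in> Om N m" and i: "0 < i" "i < l"
  shows "app (hop q N m i) (u * bas d) = app (hop q N' l i) u * bas d"
  using u
proof (induct rule: sp_induct)
  case (single c g)
  obtain j where j: "i = Suc j" using i by (cases i) auto
  obtain u a b w where g: "g = u @ a # b # w" "length u = j"
    using i j single by (auto elim: Om_split[where i = j])
  have "app (hop q N m (Suc j)) (bas ((u @ a # b # w) @ d)) = app (hop q N' l (Suc j)) (bas (u @ a # b # w)) * bas d"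
    using hop_Suc[OF g(2), of a b w N' l q] hop_Suc[OF g(2), of a b "w @ d" N m q] single d[OF single] g
    by (simp add: bas_append [symmetric] distrib_right mult.assoc)
  then show ?case unfolding g j by (simp only: bas_append app_scale mult.assoc)
qed (simp_all add: distrib_right app_add)

lemma Om_top_append:
  assumes "g \<in> Om (2 * (r + 1)) l" "l \<le> m"
  shows "g @ replicate (m - l) (hf (int r + 2)) \<in> Om (2 * (r + 2)) m"
proof -
  have "half_idx (2 * (r + 1)) \<subseteq> half_idx (2 * (r + 2))"
    unfolding half_idx_hf by (intro image_mono) auto
  moreover have "hf (int r + 2) \<in> half_idx (2 * (r + 2))"
    unfolding half_idx_hf by (intro imageI) auto
  ultimately show ?thesis using assms by (auto simp: Om_def)
qed

lemma hecke_word_mult_left: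
  assumes u: "u \<in> sp (Om (2 * (r + 1)) l)" and l: "l \<le> m" and w: "set w \<subseteq> {1..<l}"
  shows "app (wordR (hop q (2 * (r + 2)) m) w) (u * bas (replicate (m - l) (hf (int r + 2))))
    = app (wordR (hop q (2 * (r + 1)) l) w) u * bas (replicate (m - l) (hf (int r + 2)))"
  using w u
proof (induct w arbitrary: u)
  case (Cons i w)
  then have "app (hop q (2 * (r + 2)) m i) (u * bas (replicate (m - l) (hf (int r + 2))))
      = app (hop q (2 * (r + 1)) l i) u * bas (replicate (m - l) (hf (int r + 2)))"
    using Om_top_append[OF _ l] by (intro hop_mult_left) auto
  moreover have "app (hop q (2 * (r + 1)) l i) u \<in> sp (Om (2 * (r + 1)) l)"
    using Cons by (intro pres_app hop_pres) auto
  ultimately show ?case using Cons by simp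
qed simp

lemma blk_iff:
  assumes "f \<in> Om (2 * r + 4) m"
  shows "f \<in> blk r m l \<longleftrightarrow> set (take l f) \<subseteq> half_idx (2 * r + 2) \<and>
      drop l f = replicate (m - l) (of_nat r + 3/2)"
proof -
  have "hf (int r + 2) = of_nat r + 3/2" by (simp add: hf_def)
  moreover have "2 * r + 4 = 2 * (r + 2)" "2 * r + 2 = 2 * (r + 1)" by simp_all
  ultimately show ?thesis using assms unfolding blk_def by (simp only: mem_Collect_eq simp_thms)
qed

lemma hhP_pres:
  assumes "g \<in> hh_gens m"
  shows "pres (Om (2 * (r + 2)) m) (hhP q r m g)"
proof (cases g)
  case (GenT i)
  with assms show ?thesis by (auto simp: hh_gens_def intro: hop_pres[of _ m "r + 2", simplified])
next
  case (GenX l \<sigma>)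
  then have l: "l \<le> m" "\<sigma> permutes {1..l}" using assms by (auto simp: hh_gens_def)
  have "pres (Om (2 * (r + 2)) m) (wordR (hop q (2 * (r + 2)) m) (red_word l \<sigma>))"
    using set_red_word[OF l(2)] l(1) by (intro pres_wordR hop_pres) auto
  moreover have "pres (Om (2 * (r + 2)) m) (Pr r m l)"
    by (auto simp: pres_def app_Pr intro: sp_closed)
  ultimately show ?thesis
    unfolding GenX hhP.simps hecke_word_def by (rule pres_closed)
qed

lemma hh_op_hhP:
  fixes q :: "'k::field"
  assumes q: "q \<noteq> 0" and g: "g \<in> hh_gens m" and v: "v \<in> sp (Om (2 * r + 4) m)"
  shows "hh_op q r m g v = app (hhP q r m g) v"
proof (cases g)
  case (GenT i)
  then have i: "i < m" using g by (auto simp: hh_gens_def)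
  have N: "2 * r + 4 = 2 * (r + 2)" by simp
  have "gen i \<in> carrier (free_algebra {..<m})" using i by auto
  from Psi_cls[OF q this, of "r + 2"] show ?thesis
    unfolding GenT hh_op.simps hhP.simps N using v by (simp add: tensor_space_sp N)
next
  case (GenX l \<sigma>)
  then have l: "l \<le> m" "\<sigma> permutes {1..l}" using g by (auto simp: hh_gens_def)
  let ?w = "red_word l \<sigma>"
  have w: "set ?w \<subseteq> {1..<l}" by (rule set_red_word[OF l(2)])
  have N: "2 * r + 2 = 2 * (r + 1)" by simp
  have *: "bas ?w \<in> carrier (free_algebra {..<l})"
    using w by (intro free_algebra_closed(4)) (auto simp: subset_iff)
  have "hh_op q r m g v = lin (\<lambda>f. app (hhP q r m g) (bas f)) v"
    unfolding GenX hh_op.simps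
  proof (rule lin_cong)
    fix f assume "f \<in> Poly_Mapping.keys v"
    then have f: "f \<in> Om (2 * r + 4) m" using v by (auto simp: sp_def)
    show "(if set (take l f) \<subseteq> half_idx (2 * r + 2) \<and> drop l f = replicate (m - l) (of_nat r + 3/2)
       then Psi q (2 * r + 2) l (hecke_elt q l \<sigma>) (bas (take l f)) * bas (drop l f) else 0)
      = app (hhP q r m (GenX l \<sigma>)) (bas f)"
    proof (cases "f \<in> blk r m l")
      case True
      then have t: "take l f \<in> Om (2 * (r + 1)) l" and d: "drop l f = replicate (m - l) (hf (int r + 2))"
        using l by (auto simp: blk_def Om_def)
      have "app (hhP q r m (GenX l \<sigma>)) (bas f) = app (wordR (hop q (2 * (r + 2)) m) ?w) (bas (take l f) * bas (drop l f))"
        using True by (simp add: hecke_word_def app_Pr bas_append [symmetric])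
      also have "\<dots> = app (wordR (hop q (2 * (r + 1)) l) ?w) (bas (take l f)) * bas (drop l f)"
        unfolding d by (rule hecke_word_mult_left[OF sp_bas[OF t] l(1) w])
      also have "app (wordR (hop q (2 * (r + 1)) l) ?w) (bas (take l f)) = Psi q (2 * r + 2) l (hecke_elt q l \<sigma>) (bas (take l f))"
        unfolding N hecke_elt_def red_word_def [symmetric] Psi_cls[OF q *] tensor_space_sp
        by (simp only: restrict_apply sp_bas[OF t] if_True evl_bas)
      finally have eq: "app (hhP q r m (GenX l \<sigma>)) (bas f) =
          Psi q (2 * r + 2) l (hecke_elt q l \<sigma>) (bas (take l f)) * bas (drop l f)" .
      have "set (take l f) \<subseteq> half_idx (2 * r + 2) \<and> drop l f = replicate (m - l) (of_nat r + 3/2)"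
        using True blk_iff[OF f] by blast
      then show ?thesis unfolding eq by (rule if_P)
    next
      case False
      then have "\<not> (set (take l f) \<subseteq> half_idx (2 * r + 2) \<and> drop l f = replicate (m - l) (of_nat r + 3/2))"
        using blk_iff[OF f] by blast
      moreover have "app (hhP q r m (GenX l \<sigma>)) (bas f) = 0" using False by (simp add: app_Pr)
      ultimately show ?thesis by (simp only: if_False)
    qed
  qed
  then show ?thesis by (simp only: app_expand [of "hhP q r m g" v])
qed

lemma Xi_cls:
  fixes q :: "'k::field"
  assumes q: "q \<noteq> 0" and p: "p \<in> carrier (free_algebra (hh_gens m))"
  shows "Xi q r m (cls (hh_gens m) (hh_rels q m) p) =
    restrict (app (evl (wordR (hhP q r m)) p)) (tensor_space (2 * r + 4) m)"
  unfolding Xi_def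
proof (rule induced_cls[OF hh_rels_closed])
  have N: "2 * r + 4 = 2 * (r + 2)" by simp
  fix p :: "hh_gen list \<Rightarrow>\<^sub>0 'k" and v :: "rat list \<Rightarrow>\<^sub>0 'k"
  assume p: "p \<in> carrier (free_algebra (hh_gens m))" and v: "v \<in> tensor_space (2 * r + 4) m"
  show "right_act (hh_op q r m) p v = app (evl (wordR (hhP q r m)) p) v"
  proof (rule right_act_agree[OF _ hh_op_hhP[OF q] p])
    show "pres (Om (2 * r + 4) m) (hhP q r m g)" if "g \<in> hh_gens m" for g
      using hhP_pres[OF that, of r q] by (simp only: N)
  qed (use v in \<open>auto simp: tensor_space_sp\<close>)
next
  show "evl (wordR (hhP q r m)) p = 0" if "p \<in> hh_rels q m" for p
    by (rule evl_hh_rels[OF q that])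
qed (use p in auto)

text \<open>Only the generators \<open>T_i\<close> and \<open>x_id^(l)\<close> are tested, because
  every other \<open>x\<close> generator acts as a product of these.\<close>

definition commutant :: "'k::field \<Rightarrow> nat \<Rightarrow> nat \<Rightarrow> (rat list, 'k) lop set" where
  "commutant q r m = {A. pres (Om (2 * r + 4) m) A \<and>
     (\<forall>v\<in>sp (Om (2 * r + 4) m).
       (\<forall>i<m. app (A * hop q (2 * r + 4) m i) v = app (hop q (2 * r + 4) m i * A) v) \<and>
       (\<forall>l\<le>m. app (A * Pr r m l) v = app (Pr r m l * A) v))}"

lemma End_duplex_hecke_eq:
  fixes q :: "'k::field"
  assumes q: "q \<noteq> 0"
  shows "End_duplex_hecke q r m = (\<lambda>A. restrict (app A) (tensor_space (2 * r + 4) m)) ` commutant q r m"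
proof (intro equalityI subsetI)
  let ?O = "Om (2 * r + 4) m" and ?W = "tensor_space (2 * r + 4) m :: (rat list \<Rightarrow>\<^sub>0 'k) set"
  have N: "2 * r + 4 = 2 * (r + 2)" by simp
  have W: "?W = sp ?O" by (rule tensor_space_sp)
  fix A assume A: "A \<in> End_duplex_hecke q r m"
  then have lin: "A (v + w) = A v + A w" "A (cst c * v) = cst c * A v" "A v \<in> ?W"
    if "v \<in> ?W" "w \<in> ?W" for v w c
    using that by (auto simp: End_duplex_hecke_def tensor_End_def)
  have ext: "A \<in> ?W \<rightarrow>\<^sub>E ?W" using A by (simp add: End_duplex_hecke_def tensor_End_def)
  \<comment> \<open>Extension by 0 turns an operator on tensor space into one on the free
    module.\<close>
  define B where "B = Lin (\<lambda>f. if f \<in> ?O then A (bas f) else 0)"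
  have A0: "A 0 = 0" using lin(2)[of 0 0 0] W by (simp add: sp_0)
  have "A v = app B v \<and> v \<in> sp ?O" if "v \<in> sp ?O" for v
    using that
  proof (induct rule: sp_induct)
    case (single c b)
    then show ?case using lin(2)[of "bas b" "bas b" c] W by (simp add: B_def app_scale sp_bas sp_scale)
  next
    case (add v w)
    then show ?case using lin(1)[of v w] W by (simp add: app_add sp_add)
  qed (simp add: A0 sp_0)
  then have AB: "A v = app B v" if "v \<in> ?W" for v using that W by blast
  then have eq: "A = restrict (app B) ?W"
    using ext by (auto simp: fun_eq_iff restrict_def PiE_def extensional_def)
  have presB: "pres ?O B"
    unfolding pres_def using AB lin(3) W sp_bas by metis
  have comm: "app (B * evl (wordR (hhP q r m)) p) v = app (evl (wordR (hhP q r m)) p * B) v"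
    if p: "p \<in> carrier (free_algebra (hh_gens m))" and v: "v \<in> sp ?O" for p v
  proof -
    have c: "cls (hh_gens m) (hh_rels q m) p \<in> carrier (duplex_hecke q m)"
      unfolding duplex_hecke_def carrier_presented[OF hh_rels_closed] using p by (rule imageI)
    have pE: "pres ?O (evl (wordR (hhP q r m)) p)"
      using p unfolding N by (intro pres_evl pres_wordR hhP_pres) (auto simp: carrier_free_algebra)
    have "A (Xi q r m (cls (hh_gens m) (hh_rels q m) p) v) = Xi q r m (cls (hh_gens m) (hh_rels q m) p) (A v)"
      using A c v W by (auto simp: End_duplex_hecke_def)
    then show ?thesis
      unfolding Xi_cls[OF q p] using v W AB pres_app[OF pE v] pres_app[OF presB v] by simp
  qed
  have "app (B * hop q (2 * r + 4) m i) v = app (hop q (2 * r + 4) m i * B) v" if "i < m" "v \<in> sp ?O" for i v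
    using comm[of "HT i" v] that unfolding N by (auto simp: hh_gens_def)
  moreover have "app (B * Pr r m l) v = app (Pr r m l * B) v" if l: "l \<le> m" and v: "v \<in> sp ?O" for l v
  proof -
    \<comment> \<open>The reduced word of the identity is empty, which leaves the bare
      projection.\<close>
    have "HX l id \<in> carrier (free_algebra (hh_gens m))"
      using l permutes_id by (auto simp: hh_gens_def)
    from comm[OF this v] show ?thesis
      by (simp only: evl_word_gen hhP.simps hecke_word_def red_word_id wordR_simps mult_1_left)
  qed
  ultimately have "B \<in> commutant q r m"
    using presB by (auto simp: commutant_def)
  with eq show "A \<in> (\<lambda>A. restrict (app A) ?W) ` commutant q r m" by blast
next
  let ?O = "Om (2 * r + 4) m" and ?W = "tensor_space (2 * r + 4) m :: (rat list \<Rightarrow>\<^sub>0 'k) set"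
  have N: "2 * r + 4 = 2 * (r + 2)" by simp
  have W: "?W = sp ?O" by (rule tensor_space_sp)
  fix A assume "A \<in> (\<lambda>A. restrict (app A) ?W) ` commutant q r m"
  then obtain B where B: "B \<in> commutant q r m" and A: "A = restrict (app B) ?W" by blast
  have presB: "pres ?O B" using B by (simp add: commutant_def)
  have Bhop: "app B (app (hop q (2 * r + 4) m i) v) = app (hop q (2 * r + 4) m i) (app B v)" if "i < m" "v \<in> sp ?O" for i v
    using B that by (auto simp: commutant_def)
  have BPr: "app B (app (Pr r m l) v) = app (Pr r m l) (app B v)" if "l \<le> m" "v \<in> sp ?O" for l v
    using B that by (auto simp: commutant_def)
  have word: "app B (app (wordR P w) v) = app (wordR P w) (app B v)"
    if "\<And>g. g \<in> set w \<Longrightarrow> pres ?O (P g)"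
      "\<And>g v. g \<in> set w \<Longrightarrow> v \<in> sp ?O \<Longrightarrow> app B (app (P g) v) = app (P g) (app B v)" "v \<in> sp ?O"
    for P :: "'g \<Rightarrow> (rat list, 'k) lop" and w v
    using that
  proof (induct w arbitrary: v)
    case (Cons g w)
    moreover have "app (P g) v \<in> sp ?O" using Cons by (intro pres_app) auto
    ultimately show ?case by simp
  qed simp
  have PrO: "pres ?O (Pr r m l)" for l
    by (auto simp: pres_def app_Pr intro: sp_closed)
  have gens: "app B (app (hhP q r m g) v) = app (hhP q r m g) (app B v)" if g: "g \<in> hh_gens m" and v: "v \<in> sp ?O" for g v
  proof (cases g)
    case (GenT i)
    then show ?thesis using g v Bhop[of i v] unfolding N by (auto simp: hh_gens_def)
  next
    case (GenX l \<sigma>)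
    then have l: "l \<le> m" "\<sigma> permutes {1..l}" using g by (auto simp: hh_gens_def)
    have "app B (app (wordR (hop q (2 * r + 4) m) (red_word l \<sigma>)) u) = app (wordR (hop q (2 * r + 4) m) (red_word l \<sigma>)) (app B u)"
      if "u \<in> sp ?O" for u
      using set_red_word[OF l(2)] l(1) that
      by (intro word Bhop) (auto simp: N intro!: hop_pres[of _ m "r + 2", simplified])
    from this[of "app (Pr r m l) v"] show ?thesis
      unfolding GenX hhP.simps hecke_word_def N [symmetric] app_times_lop
      using pres_app[OF PrO v] BPr[OF l(1) v] by simp
  qed
  have comm: "app B (app (evl (wordR (hhP q r m)) p) v) = app (evl (wordR (hhP q r m)) p) (app B v)"
    if p: "p \<in> carrier (free_algebra (hh_gens m))" and v: "v \<in> sp ?O" for p v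
  proof -
    have "app B (app (wordR (hhP q r m) w) v) = app (wordR (hhP q r m) w) (app B v)"
      if "w \<in> Poly_Mapping.keys p" for w
    proof (rule word[OF _ _ v])
      fix g assume "g \<in> set w"
      then have g: "g \<in> hh_gens m" using p that by (auto simp: carrier_free_algebra)
      show "pres ?O (hhP q r m g)" unfolding N by (rule hhP_pres[OF g])
      show "app B (app (hhP q r m g) v) = app (hhP q r m g) (app B v)" if "v \<in> sp ?O" for v
        by (rule gens[OF g that])
    qed
    then show ?thesis unfolding app_evl app_lin by (rule lin_cong)
  qed
  have "A \<in> tensor_End (2 * r + 4) m"
    unfolding tensor_End_def A using pres_app[OF presB] W
    by (auto simp: app_add app_scale sp_add sp_scale)
  moreover have "A (Xi q r m h v) = Xi q r m h (A v)" if h: "h \<in> carrier (duplex_hecke q m)" and v: "v \<in> ?W" for h v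
  proof -
    obtain p where p: "p \<in> carrier (free_algebra (hh_gens m))" and h: "h = cls (hh_gens m) (hh_rels q m) p"
      using h unfolding duplex_hecke_def carrier_presented[OF hh_rels_closed] by blast
    have pE: "pres ?O (evl (wordR (hhP q r m)) p)"
      using p unfolding N by (intro pres_evl pres_wordR hhP_pres) (auto simp: carrier_free_algebra)
    show ?thesis
      unfolding h Xi_cls[OF q p] A using v W comm[OF p, of v] pres_app[OF pE, of v] pres_app[OF presB, of v] by simp
  qed
  ultimately show "A \<in> End_duplex_hecke q r m"
    by (simp add: End_duplex_hecke_def)
qed

subsection \<open>Commutation of the two actions\<close>

definition com :: "'b set \<Rightarrow> ('b::monoid_add, 'k::comm_ring_1) lop \<Rightarrow> ('b, 'k) lop \<Rightarrow> bool" where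
  "com S A B \<longleftrightarrow> pres S A \<and> pres S B \<and> (\<forall>v\<in>sp S. app A (app B v) = app B (app A v))"

lemma comI:
  assumes "pres S A" "pres S B" "\<And>b. b \<in> S \<Longrightarrow> app A (app B (bas b)) = app B (app A (bas b))"
  shows "com S A B"
proof -
  have "app (A * B) v = app (B * A) v" if "v \<in> sp S" for v
    using that by (rule app_eq_on[rotated]) (simp add: assms(3))
  with assms show ?thesis by (simp add: com_def)
qed

lemma com_add: "com S A B \<Longrightarrow> com S A C \<Longrightarrow> com S A (B + C)"
  by (simp add: com_def pres_closed app_add)

lemma com_mult: "com S A B \<Longrightarrow> com S A C \<Longrightarrow> com S A (B * C)"
  by (auto simp: com_def pres_closed pres_app)

lemma com_sc: "pres S A \<Longrightarrow> com S A (sc c)"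
  by (simp add: com_def pres_closed app_scale)

text \<open>With the identity as first operator, the closure rules for commutation double as closure
  rules for preserving a subspace.\<close>

lemma com_one_iff: "com S 1 B \<longleftrightarrow> pres S B"
  by (simp add: com_def pres_closed)

fun gidx :: "uq_gen \<Rightarrow> int" where
  "gidx (GenE i) = i" | "gidx (GenF i) = i" | "gidx (GenK i) = i" | "gidx (GenKinv i) = i"

lemma com_coprod:
  assumes "\<And>g. gidx g = i \<Longrightarrow> com S A (P g)" "\<And>g. gidx g = i \<Longrightarrow> com S A (Q g)" "gidx g = i"
  shows "com S A (coprod P Q g)"
  using assms by (cases g) (auto intro!: com_add com_mult)

lemma com_fam:
  assumes A: "pres S A" and "\<And>p g. p < n \<Longrightarrow> gidx g = i \<Longrightarrow> com S A (sitefam q p g)" "gidx g = i"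
  shows "com S A (fam q n g)"
  using assms(2-)
proof (induct n arbitrary: g)
  case (Suc n)
  then show ?case unfolding fam.simps by (intro com_coprod[of i]) auto
qed (simp add: com_sc A)

text \<open>Every generator sends a basis vector to a multiple of a basis vector, with coefficient
  \<open>nc\<close> and target \<open>nx\<close>. For E and F, where the coefficient is 0 the target
  defaults to the vector itself, so that such letters are not moved.\<close>

fun nc :: "'k::field \<Rightarrow> uq_gen \<Rightarrow> rat \<Rightarrow> 'k" where
  "nc q (GenE i) a = (if a = hf (i + 1) then 1 else 0)"
| "nc q (GenF i) a = (if a = hf i then 1 else 0)"
| "nc q (GenK i) a = (if a = hf i then q else if a = hf (i + 1) then inverse q else 1)"
| "nc q (GenKinv i) a = (if a = hf i then inverse q else if a = hf (i + 1) then q else 1)"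

fun nx :: "uq_gen \<Rightarrow> rat \<Rightarrow> rat" where
  "nx (GenE i) a = (if a = hf (i + 1) then hf i else a)"
| "nx (GenF i) a = (if a = hf i then hf (i + 1) else a)"
| "nx (GenK i) a = a"
| "nx (GenKinv i) a = a"

lemma natop_basis_monomial: "natop_basis q g a = cst (nc q g a) * bas (nx g a)"
  by (cases g) simp_all

lemma app_sitefam:
  "app (sitefam q p g) (bas f) =
    (if p < length f then cst (nc q g (f ! p)) * bas (f[p := nx g (f ! p)]) else cst (counit g) * bas f)"
  by (simp add: sitefam_def aug_def app_site app_short app_natop natop_basis_monomial lin_scale)

text \<open>The letters are unbounded, so that E and F operators of every index preserve this span;
  commutation with the Hecke operators is checked here.\<close>

definition HL :: "nat \<Rightarrow> rat list set" where
  "HL m = {f. length f = m \<and> set f \<subseteq> range hf}"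

lemma nx_range: "a \<in> range hf \<Longrightarrow> nx g a \<in> range hf"
  by (cases g) auto

lemma sitefam_pres_HL: "pres (HL m) (sitefam q p g)"
  unfolding pres_def
proof
  fix f assume f: "f \<in> HL m"
  have "f[p := nx g (f ! p)] \<in> HL m" if "p < length f"
  proof -
    have "f ! p \<in> range hf" using f that nth_mem unfolding HL_def by blast
    then show ?thesis
      using f nx_range[of "f ! p" g] set_update_subset_insert[of f p "nx g (f ! p)"] by (auto simp: HL_def)
  qed
  with f show "app (sitefam q p g) (bas f) \<in> sp (HL m)"
    by (auto simp: app_sitefam intro!: sp_scale sp_bas)
qed

definition HR :: "'k::field \<Rightarrow> nat \<Rightarrow> (rat list, 'k) lop" where
  "HR q j = Lin (hecke_op_basis q j)"

lemma app_HR: "app (HR q j) (bas f) = hecke_op_basis q j f"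
  by (simp add: HR_def)

lemma HL_split:
  assumes "f \<in> HL l" "Suc i < l"
  obtains u a b w where "f = u @ a # b # w" "length u = i"
proof -
  have l: "length f = l" using assms by (simp add: HL_def)
  have "f = take i f @ f ! i # drop (Suc i) f"
    using assms l by (intro id_take_nth_drop) auto
  also have "drop (Suc i) f = f ! Suc i # drop (Suc (Suc i)) f"
    using assms l by (intro Cons_nth_drop_Suc[symmetric]) auto
  finally show ?thesis using that[of "take i f"] assms l by auto
qed

lemma HR_pres:
  assumes "j < m"
  shows "pres (HL m) (HR q j)"
  unfolding pres_def
proof
  fix f assume f: "f \<in> HL m"
  show "app (HR q j) (bas f) \<in> sp (HL m)"
  proof (cases j)
    case 0
    then obtain a w where fw: "f = a # w" using f assms by (cases f) (auto simp: HL_def)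
    obtain x where "a = hf x" using f fw by (auto simp: HL_def)
    then have "- a # w \<in> HL m" using f fw by (auto simp: HL_def hf_uminus)
    with f show ?thesis unfolding 0 app_HR fw by (auto simp: hecke_op_0 intro!: sp_closed)
  next
    case (Suc i)
    obtain u a b w where "f = u @ a # b # w" "length u = i"
      using f assms Suc by (auto elim: HL_split[where i = i])
    with f Suc show ?thesis
      by (auto simp: app_HR hecke_op_Suc HL_def intro!: sp_closed)
  qed
qed

lemma com_HR_Suc_far:
  fixes q :: "'k::field"
  assumes j: "Suc j < m" and p: "p \<noteq> j" "p \<noteq> Suc j"
  shows "com (HL m) (HR q (Suc j)) (sitefam q p g)"
proof (rule comI[OF HR_pres[OF j] sitefam_pres_HL])
  fix f assume f: "f \<in> HL m"
  show "app (HR q (Suc j)) (app (sitefam q p g) (bas f)) = app (sitefam q p g) (app (HR q (Suc j)) (bas f))"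
  proof (cases "p < m")
    case True
    obtain u a b w where fu: "f = u @ a # b # w" "length u = j"
      using f j by (auto elim: HL_split)
    have len: "length f = m" using f by (simp add: HL_def)
    consider "p < j" | k where "p = j + Suc (Suc k)" "k < length w"
    proof (cases "p < j")
      case False
      then have "p = j + Suc (Suc (p - Suc (Suc j)))" using p by simp
      with that(2)[of "p - Suc (Suc j)"] True len fu show ?thesis by simp
    qed
    then show ?thesis
    proof cases
      case 1
      have "app (sitefam q p g) (bas (u @ c # d # w)) = cst (nc q g (u ! p)) * bas (u[p := nx g (u ! p)] @ c # d # w)" for c d
        using 1 fu by (simp add: app_sitefam nth_append list_update_append)
      then show ?thesis
        unfolding fu(1) using fu(2) by (auto simp: app_HR hecke_op_Suc app_linear distrib_left cst_mult_assoc mult.commute)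
    next
      case (2 k)
      have "app (sitefam q p g) (bas (u @ c # d # w)) = cst (nc q g (w ! k)) * bas (u @ c # d # w[k := nx g (w ! k)])" for c d
        using 2 fu by (simp add: app_sitefam nth_append list_update_append)
      then show ?thesis
        unfolding fu(1) using fu(2) by (auto simp: app_HR hecke_op_Suc app_linear distrib_left cst_mult_assoc mult.commute)
    qed
  next
    case False
    have "app (sitefam q p g) v = cst (counit g) * v" if "v \<in> sp (HL m)" for v
    proof -
      have "app (sitefam q p g) v = app (sc (counit g)) v"
        using that by (rule app_eq_on[rotated]) (use False in \<open>auto simp: app_sitefam HL_def\<close>)
      then show ?thesis by simp
    qed
    moreover have "(bas f :: rat list \<Rightarrow>\<^sub>0 'k) \<in> sp (HL m)" "app (HR q (Suc j)) (bas f) \<in> sp (HL m)"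
      using f pres_app[OF HR_pres[OF j]] by (auto intro: sp_bas)
    ultimately show ?thesis by (simp add: app_scale)
  qed
qed

lemma com_HR_0_far:
  assumes m: "0 < m" and p: "0 < p"
  shows "com (HL m) (HR q 0) (sitefam q p g)"
proof (rule comI[OF HR_pres[OF m] sitefam_pres_HL])
  fix f assume f: "f \<in> HL m"
  then obtain a w where fw: "f = a # w" using m by (cases f) (auto simp: HL_def)
  obtain k where k: "p = Suc k" using p by (cases p) auto
  have "app (sitefam q p g) (bas (c # w)) =
      (if k < length w then cst (nc q g (w ! k)) * bas (c # w[k := nx g (w ! k)]) else cst (counit g) * bas (c # w))" for c
    by (simp add: app_sitefam k)
  then show "app (HR q 0) (app (sitefam q p g) (bas f)) = app (sitefam q p g) (app (HR q 0) (bas f))"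
    unfolding fw by (auto simp: app_HR hecke_op_0 app_linear distrib_left cst_mult_assoc mult.commute)
qed

text \<open>The two-factor case of quantum Schur-Weyl duality in type A, checked on each generator
  by the place of the two letters relative to \<open>i\<close> and \<open>i + 1\<close>.\<close>

lemma com_HR_Suc_near:
  fixes q :: "'k::field"
  assumes q: "q \<noteq> 0" and j: "Suc j < m"
  shows "com (HL m) (HR q (Suc j)) (coprod (sitefam q j) (sitefam q (Suc j)) g)"
proof (rule comI[OF HR_pres[OF j]])
  show "pres (HL m) (coprod (sitefam q j) (sitefam q (Suc j)) g)"
    by (intro coprod_pres sitefam_pres_HL)
  fix f assume f: "f \<in> HL m"
  obtain u a b w where fu: "f = u @ a # b # w" "length u = j"
    using f j by (auto elim: HL_split)
  obtain x y where xy: "a = hf x" "b = hf y" using f fu by (auto simp: HL_def)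
  have s0: "app (sitefam q j g) (bas (u @ c # d # w)) = cst (nc q g c) * bas (u @ nx g c # d # w)" for g c d
    using fu by (auto simp: app_sitefam)
  have s1: "app (sitefam q (Suc j) g) (bas (u @ c # d # w)) = cst (nc q g d) * bas (u @ c # nx g d # w)" for g c d
    using fu by (auto simp: app_sitefam nth_append list_update_append)
  have qi: "cst q * (cst (inverse q) * X) = X" "cst (inverse q) * (cst q * X) = X" for X :: "rat list \<Rightarrow>\<^sub>0 'k"
    using q by (simp_all add: cst_mult_assoc)
  note r = s0 s1 app_HR hecke_op_Suc[OF fu(2)] app_add app_scale app_diff distrib_left qi cst_diff
    left_diff_distrib right_diff_distrib
  show "app (HR q (Suc j)) (app (coprod (sitefam q j) (sitefam q (Suc j)) g) (bas f)) =
      app (coprod (sitefam q j) (sitefam q (Suc j)) g) (app (HR q (Suc j)) (bas f))"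
  proof (cases g)
    case (GenE i)
    consider "x = i" | "x = i + 1" | "x < i" | "i + 1 < x" by linarith
    moreover consider "y = i" | "y = i + 1" | "y < i" | "i + 1 < y" by linarith
    ultimately show ?thesis
      unfolding fu(1) xy GenE
      by cases (cases x y rule: linorder_cases; auto simp: r)+
  next
    case (GenF i)
    consider "x = i" | "x = i + 1" | "x < i" | "i + 1 < x" by linarith
    moreover consider "y = i" | "y = i + 1" | "y < i" | "i + 1 < y" by linarith
    ultimately show ?thesis
      unfolding fu(1) xy GenF
      by cases (cases x y rule: linorder_cases; auto simp: r)+
  next
    case (GenK i)
    then show ?thesis unfolding fu(1) xy
      by (cases x y rule: linorder_cases) (auto simp: r)
  next
    case (GenKinv i)
    then show ?thesis unfolding fu(1) xy
      by (cases x y rule: linorder_cases) (auto simp: r)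
  qed
qed

text \<open>Coassociativity groups the two factors exchanged by the Hecke operator; all other
  factors sit at different positions.\<close>

lemma com_HR_Suc_fam:
  assumes q: "q \<noteq> 0" and j: "Suc j < m"
  shows "com (HL m) (HR q (Suc j)) (fam q m g)"
proof -
  have low: "com (HL m) (HR q (Suc j)) (fam q j g)" for g
    by (rule com_fam[OF HR_pres[OF j] com_HR_Suc_far[OF j] refl]) auto
  have "com (HL m) (HR q (Suc j)) (fam q (j + 2 + n) g)" for n g
  proof (induct n arbitrary: g)
    case 0
    have "fam q (j + 2 + 0) = coprod (fam q j) (coprod (sitefam q j) (sitefam q (Suc j)))"
      by (simp add: coprod_assoc)
    then show ?case
      by (simp only:) (rule com_coprod[OF low com_HR_Suc_near[OF q j] refl])
  next
    case (Suc n)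
    have "fam q (j + 2 + Suc n) = coprod (fam q (j + 2 + n)) (sitefam q (j + 2 + n))"
      by simp
    then show ?case
      by (simp only:) (rule com_coprod[OF Suc com_HR_Suc_far[OF j] refl], auto)
  qed
  moreover have "j + 2 + (m - j - 2) = m" using j by simp
  ultimately show ?thesis by metis
qed

section \<open>Operators of the coideal generators\<close>

definition kop :: "(uq_gen \<Rightarrow> ('b::monoid_add, 'k::field) lop) \<Rightarrow> int \<Rightarrow> ('b, 'k) lop" where
  "kop P i = P (GenK i) * P (GenKinv (- i))"

definition Bop :: "'k \<Rightarrow> (uq_gen \<Rightarrow> ('b::monoid_add, 'k::field) lop) \<Rightarrow> int \<Rightarrow> ('b, 'k) lop" where
  "Bop q P i = (if i = 0 then P (GenE 0) + sc q * (P (GenF 0) * P (GenKinv 0)) + P (GenKinv 0)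
     else P (GenE i) + P (GenF (- i)) * P (GenKinv i))"

lemma evl_iq_k: "evl (wordL P) (iq_k i) = kop P i"
  by (simp add: iq_k_def kop_def)

lemma evl_iq_B: "evl (wordL P) (iq_B q i) = Bop q P i"
  by (simp add: iq_B_def Bop_def evl_add mult.assoc)

lemma kop_coprod:
  assumes "\<And>g h. Q g * P h = P h * Q g"
  shows "kop (coprod P Q) i = kop P i * kop Q i"
proof -
  have "Q g * (P h * z) = P h * (Q g * z)" for g h z
    by (simp only: mult.assoc [symmetric] assms)
  then show ?thesis by (simp add: kop_def mult.assoc)
qed

text \<open>The coideal property: the left tensor factors that occur are \<open>B_i\<close>, 1 and
  \<open>k_(-i)\<close>, which again belong to the coideal subalgebra. An operator on the first
  position therefore only has to be compared with such elements acting on fewer factors.\<close>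

lemma Bop_coprod:
  assumes P: "uq_fam q P" and comm: "\<And>g h. Q g * P h = P h * Q g"
  shows "Bop q (coprod P Q) i = Bop q P i * Q (GenKinv i) + Q (GenE i) +
    sc (if i = 0 then q else 1) * (kop P (- i) * (Q (GenF (- i)) * Q (GenKinv i)))"
proof -
  have l: "Q g * (P h * z) = P h * (Q g * z)" for g h z
    by (simp only: mult.assoc [symmetric] comm)
  have "kop P 0 = 1" using uq_famD(1)[OF P, of 0] by (simp add: kop_def)
  moreover have "P (GenK 0) * (P (GenKinv 0) * z) = z" for z
    by (simp only: mult.assoc [symmetric] uq_famD(1)[OF P, of 0] mult_1_left)
  ultimately show ?thesis
    by (simp add: Bop_def kop_def distrib_left distrib_right mult.assoc comm l)
qed

lemma com_kop_fam:
  assumes "pres S A" "\<And>p g. p < n \<Longrightarrow> gidx g = i \<or> gidx g = - i \<Longrightarrow> com S A (sitefam q p g)"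
  shows "com S A (kop (fam q n) i)"
  unfolding kop_def
  by (rule com_mult) (rule com_fam[OF assms(1) _ refl]; rule assms(2); auto)+

lemma com_Bop_fam:
  assumes "pres S A" "\<And>p g. p < n \<Longrightarrow> gidx g = i \<or> gidx g = - i \<Longrightarrow> com S A (sitefam q p g)"
  shows "com S A (Bop q (fam q n) i)"
proof -
  have "com S A (fam q n g)" if "gidx g = i \<or> gidx g = - i" for g
    using com_fam[OF assms(1), of n "gidx g" q g] assms(2) that by auto
  then show ?thesis
    unfolding Bop_def using assms(1) by (auto intro!: com_add com_mult com_sc)
qed

lemma com_HR_Suc_iq:
  assumes q: "q \<noteq> 0" and j: "Suc j < m"
  shows "com (HL m) (HR q (Suc j)) (kop (fam q m) i)" "com (HL m) (HR q (Suc j)) (Bop q (fam q m) i)"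
  unfolding kop_def Bop_def
  using com_HR_Suc_fam[OF q j] by (auto intro!: com_add com_mult com_sc HR_pres j)

text \<open>\<open>H_0\<close> touches the first position alone, so by the coideal property an
  induction on the number of factors leaves just one factor to be checked.\<close>

lemma com_HR_0_iq:
  fixes q :: "'k::field"
  assumes q: "q \<noteq> 0" "q \<noteq> inverse q" and n: "0 < n" "n \<le> m"
  shows "com (HL m) (HR q 0) (kop (fam q n) i) \<and> com (HL m) (HR q 0) (Bop q (fam q n) i)"
  using n
proof (induct n arbitrary: i rule: nat_induct_non_zero)
  case 1
  have m: "0 < m" using 1 by simp
  have fam1: "fam q 1 = sitefam q 0"
  proof
    fix g show "fam q 1 g = sitefam q 0 g" by (cases g) simp_all
  qed
  have s0: "app (sitefam q 0 g) (bas (c # w)) = cst (nc q g c) * bas (nx g c # w)" for g c w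
    by (simp add: app_sitefam)
  have qi: "cst q * (cst (inverse q) * X) = X" "cst (inverse q) * (cst q * X) = X" for X :: "rat list \<Rightarrow>\<^sub>0 'k"
    using q by (simp_all add: cst_mult_assoc)
  note r = s0 app_HR hecke_op_0 app_add app_scale app_diff distrib_left qi cst_diff
    left_diff_distrib right_diff_distrib hf_uminus
  have pk: "pres (HL m) (kop (sitefam q 0) i)"
    unfolding kop_def by (intro pres_closed sitefam_pres_HL)
  have pB: "pres (HL m) (Bop q (sitefam q 0) i)"
    unfolding Bop_def by (auto intro!: pres_closed sitefam_pres_HL)
  have "com (HL m) (HR q 0) (kop (sitefam q 0) i)"
  proof (rule comI[OF HR_pres[OF m] pk])
    fix f assume f: "f \<in> HL m"
    then obtain a w where fw: "f = a # w" using m by (cases f) (auto simp: HL_def)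
    obtain x where x: "a = hf x" using f fw by (auto simp: HL_def)
    show "app (HR q 0) (app (kop (sitefam q 0) i) (bas f)) = app (kop (sitefam q 0) i) (app (HR q 0) (bas f))"
      unfolding fw x kop_def by (auto simp: r)
  qed
  \<comment> \<open>The coefficient \<open>q\<close> and the term \<open>K_0^-1\<close> make
    \<open>B_0\<close> act as \<open>H_0 + q\<close> on the letters \<open>hf 0\<close> and
    \<open>hf 1\<close>, and as the identity on the others. For \<open>i \<noteq> 0\<close> the
    letters \<open>hf i\<close> and \<open>hf (i + 1)\<close> have the same sign, so both fall under
    the same case of \<open>H_0\<close>.\<close>
  moreover have "com (HL m) (HR q 0) (Bop q (sitefam q 0) i)"
  proof (rule comI[OF HR_pres[OF m] pB])
    fix f assume f: "f \<in> HL m"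
    then obtain a w where fw: "f = a # w" using m by (cases f) (auto simp: HL_def)
    obtain x where x: "a = hf x" using f fw by (auto simp: HL_def)
    show "app (HR q 0) (app (Bop q (sitefam q 0) i) (bas f)) = app (Bop q (sitefam q 0) i) (app (HR q 0) (bas f))"
      unfolding fw x Bop_def by (auto simp: r)
  qed
  ultimately show ?case unfolding fam1 by (rule conjI)
next
  case (Suc n)
  have m: "0 < m" using Suc by simp
  have comm: "sitefam q n g * fam q n h = fam q n h * sitefam q n g" for g h
    by (rule fam_commute) (auto intro: sitefam_commute)
  have IH: "com (HL m) (HR q 0) (kop (fam q n) i)" "com (HL m) (HR q 0) (Bop q (fam q n) i)" for i
    using Suc by auto
  have S: "com (HL m) (HR q 0) (sitefam q n g)" for g
    by (rule com_HR_0_far[OF m Suc(1)])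
  have "com (HL m) (HR q 0) (kop (sitefam q n) i)"
    unfolding kop_def by (intro com_mult S)
  then show ?case
    unfolding fam.simps kop_coprod[of "sitefam q n" "fam q n", OF comm] Bop_coprod[OF uq_fam_fam[OF q] comm]
    by (intro conjI com_mult com_add IH S com_sc HR_pres m)
qed

section \<open>The Levi condition and the block projections\<close>

lemma hf_in_half_idx: "hf x \<in> half_idx (2 * s) \<longleftrightarrow> 1 - int s \<le> x \<and> x \<le> int s"
  unfolding half_idx_hf by auto

text \<open>For \<open>|i| <= r\<close> both letters linked by \<open>E_i\<close> and
  \<open>F_i\<close> are inner ones, so inner and outer letters are never exchanged.\<close>

lemma nx_inner:
  assumes "\<bar>gidx g\<bar> \<le> int r"
  shows "nx g a \<in> half_idx (2 * (r + 1)) \<longleftrightarrow> a \<in> half_idx (2 * (r + 1))"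
    "nx g a = hf (int r + 2) \<longleftrightarrow> a = hf (int r + 2)"
  using assms by (cases g; auto simp: hf_in_half_idx simp del: mult_Suc_right add_2_eq_Suc')+

text \<open>Membership in a block is decided letter by letter, and the generator neither mixes inner
  with outer letters nor moves the top letter.\<close>

lemma com_Pr_sitefam:
  assumes g: "\<bar>gidx g\<bar> \<le> int r \<or> (\<forall>a. nx g a = a)" and p: "p < m" and l: "l \<le> m"
    and pg: "pres (Om (2 * (r + 2)) m) (sitefam q p g)"
  shows "com (Om (2 * (r + 2)) m) (Pr r m l) (sitefam q p g)"
proof (rule comI[OF _ pg])
  show "pres (Om (2 * (r + 2)) m) (Pr r m l)"
    by (auto simp: pres_def app_Pr intro: sp_closed)
  fix f assume f: "f \<in> Om (2 * (r + 2)) m"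
  then have len: "length f = m" by (simp add: Om_def)
  \<comment> \<open>A nonzero coefficient is what shows that the moved word stays in the tensor
    space.\<close>
  have "f[p := nx g (f ! p)] \<in> blk r m l \<longleftrightarrow> f \<in> blk r m l" if nz: "nc q g (f ! p) \<noteq> 0"
    using g
  proof
    assume i: "\<bar>gidx g\<bar> \<le> int r"
    have O: "f[p := nx g (f ! p)] \<in> Om (2 * (r + 2)) m"
    proof -
      have "app (sitefam q p g) (bas f) \<in> sp (Om (2 * (r + 2)) m)"
        using pg f by (simp add: pres_def)
      then have "f[p := nx g (f ! p)] \<in> Om (2 * (r + 2)) m"
        using p len nz by (simp add: app_sitefam cst_mult_bas sp_def del: mult_Suc_right add_2_eq_Suc')
      then show ?thesis .
    qed
    show ?thesis
    proof (cases "p < l")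
      case True
      have "set ((take l f)[p := nx g (f ! p)]) \<subseteq> half_idx (2 * (r + 1)) \<longleftrightarrow> set (take l f) \<subseteq> half_idx (2 * (r + 1))"
      proof -
        let ?t = "take l f"
        have t: "?t = take p ?t @ ?t ! p # drop (Suc p) ?t"
          using True len l by (intro id_take_nth_drop) auto
        have t': "?t[p := y] = take p ?t @ y # drop (Suc p) ?t" for y
          using True len l by (intro upd_conv_take_nth_drop) auto
        have "?t ! p = f ! p" using True by simp
        then have "set (?t[p := nx g (f ! p)]) = set (take p ?t) \<union> insert (nx g (f ! p)) (set (drop (Suc p) ?t))"
          "set ?t = set (take p ?t) \<union> insert (f ! p) (set (drop (Suc p) ?t))"
        proof -
          have "set ?t = set (take p ?t @ ?t ! p # drop (Suc p) ?t)" by (simp only: t [symmetric])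
          then show "set ?t = set (take p ?t) \<union> insert (f ! p) (set (drop (Suc p) ?t))"
            by (simp only: set_append list.set \<open>?t ! p = f ! p\<close>)
          show "set (?t[p := nx g (f ! p)]) = set (take p ?t) \<union> insert (nx g (f ! p)) (set (drop (Suc p) ?t))"
            by (simp only: t' set_append list.set)
        qed
        then show ?thesis using nx_inner(1)[OF i, of "f ! p"] by (simp only: Un_subset_iff insert_subset)
      qed
      then show ?thesis using True f O by (simp add: blk_def take_update_swap)
    next
      case False
      have "(drop l f)[p - l := nx g (f ! p)] = replicate (m - l) (hf (int r + 2)) \<longleftrightarrow>
          drop l f = replicate (m - l) (hf (int r + 2))"
      proof -
        have pl: "p - l < m - l" using p False by simp
        have e: "(drop l f) ! (p - l) = f ! p" using False len p by simp
        have u: "(drop l f)[p - l := f ! p] = drop l f"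
          unfolding e [symmetric] by (rule list_update_id)
        show ?thesis
        proof
          assume a: "(drop l f)[p - l := nx g (f ! p)] = replicate (m - l) (hf (int r + 2))"
          then have "(drop l f)[p - l := nx g (f ! p)] ! (p - l) = hf (int r + 2)" using pl by simp
          then have "nx g (f ! p) = hf (int r + 2)" using pl len by simp
          then have n: "nx g (f ! p) = f ! p" using nx_inner(2)[OF i, of "f ! p"] by simp
          show "drop l f = replicate (m - l) (hf (int r + 2))" using a unfolding n u .
        next
          assume a: "drop l f = replicate (m - l) (hf (int r + 2))"
          then have "f ! p = hf (int r + 2)" using e pl by simp
          then have n: "nx g (f ! p) = f ! p" using nx_inner(2)[OF i, of "f ! p"] by simp
          show "(drop l f)[p - l := nx g (f ! p)] = replicate (m - l) (hf (int r + 2))"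
            using a unfolding n u .
        qed
      qed
      then show ?thesis using False f O by (simp add: blk_def drop_update_swap)
    qed
  qed simp
  then show "app (Pr r m l) (app (sitefam q p g) (bas f)) = app (sitefam q p g) (app (Pr r m l) (bas f))"
    using p len by (cases "nc q g (f ! p) = 0") (auto simp: app_sitefam app_Pr app_linear)
qed

lemma sitefam_pres_Om:
  assumes "\<bar>gidx g\<bar> \<le> int s - 1"
  shows "pres (Om (2 * s) m) (sitefam q p g)"
  unfolding pres_def
proof
  fix f assume f: "f \<in> Om (2 * s) m"
  have n: "nx g a \<in> half_idx (2 * s)" if "a \<in> half_idx (2 * s)" for a
    using that assms by (cases g) (auto simp: hf_in_half_idx simp del: mult_Suc_right)
  have "f[p := nx g (f ! p)] \<in> Om (2 * s) m" if "p < length f"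
  proof -
    have "f ! p \<in> half_idx (2 * s)" using f that nth_mem unfolding Om_def by blast
    then show ?thesis
      using f n[of "f ! p"] set_update_subset_insert[of f p "nx g (f ! p)"] by (auto simp: Om_def)
  qed
  with f show "app (sitefam q p g) (bas f) \<in> sp (Om (2 * s) m)"
    by (auto simp: app_sitefam intro!: sp_scale sp_bas)
qed

text \<open>The Hecke operators are tested on the larger span \<open>HL m\<close>, where every
  generator acts, and the projections on the tensor space itself.\<close>

lemma commutantI:
  assumes "pres (Om (2 * (r + 2)) m) A"
    and "\<And>i. i < m \<Longrightarrow> com (HL m) (HR q i) A"
    and "\<And>l. l \<le> m \<Longrightarrow> com (Om (2 * (r + 2)) m) (Pr r m l) A"
  shows "A \<in> commutant q r m"
proof -
  let ?O = "Om (2 * (r + 2)) m"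
  have N: "2 * r + 4 = 2 * (r + 2)" by simp
  have "half_idx (2 * (r + 2)) \<subseteq> range hf" unfolding half_idx_hf by blast
  then have sub: "?O \<subseteq> HL m" unfolding Om_def HL_def by blast
  have h: "app (hop q (2 * (r + 2)) m i) v = app (HR q i) v" if "v \<in> sp ?O" for i v
    using that by (rule app_eq_on[rotated]) (simp add: app_hop app_HR)
  have "app A (app (hop q (2 * (r + 2)) m i) v) = app (hop q (2 * (r + 2)) m i) (app A v)"
    if "i < m" "v \<in> sp ?O" for i v
  proof -
    have "v \<in> sp (HL m)" using that(2) sub sp_mono by blast
    then show ?thesis
      using assms(2)[OF that(1)] h[OF that(2)] h[OF pres_app[OF assms(1) that(2)]] by (simp add: com_def)
  qed
  moreover have "app A (app (Pr r m l) v) = app (Pr r m l) (app A v)"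
    if "l \<le> m" "v \<in> sp ?O" for l v
    using assms(3)[OF that(1)] that(2) by (simp add: com_def)
  ultimately show ?thesis
    unfolding commutant_def N using assms(1) by (simp del: mult_Suc_right add_2_eq_Suc')
qed

lemma commutant_closed:
  shows "sc c \<in> commutant q r m"
    "A \<in> commutant q r m \<Longrightarrow> B \<in> commutant q r m \<Longrightarrow> A + B \<in> commutant q r m"
    "A \<in> commutant q r m \<Longrightarrow> B \<in> commutant q r m \<Longrightarrow> A - B \<in> commutant q r m"
    "A \<in> commutant q r m \<Longrightarrow> B \<in> commutant q r m \<Longrightarrow> A * B \<in> commutant q r m"
  unfolding commutant_def
  by (auto simp: pres_closed app_scale app_add app_diff pres_app simp del: mult_Suc_right add_2_eq_Suc')

definition levi_gens :: "'k::field \<Rightarrow> nat \<Rightarrow> (uq_gen list \<Rightarrow>\<^sub>0 'k) set" where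
  "levi_gens q r = iq_k ` int_idx (r + 1) \<union> iq_B q ` int_idx r"

lemma levi_gens_closed: "levi_gens q r \<subseteq> carrier (free_algebra (uq_gens r))"
proof -
  have g: "UE i \<in> carrier (free_algebra (uq_gens r))" "UF i \<in> carrier (free_algebra (uq_gens r))"
    "UK i \<in> carrier (free_algebra (uq_gens r))" "UKinv i \<in> carrier (free_algebra (uq_gens r))"
    if "i \<in> int_idx (r + 1)" for i
    using that by (auto simp: uq_gens_def intro!: free_algebra_closed(5))
  have n: "i \<in> int_idx r \<Longrightarrow> i \<in> int_idx (r + 1)" "i \<in> int_idx (r + 1) \<Longrightarrow> - i \<in> int_idx (r + 1)"
    "0 \<in> int_idx (r + 1)" for i
    by (auto simp: int_idx_def)
  have "iq_k i \<in> carrier (free_algebra (uq_gens r))" if "i \<in> int_idx (r + 1)" for i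
    unfolding iq_k_def using that n(2)[OF that] by (intro free_algebra_closed(7) g)
  moreover have "iq_B q i \<in> carrier (free_algebra (uq_gens r))" if "i \<in> int_idx r" for i
    unfolding iq_B_def using n(1)[OF that] n(2)[OF n(1)[OF that]] n(3)
    by (auto intro!: free_algebra_closed(3,6,7) g simp del: One_nat_def Suc_eq_plus1[symmetric])
  ultimately show ?thesis unfolding levi_gens_def by blast
qed

lemma levi_commutant:
  fixes q :: "'k::field"
  assumes q: "q \<noteq> 0" "q \<noteq> inverse q" and m: "0 < m" and p: "p \<in> subalg (levi_gens q r)"
  shows "evl (wordL (fam q m)) p \<in> commutant q r m"
  using p
proof induct
  case (incl x)
  let ?O = "Om (2 * (r + 2)) m"
  have PrO: "pres ?O (Pr r m l)" for l
    by (auto simp: pres_def app_Pr intro: sp_closed)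
  have one: "pres ?O (1 :: (rat list, 'k) lop)" by (rule pres_closed)
  have so: "pres ?O (sitefam q p g)" if "\<bar>gidx g\<bar> \<le> int r + 1" for p g
    using sitefam_pres_Om[of g "r + 2" m q p] that by simp
  have HR: "com (HL m) (HR q i) (kop (fam q m) j) \<and> com (HL m) (HR q i) (Bop q (fam q m) j)"
    if "i < m" for i j
  proof (cases i)
    case 0
    then show ?thesis using com_HR_0_iq[OF q m order_refl] by blast
  next
    case (Suc k)
    then show ?thesis using com_HR_Suc_iq[OF q(1), of k m] that by blast
  qed
  from incl consider j where "x = iq_k j" "j \<in> int_idx (r + 1)" | j where "x = iq_B q j" "j \<in> int_idx r"
    by (auto simp: levi_gens_def)
  then show ?case
  proof cases
    case 1
    then have j: "\<bar>j\<bar> \<le> int r + 1" by (auto simp: int_idx_def)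
    have "pres ?O (kop (fam q m) j)"
      unfolding com_one_iff[symmetric]
      by (rule com_kop_fam[OF one]) (use j so in \<open>auto simp: com_one_iff\<close>)
    moreover have "com ?O (Pr r m l) (kop (fam q m) j)" if l: "l \<le> m" for l
    proof -
      \<comment> \<open>For \<open>|j| = r + 1\<close> outer letters are involved, but the K
        operators are diagonal and move no letter.\<close>
      have c: "com ?O (Pr r m l) (fam q m (GenK i)) \<and> com ?O (Pr r m l) (fam q m (GenKinv i))"
        if i: "\<bar>i\<bar> \<le> int r + 1" for i
      proof -
        have "com ?O (Pr r m l) (sitefam q p g)" if "g = GenK i \<or> g = GenKinv i" "p < m" for p g
          using that i l by (intro com_Pr_sitefam so) auto
        moreover have "com ?O (Pr r m l) 1"
          using com_sc[OF PrO, of l 1] unfolding sc_1 .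
        ultimately have "com ?O (Pr r m l) (fam q n (GenK i)) \<and> com ?O (Pr r m l) (fam q n (GenKinv i))" if "n \<le> m" for n
          using that by (induct n) (auto intro!: com_mult)
        then show ?thesis by blast
      qed
      show ?thesis unfolding kop_def using c[of j] c[of "- j"] j by (auto intro: com_mult)
    qed
    ultimately show ?thesis
      unfolding 1(1) evl_iq_k by (intro commutantI) (use HR in auto)
  next
    case 2
    then have j: "\<bar>j\<bar> \<le> int r" by (auto simp: int_idx_def)
    have "pres ?O (Bop q (fam q m) j)"
      unfolding com_one_iff[symmetric]
      by (rule com_Bop_fam[OF one]) (use j so in \<open>auto simp: com_one_iff\<close>)
    moreover have "com ?O (Pr r m l) (Bop q (fam q m) j)" if l: "l \<le> m" for l
    proof (rule com_Bop_fam[OF PrO])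
      fix p g assume p: "p < m" and "gidx g = j \<or> gidx g = - j"
      then have g: "\<bar>gidx g\<bar> \<le> int r" using j by auto
      then show "com ?O (Pr r m l) (sitefam q p g)"
        by (intro com_Pr_sitefam[OF disjI1[OF g] p l] so) simp
    qed
    ultimately show ?thesis
      unfolding 2(1) evl_iq_B by (intro commutantI) (use HR in auto)
  qed
qed (simp_all add: evl_add commutant_closed)

subsection \<open>Specialization at q = 1\<close>

definition evq :: "'k::field_char_0 \<Rightarrow> rat poly \<Rightarrow> 'k" where
  "evq q a = poly (map_poly of_rat a) q"

lemma evq_0 [simp]: "evq q 0 = 0"
  by (simp add: evq_def)

lemma evq_pCons: "evq q (pCons c a) = of_rat c + q * evq q a"
  by (simp add: evq_def map_poly_pCons)

lemma evq_const [simp]: "evq q [:c:] = of_rat c"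
  by (simp add: evq_pCons)

lemma evq_1 [simp]: "evq q 1 = 1"
  using evq_const[of q 1] by (simp add: one_pCons)

lemma evq_add: "evq q (a + b) = evq q a + evq q b"
  by (induct a b rule: poly_induct2) (simp_all add: evq_pCons of_rat_add algebra_simps)

lemma evq_smult: "evq q (Polynomial.smult c a) = of_rat c * evq q a"
  by (induct a) (simp_all add: evq_pCons of_rat_mult algebra_simps)

lemma evq_mult: "evq q (a * b) = evq q a * evq q b"
  by (induct a) (simp_all add: evq_pCons evq_add evq_smult algebra_simps)

lemma evq_diff: "evq q (a - b) = evq q a - evq q b"
  using evq_add[of q "a - b" b] by simp

lemma evq_prod: "evq q (prod a I) = (\<Prod>i\<in>I. evq q (a i))"
  by (induct I rule: infinite_finite_induct) (simp_all add: evq_mult)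

lemma evq_eq_0_iff:
  assumes "\<not> algebraic q"
  shows "evq q a = 0 \<longleftrightarrow> a = 0"
proof
  assume *: "evq q a = 0"
  show "a = 0"
  proof (rule ccontr)
    assume "a \<noteq> 0"
    then have "Polynomial.coeff (map_poly of_rat a) (Polynomial.degree a) \<noteq> (0 :: 'a)"
      by (simp add: coeff_map_poly)
    then have "map_poly of_rat a \<noteq> (0 :: 'a poly)" by auto
    then have "algebraic q"
      using * by (intro algebraicI'[of "map_poly of_rat a"]) (auto simp: evq_def coeff_map_poly)
    with assms show False by simp
  qed
qed simp

text \<open>\<open>spec q x c\<close>: the rational function \<open>x\<close> in \<open>q\<close> is regular at \<open>q = 1\<close> with value \<open>c\<close>.\<close>

definition spec :: "'k::field_char_0 \<Rightarrow> 'k \<Rightarrow> rat \<Rightarrow> bool" where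
  "spec q x c \<longleftrightarrow> (\<exists>a b. poly b 1 \<noteq> 0 \<and> x * evq q b = evq q a \<and> c * poly b 1 = poly a 1)"

lemma spec_of_rat: "spec q (of_rat c) c"
  unfolding spec_def by (rule exI[of _ "[:c:]"], rule exI[of _ 1]) simp

lemma spec_0: "spec q 0 0" and spec_1: "spec q 1 1"
  using spec_of_rat[of q 0] spec_of_rat[of q 1] by simp_all

lemma spec_q: "spec q q 1"
  unfolding spec_def by (rule exI[of _ "[:0, 1:]"], rule exI[of _ 1]) (simp add: evq_pCons)

lemma spec_inverse_q: "q \<noteq> 0 \<Longrightarrow> spec q (inverse q) 1"
  unfolding spec_def by (rule exI[of _ 1], rule exI[of _ "[:0, 1:]"]) (simp add: evq_pCons)

lemma spec_add:
  assumes "spec q x c" "spec q y d"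
  shows "spec q (x + y) (c + d)"
proof -
  obtain a b a' b' where "poly b 1 \<noteq> 0" "x * evq q b = evq q a" "c * poly b 1 = poly a 1"
    and "poly b' 1 \<noteq> 0" "y * evq q b' = evq q a'" "d * poly b' 1 = poly a' 1"
    using assms by (auto simp: spec_def)
  then show ?thesis
    unfolding spec_def
    by (intro exI[of _ "a * b' + a' * b"] exI[of _ "b * b'"])
      (auto simp: evq_add evq_mult algebra_simps simp flip: \<open>x * evq q b = evq q a\<close> \<open>y * evq q b' = evq q a'\<close>
        \<open>c * poly b 1 = poly a 1\<close> \<open>d * poly b' 1 = poly a' 1\<close>)
qed

lemma spec_mult:
  assumes "spec q x c" "spec q y d"
  shows "spec q (x * y) (c * d)"
proof -
  obtain a b a' b' where *: "poly b 1 \<noteq> 0" "x * evq q b = evq q a" "c * poly b 1 = poly a 1"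
    and "poly b' 1 \<noteq> 0" "y * evq q b' = evq q a'" "d * poly b' 1 = poly a' 1"
    using assms by (auto simp: spec_def)
  then show ?thesis
    unfolding spec_def
    by (intro exI[of _ "a * a'"] exI[of _ "b * b'"])
      (auto simp: evq_add evq_mult algebra_simps simp flip: \<open>x * evq q b = evq q a\<close> \<open>y * evq q b' = evq q a'\<close>
        \<open>c * poly b 1 = poly a 1\<close> \<open>d * poly b' 1 = poly a' 1\<close>)
qed

lemma spec_uminus: "spec q x c \<Longrightarrow> spec q (- x) (- c)"
  using spec_mult[OF spec_of_rat[of q "- 1"], of x c] by simp

lemma spec_diff: "spec q x c \<Longrightarrow> spec q y d \<Longrightarrow> spec q (x - y) (c - d)"
  using spec_add[of q x c "- y" "- d"] spec_uminus[of q y d] by simp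

lemma spec_sum: "(\<And>i. i \<in> I \<Longrightarrow> spec q (x i) (c i)) \<Longrightarrow> spec q (sum x I) (sum c I)"
  by (induct I rule: infinite_finite_induct) (auto intro: spec_add spec_0)

text \<open>Two fractions for \<open>x\<close> have equal cross products at \<open>q\<close>, hence
  as polynomials by transcendence, hence also at 1.\<close>

lemma spec_unique:
  assumes q: "\<not> algebraic q" and "spec q x c" "spec q x d"
  shows "c = d"
proof -
  obtain a b a' b' where *: "poly b 1 \<noteq> 0" "x * evq q b = evq q a" "c * poly b 1 = poly a 1"
    and **: "poly b' 1 \<noteq> 0" "x * evq q b' = evq q a'" "d * poly b' 1 = poly a' 1"
    using assms(2,3) by (auto simp: spec_def)
  have "evq q a * evq q b' = evq q a' * evq q b"
    unfolding *(2)[symmetric] **(2)[symmetric] by (simp add: mult_ac)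
  then have "evq q (a * b' - a' * b) = 0"
    by (simp add: evq_diff evq_mult)
  then have "a * b' = a' * b"
    by (simp add: evq_eq_0_iff[OF q])
  then have "poly (a * b') 1 = poly (a' * b) 1" by (simp only:)
  then have "poly a 1 * poly b' 1 = poly a' 1 * poly b 1" by simp
  then have "c * (poly b 1 * poly b' 1) = d * (poly b 1 * poly b' 1)"
    unfolding *(3)[symmetric] **(3)[symmetric] by (simp add: mult_ac)
  with * ** show ?thesis by simp
qed

text \<open>After clearing denominators, the largest power of \<open>X - 1\<close> dividing all
  numerators is cancelled; a nonzero numerator that attains it then has a nonzero value at
  1.\<close>

lemma ex_spec_scaled:
  fixes q :: "'k::field_char_0" and x :: "'i \<Rightarrow> 'k"
  assumes q: "\<not> algebraic q" and rat: "\<And>y::'k. \<exists>a b. evq q b \<noteq> 0 \<and> y = evq q a / evq q b"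
    and I: "finite I" and nz: "\<exists>i\<in>I. x i \<noteq> 0"
  obtains e c where "e \<noteq> 0" "\<And>i. i \<in> I \<Longrightarrow> spec q (e * x i) (c i)" "\<exists>i\<in>I. c i \<noteq> 0"
proof -
  obtain a b where ab: "\<And>i. evq q (b i) \<noteq> 0" "\<And>i. x i = evq q (a i) / evq q (b i)"
  proof -
    have "\<forall>i. \<exists>a b. evq q b \<noteq> 0 \<and> x i = evq q a / evq q b" using rat by blast
    from choice[OF this] obtain a where "\<forall>i. \<exists>b. evq q b \<noteq> 0 \<and> x i = evq q (a i) / evq q b" by blast
    from choice[OF this] that show ?thesis by blast
  qed
  \<comment> \<open>The numerator of \<open>x i\<close> over the common denominator
    \<open>prod b I\<close>.\<close>
  define p where "p i = a i * prod b (I - {i})" for i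
  have p: "evq q (prod b I) * x i = evq q (p i)" if "i \<in> I" for i
    using ab(1)[of i] prod.remove[OF I that, of b] by (simp add: ab(2) p_def evq_mult)
  have D: "evq q (prod b I) \<noteq> 0" using ab(1) I by (simp add: evq_prod)
  define J where "J = {i \<in> I. p i \<noteq> 0}"
  have J: "finite J" "J \<noteq> {}"
  proof -
    obtain i where i: "i \<in> I" "x i \<noteq> 0" using nz by blast
    then have "evq q (prod b I) * x i \<noteq> 0" using D by simp
    then have "evq q (p i) \<noteq> 0" using p[OF i(1)] by simp
    then have "p i \<noteq> 0" by auto
    with i show "J \<noteq> {}" by (auto simp: J_def)
  qed (use I in \<open>auto simp: J_def\<close>)
  \<comment> \<open>The least order of vanishing at 1 among the nonzero numerators.\<close>
  define n where "n = Min ((\<lambda>i. Polynomial.order 1 (p i)) ` J)"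
  have dvd: "[:- 1, 1:] ^ n dvd p i" if "i \<in> I" for i
  proof (cases "p i = 0")
    case False
    with that have "n \<le> Polynomial.order 1 (p i)" unfolding n_def using J by (intro Min_le) (auto simp: J_def)
    then show ?thesis by (simp add: order_divides)
  qed simp
  obtain p' where p': "\<And>i. i \<in> I \<Longrightarrow> p i = [:- 1, 1:] ^ n * p' i"
  proof -
    have "\<forall>i\<in>I. \<exists>k. p i = [:- 1, 1:] ^ n * k" using dvd by (auto simp: dvd_def)
    from bchoice[OF this] that show ?thesis by blast
  qed
  have "n \<in> (\<lambda>i. Polynomial.order 1 (p i)) ` J" unfolding n_def using J by (intro Min_in) auto
  then obtain j where j: "j \<in> I" "p j \<noteq> 0" "Polynomial.order 1 (p j) = n" by (auto simp: J_def)
  have "poly (p' j) 1 \<noteq> 0"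
  proof
    assume "poly (p' j) 1 = 0"
    then have "[:- 1, 1:] dvd p' j" by (simp add: poly_eq_0_iff_dvd)
    then have "[:- 1, 1:] ^ n * [:- 1, 1:] dvd [:- 1, 1:] ^ n * p' j" by (rule mult_dvd_mono[OF dvd_refl])
    then have "[:- 1, 1:] ^ Suc n dvd p j" by (simp only: p'[OF j(1)] power_Suc2)
    then have "Suc n \<le> Polynomial.order 1 (p j)" using j(2) unfolding order_divides by blast
    with j(3) show False by simp
  qed
  let ?e = "evq q ([:- 1, 1:] ^ n)"
  have "[:- 1, 1:] ^ n \<noteq> (0 :: rat poly)" by simp
  then have e: "?e \<noteq> 0" using evq_eq_0_iff[OF q] by blast
  show ?thesis
  proof (rule that[of "evq q (prod b I) / ?e" "\<lambda>i. poly (p' i) 1"])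
    show "evq q (prod b I) / ?e \<noteq> 0" using D e by simp
    show "spec q (evq q (prod b I) / ?e * x i) (poly (p' i) 1)" if "i \<in> I" for i
      unfolding spec_def
    proof (rule exI[of _ "p' i"], rule exI[of _ 1], intro conjI)
      show "evq q (prod b I) / ?e * x i * evq q 1 = evq q (p' i)"
        using p[OF that] p'[OF that] e by (simp add: evq_mult)
    qed simp_all
    show "\<exists>i\<in>I. poly (p' i) 1 \<noteq> 0" using j \<open>poly (p' j) 1 \<noteq> 0\<close> by blast
  qed
qed

section \<open>Matrix entries and their values at q = 1\<close>

definition ent :: "('b::monoid_add, 'k::comm_ring_1) lop \<Rightarrow> 'b \<Rightarrow> 'b \<Rightarrow> 'k" where
  "ent A g f = Poly_Mapping.lookup (app A (bas f)) g"

lemma ent_add: "ent (A + B) g f = ent A g f + ent B g f"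
  and ent_diff: "ent (A - B) g f = ent A g f - ent B g f"
  and ent_sc_mult: "ent (sc c * A) g f = c * ent A g f"
  by (simp_all add: ent_def lookup_add lookup_minus)

lemma ent_sum: "ent (sum F S) g f = (\<Sum>x\<in>S. ent (F x) g f)"
  by (simp add: ent_def lookup_sum)

lemma ent_mult:
  assumes "finite S" "pres S B" "f \<in> S"
  shows "ent (A * B) g f = (\<Sum>h\<in>S. ent A g h * ent B h f)"
proof -
  have "app B (bas f) = (\<Sum>h\<in>S. cst (ent B h f) * bas h)"
    unfolding ent_def using assms by (intro pm_expand) (auto simp: pres_def sp_def)
  from arg_cong[OF this, of "\<lambda>v. Poly_Mapping.lookup (app A v) g"] show ?thesis
    by (simp add: app_linear lookup_sum mult.commute ent_def)
qed

text \<open>Columns come from \<open>S\<close> while rows are unrestricted; preservation of the span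
  of \<open>S\<close> makes the remaining rows 0.\<close>

definition specM :: "'k::field_char_0 \<Rightarrow> 'b set \<Rightarrow> ('b::monoid_add, 'k) lop \<Rightarrow> ('b, rat) lop \<Rightarrow> bool" where
  "specM q S A M \<longleftrightarrow> pres S A \<and> pres S M \<and> (\<forall>f\<in>S. \<forall>g. spec q (ent A g f) (ent M g f))"

lemma specM_add: "specM q S A M \<Longrightarrow> specM q S B M' \<Longrightarrow> specM q S (A + B) (M + M')"
  by (simp add: specM_def pres_closed ent_add spec_add)

lemma specM_mult:
  assumes "finite S" "specM q S A M" "specM q S B M'"
  shows "specM q S (A * B) (M * M')"
  using assms unfolding specM_def
  by (auto simp: pres_closed ent_mult[of S] intro!: spec_sum spec_mult)

lemma specM_sc:
  assumes "spec q c d"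
  shows "specM q S (sc c) (sc d)"
  using assms by (simp add: specM_def pres_closed ent_def lookup_bas spec_0)

lemma specM_zero: "specM q S 0 0"
  using specM_sc[OF spec_0, of q S] by simp

lemma specM_agree:
  assumes "specM q S A M" "\<And>f. f \<in> S \<Longrightarrow> app M (bas f) = app M' (bas f)"
  shows "specM q S A M'"
  using assms by (simp add: specM_def ent_def pres_def)

lemma finite_Om: "finite (Om N m)"
proof -
  have "finite (half_idx N)" by (simp add: half_idx_def)
  then have "finite {f. set f \<subseteq> half_idx N \<and> length f = m}" by (rule finite_lists_length_eq)
  then show ?thesis by (simp add: Om_def conj_commute)
qed

lemma spec_nc: "q \<noteq> 0 \<Longrightarrow> spec q (nc q g a) (nc 1 g a)"
  by (cases g) (auto intro: spec_0 spec_1 spec_q spec_inverse_q)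

lemma specM_sitefam:
  assumes "q \<noteq> 0" "\<bar>gidx g\<bar> \<le> int s - 1"
  shows "specM q (Om (2 * s) m) (sitefam q p g) (sitefam 1 p g)"
  unfolding specM_def
proof (intro conjI ballI allI sitefam_pres_Om assms(2))
  fix f h
  have "spec q (counit g) (counit g)" by (cases g) (simp_all add: spec_0 spec_1)
  then show "spec q (ent (sitefam q p g) h f) (ent (sitefam 1 p g) h f)"
    by (simp add: ent_def app_sitefam lookup_bas spec_0 spec_nc[OF assms(1)])
qed

lemma specM_coprod:
  assumes "finite S" "\<And>g. gidx g = i \<Longrightarrow> specM q S (P g) (P' g)" "\<And>g. gidx g = i \<Longrightarrow> specM q S (Q g) (Q' g)"
    and "gidx g = i"
  shows "specM q S (coprod P Q g) (coprod P' Q' g)"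
  using assms by (cases g) (auto intro!: specM_add specM_mult)

lemma specM_fam:
  assumes q: "q \<noteq> 0" and "\<bar>gidx g\<bar> \<le> int s - 1"
  shows "specM q (Om (2 * s) m) (fam q n g) (fam 1 n g)"
  using assms(2)
proof (induct n arbitrary: g)
  case 0
  have "spec q (counit g) (counit g)" by (cases g) (simp_all add: spec_0 spec_1)
  then show ?case by (simp add: specM_sc)
next
  case (Suc n)
  show ?case
    unfolding fam.simps
    by (rule specM_coprod[OF finite_Om _ _ refl]) (use Suc specM_sitefam[OF q] in auto)
qed

section \<open>Primitive operators and the generators at q = 1\<close>

definition dl :: "nat \<Rightarrow> (rat, 'k::comm_ring_1) lop \<Rightarrow> (rat list, 'k) lop" where
  "dl n Y = (\<Sum>p<n. site p Y)"

lemma dl_add: "dl n (X + Y) = dl n X + dl n Y"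
  by (simp add: dl_def site_add sum.distrib)

lemma dl_diff: "dl n (X - Y) = dl n X - dl n Y"
  by (simp add: dl_def site_diff sum_subtractf)

text \<open>One-site operators at distinct positions commute, so only the diagonal of the double sum
  survives.\<close>

lemma dl_commutator: "dl n (Y * Z - Z * Y) = dl n Y * dl n Z - dl n Z * dl n Y"
proof -
  have "dl n Y * dl n Z - dl n Z * dl n Y = (\<Sum>p<n. \<Sum>t<n. site p Y * site t Z - site t Z * site p Y)"
  proof -
    have "dl n Z * dl n Y = (\<Sum>p<n. \<Sum>t<n. site t Z * site p Y)"
      unfolding dl_def sum_product by (rule sum.swap)
    moreover have "dl n Y * dl n Z = (\<Sum>p<n. \<Sum>t<n. site p Y * site t Z)"
      unfolding dl_def sum_product ..
    ultimately show ?thesis by (simp only: sum_subtractf)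
  qed
  also have "\<dots> = (\<Sum>p<n. \<Sum>t<n. if t = p then site p (Y * Z - Z * Y) else 0)"
  proof (intro sum.cong refl)
    fix p t
    show "site p Y * site t Z - site t Z * site p Y = (if t = p then site p (Y * Z - Z * Y) else 0)"
      using site_commute[of p t Y Z] by (auto simp: site_mult site_diff)
  qed
  also have "\<dots> = dl n (Y * Z - Z * Y)"
    by (simp add: dl_def sum.delta)
  finally show ?thesis by simp
qed

text \<open>\<open>XE a b\<close> is \<open>E\<^sub>a\<^sub>b + E\<^sub>-\<^sub>a\<^sub>,\<^sub>-\<^sub>b\<close> in terms of matrix units.\<close>

definition XE :: "rat \<Rightarrow> rat \<Rightarrow> (rat, rat) lop" where
  "XE a b = Lin (\<lambda>c. if c = b then bas a else if c = - b then bas (- a) else 0)"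

lemma app_XE: "app (XE a b) (bas c) = (if c = b then bas a else if c = - b then bas (- a) else 0)"
  by (simp add: XE_def)

lemma XE_uminus: "b \<noteq> 0 \<Longrightarrow> XE (- a) (- b) = XE a b"
  by (rule lop_eqI) (auto simp: app_XE)

lemma XE_mult:
  assumes "b \<noteq> 0"
  shows "XE a b * XE c d = (if c = b then XE a d else if c = - b then XE (- a) d else 0)"
  using assms by (intro lop_eqI) (auto simp: app_XE)

lemma sitefam_1_K: "sitefam 1 p (GenK i) = 1" "sitefam 1 p (GenKinv i) = 1"
  by (rule lop_eqI; simp add: app_sitefam)+

lemma fam_1_K: "fam 1 n (GenK i) = 1" "fam 1 n (GenKinv i) = 1"
  by (induct n) (simp_all add: sitefam_1_K)

lemma fam_1_EF: "fam 1 n (GenE i) = dl n (natop 1 (GenE i))" "fam 1 n (GenF i) = dl n (natop 1 (GenF i))"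
  by (induct n) (simp_all add: sitefam_1_K fam_1_K dl_def, simp_all add: sitefam_def aug_def)

text \<open>Negating both indices turns the matrix unit of \<open>E_i\<close> into that of
  \<open>F_(-i)\<close>.\<close>

lemma natop_1_XE: "natop 1 (GenE i) + natop 1 (GenF (- i)) = XE (hf i) (hf (i + 1))"
proof (rule lop_eqI)
  fix b
  \<comment> \<open>By parity \<open>i + 1 = - i\<close> has no integer solution, so no letter is
    moved by both summands.\<close>
  have "hf (i + 1) \<noteq> hf (- i)" by (simp, presburger)
  then show "app (natop 1 (GenE i) + natop 1 (GenF (- i))) (bas b) = app (XE (hf i) (hf (i + 1))) (bas b)"
    by (auto simp: app_natop app_XE hf_uminus)
qed

text \<open>The extra 1 for \<open>i = 0\<close> comes from the summand
  \<open>K_0^-1\<close>.\<close>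

lemma Bop_fam_1: "Bop 1 (fam 1 n) i = dl n (XE (hf i) (hf (i + 1))) + (if i = 0 then 1 else 0)"
  unfolding natop_1_XE [symmetric] by (simp add: Bop_def fam_1_K fam_1_EF dl_add)

text \<open>The representative \<open>p\<close> may have coefficients with a pole at 1, as long as
  its operator on tensor space is regular there.\<close>

definition A1 :: "'k::field_char_0 \<Rightarrow> nat \<Rightarrow> nat \<Rightarrow> (rat list, rat) lop set" where
  "A1 q r m = {M. \<exists>p\<in>subalg (levi_gens q r). specM q (Om (2 * (r + 2)) m) (evl (wordL (fam q m)) p) M}"

lemma A1_I:
  "p \<in> subalg (levi_gens q r) \<Longrightarrow> specM q (Om (2 * (r + 2)) m) (evl (wordL (fam q m)) p) M \<Longrightarrow> M \<in> A1 q r m"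
  unfolding A1_def by blast

lemma A1_add: "M \<in> A1 q r m \<Longrightarrow> M' \<in> A1 q r m \<Longrightarrow> M + M' \<in> A1 q r m"
proof -
  assume "M \<in> A1 q r m" "M' \<in> A1 q r m"
  then obtain p p' where "p \<in> subalg (levi_gens q r)" "p' \<in> subalg (levi_gens q r)"
    "specM q (Om (2 * (r + 2)) m) (evl (wordL (fam q m)) p) M"
    "specM q (Om (2 * (r + 2)) m) (evl (wordL (fam q m)) p') M'" unfolding A1_def by blast
  then show ?thesis
    by (intro A1_I[of "p + p'"]) (simp_all only: evl_add subalg.add specM_add)
qed

lemma A1_mult: "M \<in> A1 q r m \<Longrightarrow> M' \<in> A1 q r m \<Longrightarrow> M * M' \<in> A1 q r m"
proof -
  assume "M \<in> A1 q r m" "M' \<in> A1 q r m"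
  then obtain p p' where "p \<in> subalg (levi_gens q r)" "p' \<in> subalg (levi_gens q r)"
    "specM q (Om (2 * (r + 2)) m) (evl (wordL (fam q m)) p) M"
    "specM q (Om (2 * (r + 2)) m) (evl (wordL (fam q m)) p') M'" unfolding A1_def by blast
  then show ?thesis
    by (intro A1_I[of "p * p'"]) (simp_all only: evl_wordL_mult subalg.mult specM_mult[OF finite_Om])
qed

lemma A1_sc: "sc c \<in> A1 q r m"
  by (rule A1_I[OF subalg.cst[of "of_rat c"]]) (simp only: evl_word_cst specM_sc[OF spec_of_rat])

lemma A1_diff: "M \<in> A1 q r m \<Longrightarrow> M' \<in> A1 q r m \<Longrightarrow> M - M' \<in> A1 q r m"
  using A1_add[of M q r m "sc (- 1) * M'"] A1_mult[OF A1_sc, of M' q r m "- 1"] by (simp add: sc_uminus)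

lemma A1_sum: "(\<And>x. x \<in> X \<Longrightarrow> F x \<in> A1 q r m) \<Longrightarrow> sum F X \<in> A1 q r m"
  using A1_sc[of 0 q r m] by (induct X rule: infinite_finite_induct) (auto intro: A1_add)

lemma A1_agree:
  assumes "M \<in> A1 q r m" "\<And>f. f \<in> Om (2 * (r + 2)) m \<Longrightarrow> app M (bas f) = app M' (bas f)"
  shows "M' \<in> A1 q r m"
  using assms specM_agree unfolding A1_def by blast

lemma A1_Bop:
  assumes q: "q \<noteq> 0" and i: "i \<in> int_idx r"
  shows "dl m (XE (hf i) (hf (i + 1))) \<in> A1 q r m"
proof -
  let ?O = "Om (2 * (r + 2)) m"
  have g: "specM q ?O (fam q m g) (fam 1 m g)" if "gidx g = i \<or> gidx g = - i" for g
    using that i by (intro specM_fam[OF q]) (auto simp: int_idx_def)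
  have "specM q ?O (Bop q (fam q m) i) (Bop 1 (fam 1 m) i)"
  proof (cases "i = 0")
    case True
    have "specM q ?O (fam q m (GenE 0) + sc q * (fam q m (GenF 0) * fam q m (GenKinv 0)) + fam q m (GenKinv 0))
        (fam 1 m (GenE 0) + sc 1 * (fam 1 m (GenF 0) * fam 1 m (GenKinv 0)) + fam 1 m (GenKinv 0))"
      by (intro specM_add specM_mult[OF finite_Om] specM_sc spec_q g) (simp_all add: True)
    then show ?thesis by (simp only: Bop_def True if_True simp_thms)
  next
    case False
    have "specM q ?O (fam q m (GenE i) + fam q m (GenF (- i)) * fam q m (GenKinv i))
        (fam 1 m (GenE i) + fam 1 m (GenF (- i)) * fam 1 m (GenKinv i))"
      by (intro specM_add specM_mult[OF finite_Om] g) simp_all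
    then show ?thesis by (simp only: Bop_def False if_False)
  qed
  moreover have "iq_B q i \<in> subalg (levi_gens q r)"
    using i by (intro subalg.incl) (simp add: levi_gens_def)
  ultimately have "Bop 1 (fam 1 m) i \<in> A1 q r m"
    by (intro A1_I[of "iq_B q i"]) (simp_all only: evl_iq_B)
  then have "Bop 1 (fam 1 m) i - sc (if i = 0 then 1 else 0) \<in> A1 q r m"
    using A1_diff A1_sc by blast
  also have "Bop 1 (fam 1 m) i - sc (if i = 0 then 1 else 0) = dl m (XE (hf i) (hf (i + 1)))"
    by (simp add: Bop_fam_1)
  finally show ?thesis .
qed

text \<open>On a basis word the operator of \<open>k_i\<close> at one site is a power
  \<open>q^e\<close> with \<open>e\<close> one of 1, 0, -1, and \<open>(q^e - 1) / (q - 1)\<close>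
  has the value \<open>e\<close> at \<open>q = 1\<close>.\<close>

lemma specM_kop_site:
  assumes q: "q \<noteq> 0" "q \<noteq> 1" and i: "1 \<le> i" "i \<le> int r + 1" and n: "n < m"
  shows "specM q (Om (2 * (r + 2)) m) (sc (inverse (q - 1)) * (kop (sitefam q n) i - 1))
    (site n (XE (hf i) (hf i) - XE (hf (i + 1)) (hf (i + 1))))"
  unfolding specM_def
proof (intro conjI ballI allI)
  let ?O = "Om (2 * (r + 2)) m" and ?X = "XE (hf i) (hf i) - XE (hf (i + 1)) (hf (i + 1))"
  \<comment> \<open>The exponents: 1 at \<open>hf i\<close> and its negative, -1 at
    \<open>hf (i + 1)\<close> and its negative. The bound \<open>1 \<le> i\<close> keeps these four
    letters distinct.\<close>
  define e :: "int \<Rightarrow> rat" where "e x = (if x = i \<or> x = 1 - i then 1 else if x = i + 1 \<or> x = - i then - 1 else 0)" for x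
  define \<kappa> where "\<kappa> x = nc q (GenK i) (hf x) * nc q (GenKinv (- i)) (hf x)" for x
  have A: "app (sc (inverse (q - 1)) * (kop (sitefam q n) i - 1)) (bas f) = cst (inverse (q - 1) * (\<kappa> x - 1)) * bas f"
    if "f ! n = hf x" "n < length f" for f x
  proof -
    have u: "f[n := hf x] = f" using that(1) list_update_id[of f n] by simp
    have "app (kop (sitefam q n) i) (bas f) = cst (\<kappa> x) * bas f"
      using that by (simp add: kop_def app_sitefam app_scale u \<kappa>_def cst_mult_assoc mult.commute del: nc.simps)
    then show ?thesis
      by (simp only: app_times_lop app_sc app_minus_lop app_one_lop cst_mult cst_diff cst_1
          left_diff_distrib right_diff_distrib mult.assoc mult_1_right mult_1_left)
  qed
  have X: "app ?X (bas (hf x)) = cst (e x) * bas (hf x)" for x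
    using i unfolding e_def by (auto simp: app_XE hf_uminus cst_uminus)
  have M: "app (site n ?X) (bas f) = cst (e x) * bas f" if "f ! n = hf x" "n < length f" for f x
    using that list_update_id[of f n] by (simp only: app_site if_True X lin_scale lin_bas)
  have sp: "spec q (inverse (q - 1) * (\<kappa> x - 1)) (e x)" for x
  proof -
    have 1: "inverse (q - 1) * (q - 1) = 1" using q by simp
    have 2: "inverse (q - 1) * (inverse q - 1) = - inverse q" using q by (simp add: field_simps)
    have "\<kappa> x = (if x = i \<or> x = 1 - i then q else if x = i + 1 \<or> x = - i then inverse q else 1)"
      using i unfolding \<kappa>_def by auto
    then show ?thesis
      unfolding e_def using 1 2 spec_1[of q] spec_0[of q] spec_uminus[OF spec_inverse_q[OF q(1)]] by auto
  qed
  have O: "\<exists>x. f ! n = hf x" "n < length f" if "f \<in> ?O" for f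
  proof -
    show l: "n < length f" using that n by (simp add: Om_def)
    have "f ! n \<in> half_idx (2 * (r + 2))" using that nth_mem[OF l] unfolding Om_def by blast
    then show "\<exists>x. f ! n = hf x" unfolding half_idx_hf by auto
  qed
  have pr: "pres ?O (sc (inverse (q - 1)) * (kop (sitefam q n) i - 1))" "pres ?O (site n ?X)"
  proof -
    have "app (sc (inverse (q - 1)) * (kop (sitefam q n) i - 1)) (bas f) \<in> sp ?O \<and> app (site n ?X) (bas f) \<in> sp ?O"
      if f: "f \<in> ?O" for f
    proof -
      obtain x where x: "f ! n = hf x" using O(1)[OF f] by blast
      show ?thesis unfolding A[OF x O(2)[OF f]] M[OF x O(2)[OF f]] using f by (intro conjI sp_scale sp_bas)
    qed
    then show "pres ?O (sc (inverse (q - 1)) * (kop (sitefam q n) i - 1))" "pres ?O (site n ?X)"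
      unfolding pres_def by blast+
  qed
  show "pres ?O (sc (inverse (q - 1)) * (kop (sitefam q n) i - 1))" by (rule pr(1))
  show "pres ?O (site n ?X)" by (rule pr(2))
  show "spec q (ent (sc (inverse (q - 1)) * (kop (sitefam q n) i - 1)) h f) (ent (site n ?X) h f)"
    if f: "f \<in> ?O" for f h
  proof -
    obtain x where x: "f ! n = hf x" using O(1)[OF f] by blast
    show ?thesis
      unfolding ent_def A[OF x O(2)[OF f]] M[OF x O(2)[OF f]] using sp[of x] by (simp add: lookup_bas spec_0)
  qed
qed

text \<open>A Leibniz rule: \<open>k k' - 1 = k (k' - 1) + (k - 1)\<close>, where \<open>k\<close>
  becomes 1 at \<open>q = 1\<close>.\<close>

lemma specM_kop:
  assumes q: "q \<noteq> 0" "q \<noteq> 1" and i: "1 \<le> i" "i \<le> int r + 1" and n: "n \<le> m"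
  shows "specM q (Om (2 * (r + 2)) m) (sc (inverse (q - 1)) * (kop (fam q n) i - 1))
    (dl n (XE (hf i) (hf i) - XE (hf (i + 1)) (hf (i + 1))))"
  using n
proof (induct n)
  case 0
  then show ?case by (simp add: kop_def dl_def specM_zero)
next
  case (Suc n)
  let ?X = "XE (hf i) (hf i) - XE (hf (i + 1)) (hf (i + 1))" and ?c = "sc (inverse (q - 1))"
  have comm: "sitefam q n g * fam q n h = fam q n h * sitefam q n g" for g h
    by (rule fam_commute) (auto intro: sitefam_commute)
  have k: "kop (fam q (Suc n)) i = kop (fam q n) i * kop (sitefam q n) i"
    unfolding fam.simps by (rule kop_coprod[OF comm])
  have "specM q (Om (2 * (r + 2)) m) (kop (fam q n) i) (kop (fam 1 n) i)"
    unfolding kop_def using i by (intro specM_mult[OF finite_Om] specM_fam[OF q(1)]) auto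
  then have 1: "specM q (Om (2 * (r + 2)) m) (kop (fam q n) i) 1"
    by (simp add: kop_def fam_1_K)
  have "specM q (Om (2 * (r + 2)) m) (kop (fam q n) i * (?c * (kop (sitefam q n) i - 1)) + ?c * (kop (fam q n) i - 1))
      (1 * site n ?X + dl n ?X)"
    using Suc by (intro specM_add specM_mult[OF finite_Om] 1 specM_kop_site[OF q i]) auto
  moreover have "kop (fam q n) i * (?c * (kop (sitefam q n) i - 1)) + ?c * (kop (fam q n) i - 1)
      = ?c * (kop (fam q (Suc n)) i - 1)"
    unfolding k by (simp add: sc_commute_left[of "kop (fam q n) i"] sc_commute[of "kop (fam q n) i"] right_diff_distrib)
  moreover have "1 * site n ?X + dl n ?X = dl (Suc n) ?X"
    by (simp add: dl_def add.commute)
  ultimately show ?case by (simp only:)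
qed

lemma A1_kop:
  assumes q: "q \<noteq> 0" "q \<noteq> 1" and i: "1 \<le> i" "i \<le> int r + 1"
  shows "dl m (XE (hf i) (hf i) - XE (hf (i + 1)) (hf (i + 1))) \<in> A1 q r m"
proof -
  let ?p = "cst (inverse (q - 1)) * (iq_k i + cst (- 1))"
  have "iq_k i \<in> subalg (levi_gens q r)"
    using i by (intro subalg.incl) (simp add: levi_gens_def int_idx_def)
  then have p: "?p \<in> subalg (levi_gens q r)"
    by (intro subalg.mult subalg.add subalg.cst)
  have "evl (wordL (fam q m)) ?p = sc (inverse (q - 1)) * (kop (fam q m) i - 1)"
    by (simp add: evl_add evl_iq_k sc_uminus)
  with specM_kop[OF q i order_refl] p show ?thesis
    by (intro A1_I[of ?p]) (simp_all only:)
qed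

lemma dl_agree:
  assumes "\<And>a. a \<in> half_idx N \<Longrightarrow> app Y (bas a) = app Y' (bas a)" and f: "f \<in> Om N m"
  shows "app (dl m Y) (bas f) = app (dl m Y') (bas f)"
proof -
  have "f ! p \<in> half_idx N" if "p < m" for p
    using f that nth_mem[of p f] unfolding Om_def by blast
  then show ?thesis
    unfolding dl_def app_sum_lop using f assms(1) by (intro sum.cong refl) (simp add: app_site Om_def)
qed

lemma A1_dl_commutator: "dl m Y \<in> A1 q r m \<Longrightarrow> dl m Z \<in> A1 q r m \<Longrightarrow> dl m (Y * Z - Z * Y) \<in> A1 q r m"
  unfolding dl_commutator by (intro A1_diff A1_mult)

lemma hf_nonzero [simp]: "hf x \<noteq> 0"
proof -
  have "0 < hf x \<or> 0 < - hf x" unfolding hf_uminus hf_pos by linarith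
  then show ?thesis by (metis less_irrefl neg_0_less_iff_less)
qed

lemma half_idxE:
  assumes "a \<in> half_idx (2 * s)"
  obtains x where "a = hf x" "1 - int s \<le> x" "x \<le> int s"
  using assms unfolding half_idx_hf by auto

text \<open>The generators supply neighbouring indices, and commutators increase the distance, as
  for root vectors. Since \<open>XE\<close> is symmetrized under negation, the reversed product may
  leave an unwanted term, which has a smaller distance and falls under the induction.\<close>

lemma A1_XE_less:
  assumes q: "q \<noteq> 0" and "- int r \<le> x" "x < y" "y \<le> int r + 1"
  shows "dl m (XE (hf x) (hf y)) \<in> A1 q r m"
  using assms(2-)
proof (induct "nat (y - x)" arbitrary: x y rule: less_induct)
  case less
  show ?case
  proof (cases "y = x + 1")
    case True
    then have "x \<in> int_idx r" using less.prems by (simp add: int_idx_def)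
    from A1_Bop[OF q this] True show ?thesis by simp
  next
    case False
    define z where "z = y - 1"
    have z: "x < z" "y = z + 1" using False less.prems by (auto simp: z_def)
    have xz: "dl m (XE (hf x) (hf z)) \<in> A1 q r m"
      by (rule less.hyps) (use z less.prems in auto)
    have "z \<in> int_idx r" using z less.prems by (simp add: int_idx_def)
    then have zy: "dl m (XE (hf z) (hf y)) \<in> A1 q r m" using A1_Bop[OF q] z by simp
    have 1: "XE (hf x) (hf z) * XE (hf z) (hf y) = XE (hf x) (hf y)"
      by (simp add: XE_mult)
    have 2: "XE (hf z) (hf y) * XE (hf x) (hf z) = (if x = 1 - y then XE (hf (x + 1)) (hf z) else 0)"
      using less.prems z by (auto simp: XE_mult hf_uminus)
    have comm: "dl m (XE (hf x) (hf z) * XE (hf z) (hf y) - XE (hf z) (hf y) * XE (hf x) (hf z)) \<in> A1 q r m"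
      by (rule A1_dl_commutator[OF xz zy])
    show ?thesis
    proof (cases "x = 1 - y")
      case True
      \<comment> \<open>The difference \<open>z - (x + 1) = 2 y - 3\<close> is odd and therefore
        cannot be 0.\<close>
      have "x + 1 < z" using True z by presburger
      then have "dl m (XE (hf (x + 1)) (hf z)) \<in> A1 q r m"
        by (intro less.hyps) (use z less.prems in auto)
      with comm[unfolded 1 2 if_P[OF True]]
      have "dl m (XE (hf x) (hf y) - XE (hf (x + 1)) (hf z)) + dl m (XE (hf (x + 1)) (hf z)) \<in> A1 q r m"
        by (rule A1_add)
      then show ?thesis by (simp only: dl_diff diff_add_cancel)
    next
      case False
      then show ?thesis using comm unfolding 1 2 by simp
    qed
  qed
qed

text \<open>The \<open>k_i\<close> supply only differences of the diagonal operators. The sum over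
  all \<open>r + 2\<close> of them is the scalar \<open>m\<close> on tensor space, and this
  separates them.\<close>

lemma A1_XE_diag:
  assumes q: "q \<noteq> 0" "q \<noteq> 1" and j: "1 \<le> j" "j \<le> int r + 2"
  shows "dl m (XE (hf j) (hf j)) \<in> A1 q r m"
proof -
  let ?d = "\<lambda>j. XE (hf j) (hf j)"
  have diff: "dl m (?d 1 - ?d j) \<in> A1 q r m" if "1 \<le> j" "j \<le> int r + 2" for j
    using that
  proof (induct j rule: int_ge_induct)
    case base
    then show ?case using A1_sc[of 0 q r m] by (simp add: dl_def)
  next
    case (step j)
    have "dl m (?d j - ?d (j + 1)) \<in> A1 q r m" using step by (intro A1_kop q) auto
    moreover have "dl m (?d 1 - ?d j) \<in> A1 q r m" using step by simp
    ultimately have "dl m (?d 1 - ?d j) + dl m (?d j - ?d (j + 1)) \<in> A1 q r m" by (rule A1_add[rotated])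
    then show ?case by (simp only: dl_diff) simp
  qed
  let ?J = "{1..int r + 2}"
  have "dl m (\<Sum>j\<in>?J. ?d j) \<in> A1 q r m"
  proof (rule A1_agree[OF A1_sc[of "of_nat m"]])
    fix f assume f: "f \<in> Om (2 * (r + 2)) m"
    have "app (\<Sum>j\<in>?J. ?d j) (bas a) = app 1 (bas a)" if a: "a \<in> half_idx (2 * (r + 2))" for a
    proof -
      obtain x where x: "a = hf x" "1 - int (r + 2) \<le> x" "x \<le> int (r + 2)" using a by (rule half_idxE)
      \<comment> \<open>Each letter is met by exactly one summand, the one of its positive
        representative.\<close>
      have "app (\<Sum>j\<in>?J. ?d j) (bas a) = (\<Sum>j\<in>?J. if j = (if 1 \<le> x then x else 1 - x) then bas a else 0)"
        unfolding app_sum_lop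
        by (intro sum.cong refl) (auto simp: app_XE x hf_uminus)
      also have "\<dots> = bas a" using x by (simp add: sum.delta)
      finally show ?thesis by simp
    qed
    then have "app (dl m (\<Sum>j\<in>?J. ?d j)) (bas f) = app (dl m 1) (bas f)"
      by (rule dl_agree[OF _ f])
    also have "\<dots> = (\<Sum>p<m. bas f)"
      unfolding dl_def app_sum_lop using f by (intro sum.cong refl) (simp add: app_site Om_def)
    also have "\<dots> = app (sc (of_nat m)) (bas f)"
    proof -
      have "(\<Sum>p<n. v) = cst (of_nat n) * v" for n and v :: "rat list \<Rightarrow>\<^sub>0 rat"
        by (induct n) (simp_all add: cst_add distrib_right)
      then show ?thesis by (simp only: app_sc)
    qed
    finally show "app (sc (of_nat m)) (bas f) = app (dl m (\<Sum>j\<in>?J. ?d j)) (bas f)" by simp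
  qed
  moreover have "(\<Sum>j\<in>?J. dl m (?d 1 - ?d j)) \<in> A1 q r m"
    by (rule A1_sum) (use diff in auto)
  ultimately have "dl m (\<Sum>j\<in>?J. ?d j) + (\<Sum>j\<in>?J. dl m (?d 1 - ?d j)) \<in> A1 q r m"
    by (rule A1_add)
  also have "dl m (\<Sum>j\<in>?J. ?d j) + (\<Sum>j\<in>?J. dl m (?d 1 - ?d j)) = of_nat (r + 2) * dl m (?d 1)"
  proof -
    have "dl m (\<Sum>j\<in>X. ?d j) = (\<Sum>j\<in>X. dl m (?d j))" if "finite X" for X :: "int set"
      using that by induct (simp_all add: dl_add, simp add: dl_def)
    then show ?thesis by (simp add: dl_diff sum_subtractf nat_add_distrib)
  qed
  finally have "sc (inverse (of_nat (r + 2))) * (of_nat (r + 2) * dl m (?d 1)) \<in> A1 q r m"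
    by (rule A1_mult[OF A1_sc])
  also have "sc (inverse (of_nat (r + 2))) * (of_nat (r + 2) * dl m (?d 1)) = dl m (?d 1)"
  proof -
    have n: "of_nat n = (sc (of_nat n) :: (rat list, rat) lop)" for n
      by (induct n) (simp_all add: sc_add)
    have "inverse (of_nat (r + 2)) * of_nat (r + 2) = (1 :: rat)"
      by (rule left_inverse) (simp only: of_nat_eq_0_iff)
    then show ?thesis unfolding n sc_sc_left by (simp only: sc_1 mult_1_left)
  qed
  finally have "dl m (?d 1) - dl m (?d 1 - ?d j) \<in> A1 q r m"
    using diff[OF j] by (rule A1_diff)
  then show ?thesis by (simp only: dl_diff) simp
qed

text \<open>The matrix positions open to the Levi subalgebra: the inner square and the two outer
  diagonal places.\<close>

definition adm :: "nat \<Rightarrow> rat \<Rightarrow> rat \<Rightarrow> bool" where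
  "adm r a b \<longleftrightarrow> a \<in> half_idx (2 * (r + 1)) \<and> b \<in> half_idx (2 * (r + 1)) \<or>
     a = b \<and> (b = hf (int r + 2) \<or> b = - hf (int r + 2))"

text \<open>The operator 0 is included so that products stay inside.\<close>

definition Adm :: "nat \<Rightarrow> (rat, rat) lop set" where
  "Adm r = insert 0 {XE a b | a b. adm r a b}"

lemma A1_Adm:
  assumes q: "q \<noteq> 0" "q \<noteq> 1" and Y: "Y \<in> Adm r"
  shows "dl m Y \<in> A1 q r m"
proof -
  have diag: "dl m (XE (hf x) (hf x)) \<in> A1 q r m" if "- int r - 1 \<le> x" "x \<le> int r + 2" for x
  proof (cases "1 \<le> x")
    case True
    then show ?thesis using A1_XE_diag[OF q] that by blast
  next
    case False
    have "XE (hf x) (hf x) = XE (hf (1 - x)) (hf (1 - x))"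
      using XE_uminus[of "hf x" "hf x"] by (simp add: hf_uminus)
    then show ?thesis using A1_XE_diag[OF q, of "1 - x"] that False by simp
  qed
  from Y consider "Y = 0" | a b where "Y = XE a b" "adm r a b" by (auto simp: Adm_def)
  then show ?thesis
  proof cases
    case 1
    then show ?thesis using A1_sc[of 0 q r m] by (simp add: dl_def)
  next
    case 2
    from 2(2) consider "a \<in> half_idx (2 * (r + 1))" "b \<in> half_idx (2 * (r + 1))"
      | "a = b" "b = hf (int r + 2)" | "a = b" "b = hf (- int r - 1)"
      by (auto simp: adm_def hf_uminus algebra_simps)
    then show ?thesis
    proof cases
      case 1
      obtain x where x: "a = hf x" "1 - int (r + 1) \<le> x" "x \<le> int (r + 1)" using 1(1) by (rule half_idxE)
      obtain y where y: "b = hf y" "1 - int (r + 1) \<le> y" "y \<le> int (r + 1)" using 1(2) by (rule half_idxE)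
      have xy: "a = hf x" "b = hf y"
        "- int r \<le> x" "x \<le> int r + 1" "- int r \<le> y" "y \<le> int r + 1"
        using x y by simp_all
      consider "x < y" | "x = y" | "y < x" by linarith
      then show ?thesis
      proof cases
        case 1
        then show ?thesis using A1_XE_less[OF q(1), of r x y m] xy 2 by simp
      next
        case 2
        then show ?thesis using diag[of x] xy \<open>Y = XE a b\<close> by simp
      next
        case 3
        \<comment> \<open>Negating both indices brings a place below the diagonal above it.\<close>
        have "Y = XE (hf (1 - x)) (hf (1 - y))"
          using XE_uminus[of "hf y" "hf x"] xy \<open>Y = XE a b\<close> by (simp add: hf_uminus)
        then show ?thesis using A1_XE_less[OF q(1), of r "1 - x" "1 - y" m] xy 3 by simp
      qed
    qed (use diag[of "int r + 2"] diag[of "- int r - 1"] 2 in auto)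
  qed
qed

text \<open>Inner and outer letters never meet in a nonzero product, so the inner square and the
  outer diagonal are closed separately.\<close>

lemma Adm_mult:
  assumes "X \<in> Adm r" "Y \<in> Adm r"
  shows "X * Y \<in> Adm r"
proof (cases "X = 0 \<or> Y = 0")
  case True
  then show ?thesis by (auto simp: Adm_def)
next
  case False
  then obtain a b c d where X: "X = XE a b" "adm r a b" and Y: "Y = XE c d" "adm r c d"
    using assms by (auto simp: Adm_def)
  have t: "hf (int r + 2) \<notin> half_idx (2 * (r + 1))" "- hf (int r + 2) \<notin> half_idx (2 * (r + 1))"
    unfolding hf_uminus hf_in_half_idx by simp_all
  let ?V = "half_idx (2 * (r + 1))" and ?t = "hf (int r + 2)"
  have b: "b \<noteq> 0"
    using X(2) half_idx_nonzero[of b "r + 1"] hf_nonzero[of "int r + 2"] unfolding adm_def neg_equal_0_iff_equal [symmetric, of "hf (int r + 2)"]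
    by (elim disjE conjE) simp_all
  have neg: "x \<in> ?V \<Longrightarrow> - x \<in> ?V" for x by (rule half_idx_uminus)
  have "adm r a d" if "c = b"
  proof (cases "b \<in> ?V")
    case True
    then have "a \<in> ?V" "d \<in> ?V" using X(2) Y(2) that t unfolding adm_def by metis+
    then show ?thesis by (simp add: adm_def)
  next
    case False
    then have "a = b" "c = d" "b = ?t \<or> b = - ?t" using X(2) Y(2) that unfolding adm_def by metis+
    then show ?thesis using that by (simp add: adm_def)
  qed
  moreover have "adm r (- a) d" if cb: "c = - b"
  proof (cases "b \<in> ?V")
    case True
    then have "c \<in> ?V" using neg cb by simp
    then have "a \<in> ?V" "d \<in> ?V" using True X(2) Y(2) t unfolding adm_def by metis+
    then show ?thesis using neg by (simp add: adm_def)
  next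
    case False
    then have "c \<notin> ?V" using neg[of c] cb by auto
    with False have "a = b" "c = d" "b = ?t \<or> b = - ?t" using X(2) Y(2) unfolding adm_def by metis+
    then have "- a = d" "d = ?t \<or> d = - ?t" using cb by auto
    then show ?thesis by (simp add: adm_def)
  qed
  ultimately show ?thesis
    unfolding X(1) Y(1) XE_mult[OF b] by (auto simp: Adm_def)
qed

section \<open>Symmetrized tensors of one-site operators\<close>

definition W :: "nat list \<Rightarrow> (rat, 'k::comm_ring_1) lop list \<Rightarrow> (rat list, 'k) lop" where
  "W ps Xs = prod_list (map2 site ps Xs)"

definition DL :: "nat \<Rightarrow> nat \<Rightarrow> nat list set" where
  "DL m n = {ps. length ps = n \<and> distinct ps \<and> set ps \<subseteq> {..<m}}"

lemma finite_DL: "finite (DL m n)"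
  by (rule finite_subset[OF _ finite_lists_length_eq[of "{..<m}" n]]) (auto simp: DL_def)

text \<open>The sum runs over all injective placements of the factors; repeated factors are counted
  with multiplicity instead of dividing by a stabilizer.\<close>

definition SS :: "nat \<Rightarrow> (rat, 'k::comm_ring_1) lop list \<Rightarrow> (rat list, 'k) lop" where
  "SS m Xs = (\<Sum>ps\<in>DL m (length Xs). W ps Xs)"

lemma site_W:
  assumes "distinct ps" "length ps = length Xs" "s < length Xs"
  shows "site (ps ! s) Y * W ps Xs = W ps (Xs[s := Y * Xs ! s])"
  using assms
proof (induct ps arbitrary: Xs s)
  case (Cons p ps)
  then obtain X Xs' where Xs: "Xs = X # Xs'" by (cases Xs) auto
  show ?case
  proof (cases s)
    case 0
    then show ?thesis by (simp add: Xs W_def mult.assoc [symmetric] site_mult)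
  next
    case (Suc t)
    then have "site (ps ! t) Y * W ps Xs' = W ps (Xs'[t := Y * Xs' ! t])"
      using Cons Xs by auto
    moreover have "ps ! t \<noteq> p" using Cons Suc Xs by auto
    then have "site (ps ! t) Y * site p X = site p X * site (ps ! t) Y" by (rule site_commute)
    then have "site (ps ! t) Y * (site p X * W ps Xs') = site p X * (site (ps ! t) Y * W ps Xs')"
      by (simp only: mult.assoc [symmetric])
    ultimately show ?thesis
      unfolding Suc Xs by (simp add: W_def)
  qed
qed simp

text \<open>The additional factor meets either a free position or an occupied one; in the second
  case it merges with the factor found there.\<close>

lemma dl_SS: "dl m Y * SS m Xs = SS m (Y # Xs) + (\<Sum>s<length Xs. SS m (Xs[s := Y * Xs ! s]))"
proof -
  let ?n = "length Xs"
  have "dl m Y * SS m Xs = (\<Sum>ps\<in>DL m ?n. \<Sum>p<m. site p Y * W ps Xs)"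
    unfolding dl_def SS_def sum_product by (rule sum.swap)
  also have "\<dots> = (\<Sum>ps\<in>DL m ?n. (\<Sum>p\<in>{..<m} - set ps. site p Y * W ps Xs) + (\<Sum>s<?n. W ps (Xs[s := Y * Xs ! s])))"
  proof (intro sum.cong refl)
    fix ps assume ps: "ps \<in> DL m ?n"
    then have "(\<Sum>p<m. site p Y * W ps Xs)
        = (\<Sum>p\<in>{..<m} - set ps. site p Y * W ps Xs) + (\<Sum>p\<in>set ps. site p Y * W ps Xs)"
      by (intro sum.subset_diff) (auto simp: DL_def)
    also have "(\<Sum>p\<in>set ps. site p Y * W ps Xs) = (\<Sum>s<?n. site (ps ! s) Y * W ps Xs)"
      using ps by (intro sum.reindex_bij_betw[symmetric] bij_betw_nth) (auto simp: DL_def)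
    also have "\<dots> = (\<Sum>s<?n. W ps (Xs[s := Y * Xs ! s]))"
      using ps by (intro sum.cong refl site_W) (auto simp: DL_def)
    finally show "(\<Sum>p<m. site p Y * W ps Xs) = (\<Sum>p\<in>{..<m} - set ps. site p Y * W ps Xs) + (\<Sum>s<?n. W ps (Xs[s := Y * Xs ! s]))" .
  qed
  also have "\<dots> = (\<Sum>ps\<in>DL m ?n. \<Sum>p\<in>{..<m} - set ps. site p Y * W ps Xs) + (\<Sum>s<?n. SS m (Xs[s := Y * Xs ! s]))"
  proof -
    have "(\<Sum>ps\<in>DL m ?n. \<Sum>s<?n. W ps (Xs[s := Y * Xs ! s])) = (\<Sum>s<?n. SS m (Xs[s := Y * Xs ! s]))"
      unfolding SS_def length_list_update by (rule sum.swap)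
    then show ?thesis by (simp only: sum.distrib)
  qed
  also have "(\<Sum>ps\<in>DL m ?n. \<Sum>p\<in>{..<m} - set ps. site p Y * W ps Xs) = SS m (Y # Xs)"
  proof -
    have "(\<Sum>ps\<in>DL m ?n. \<Sum>p\<in>{..<m} - set ps. site p Y * W ps Xs)
        = (\<Sum>(ps, p)\<in>(SIGMA ps:DL m ?n. {..<m} - set ps). W (p # ps) (Y # Xs))"
      by (subst sum.Sigma) (auto simp: finite_DL W_def)
    also have "\<dots> = SS m (Y # Xs)"
      unfolding SS_def
    proof (rule sum.reindex_bij_witness[of _ "\<lambda>qs. (tl qs, hd qs)" "\<lambda>(ps, p). p # ps"])
      fix qs assume "qs \<in> DL m (length (Y # Xs))"
      then show "(tl qs, hd qs) \<in> (SIGMA ps:DL m ?n. {..<m} - set ps)"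
        "(\<lambda>(ps, p). p # ps) (tl qs, hd qs) = qs"
        by (cases qs; auto simp: DL_def)+
    qed (auto simp: DL_def)
    finally show ?thesis .
  qed
  finally show ?thesis .
qed

text \<open>The recursion \<open>dl_SS\<close> is solved for its longest term: the merged terms have
  one factor less, and their factors are still in \<open>Adm r\<close>.\<close>

lemma A1_SS:
  assumes q: "q \<noteq> 0" "q \<noteq> 1" and Xs: "set Xs \<subseteq> Adm r"
  shows "SS m Xs \<in> A1 q r m"
  using Xs
proof (induct "length Xs" arbitrary: Xs)
  case 0
  have "DL m 0 = {[]}" by (auto simp: DL_def)
  with 0 have "SS m Xs = sc 1" by (simp add: SS_def W_def)
  then show ?case by (simp only: A1_sc)
next
  case (Suc n)
  then obtain Y Ys where Xs: "Xs = Y # Ys" "length Ys = n" by (cases Xs) auto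
  have "SS m (Ys[s := Y * Ys ! s]) \<in> A1 q r m" if "s < length Ys" for s
  proof -
    have "Y * Ys ! s \<in> Adm r" using Suc.prems Xs that by (intro Adm_mult) auto
    then have "set (Ys[s := Y * Ys ! s]) \<subseteq> Adm r"
      using Suc.prems Xs set_update_subset_insert[of Ys s "Y * Ys ! s"] by auto
    with Suc.hyps(1)[of "Ys[s := Y * Ys ! s]"] Xs(2) show ?thesis by simp
  qed
  then have 1: "(\<Sum>s<length Ys. SS m (Ys[s := Y * Ys ! s])) \<in> A1 q r m"
    by (intro A1_sum) auto
  have "dl m Y * SS m Ys \<in> A1 q r m"
    using Suc Xs by (intro A1_mult A1_Adm[OF q]) auto
  then have "dl m Y * SS m Ys - (\<Sum>s<length Ys. SS m (Ys[s := Y * Ys ! s])) \<in> A1 q r m"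
    using 1 by (rule A1_diff)
  then show ?case unfolding dl_SS Xs(1) by simp
qed

subsection \<open>The commutant at q = 1\<close>

definition neg2 :: "rat \<times> rat \<Rightarrow> rat \<times> rat" where
  "neg2 z = (- fst z, - snd z)"

definition XL :: "(rat \<times> rat) list \<Rightarrow> (rat, rat) lop list" where
  "XL zs = map (\<lambda>(a, b). XE a b) zs"

lemma app_site_XE:
  assumes "p < length f"
  shows "app (site p (XE a b)) (bas f) =
    (if f ! p = b then bas (f[p := a]) else if f ! p = - b then bas (f[p := - a]) else 0)"
  using assms by (simp add: app_site app_XE)

text \<open>Each factor changes the letter at one position, the positions are distinct, and
  \<open>XE\<close> never produces a sum of two basis vectors; so the image remains a single word or
  becomes 0.\<close>

lemma W_XE_monomial:
  assumes "distinct ps" "length ps = length zs" "set ps \<subseteq> {..<length f}"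
  shows "app (W ps (XL zs)) (bas f) = 0 \<or> (\<exists>g. app (W ps (XL zs)) (bas f) = bas g \<and> length g = length f \<and>
    (\<forall>t<length zs. (g ! (ps ! t), f ! (ps ! t)) \<in> {zs ! t, neg2 (zs ! t)}) \<and> (\<forall>p. p \<notin> set ps \<longrightarrow> g ! p = f ! p))"
  using assms
proof (induct ps arbitrary: zs)
  case Nil
  then show ?case by (intro disjI2 exI[of _ f]) (simp add: W_def XL_def)
next
  case (Cons p ps)
  then obtain a b zs' where zs: "zs = (a, b) # zs'" by (cases zs) auto
  have W: "app (W (p # ps) (XL zs)) (bas f) = app (site p (XE a b)) (app (W ps (XL zs')) (bas f))"
    by (simp add: W_def XL_def zs)
  have "app (W ps (XL zs')) (bas f) = 0 \<or> (\<exists>g. app (W ps (XL zs')) (bas f) = bas g \<and> length g = length f \<and>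
    (\<forall>t<length zs'. (g ! (ps ! t), f ! (ps ! t)) \<in> {zs' ! t, neg2 (zs' ! t)}) \<and> (\<forall>p. p \<notin> set ps \<longrightarrow> g ! p = f ! p))"
    using Cons zs by (intro Cons.hyps) auto
  then show ?case
  proof
    assume "app (W ps (XL zs')) (bas f) = 0"
    then show ?thesis by (simp add: W)
  next
    assume "\<exists>g. app (W ps (XL zs')) (bas f) = bas g \<and> length g = length f \<and>
      (\<forall>t<length zs'. (g ! (ps ! t), f ! (ps ! t)) \<in> {zs' ! t, neg2 (zs' ! t)}) \<and> (\<forall>p. p \<notin> set ps \<longrightarrow> g ! p = f ! p)"
    then obtain g where g: "app (W ps (XL zs')) (bas f) = bas g" "length g = length f"
      "\<And>t. t < length zs' \<Longrightarrow> (g ! (ps ! t), f ! (ps ! t)) \<in> {zs' ! t, neg2 (zs' ! t)}"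
      "\<And>p. p \<notin> set ps \<Longrightarrow> g ! p = f ! p" by blast
    have p: "p < length g" "g ! p = f ! p" "p \<notin> set ps" using Cons.prems g(2,4) by auto
    have step: "(\<forall>t<length zs. (g[p := c] ! ((p # ps) ! t), f ! ((p # ps) ! t)) \<in> {zs ! t, neg2 (zs ! t)}) \<and>
        (\<forall>p'. p' \<notin> set (p # ps) \<longrightarrow> g[p := c] ! p' = f ! p')"
      if c: "(c, f ! p) \<in> {(a, b), neg2 (a, b)}" for c
    proof (intro conjI allI impI)
      fix t assume t: "t < length zs"
      show "(g[p := c] ! ((p # ps) ! t), f ! ((p # ps) ! t)) \<in> {zs ! t, neg2 (zs ! t)}"
      proof (cases t)
        case 0
        then show ?thesis using c p zs by simp
      next
        case (Suc t')
        then have t': "t' < length zs'" using t zs by simp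
        then have "ps ! t' \<noteq> p" using p(3) Cons.prems zs by (metis Suc_inject length_Cons nth_mem)
        then show ?thesis using g(3)[OF t'] Suc zs by simp
      qed
    next
      fix p' assume "p' \<notin> set (p # ps)"
      then show "g[p := c] ! p' = f ! p'" using g(4)[of p'] by simp
    qed
    define Q where "Q v \<longleftrightarrow> (\<exists>h. v = (bas h :: rat list \<Rightarrow>\<^sub>0 rat) \<and> length h = length f \<and>
      (\<forall>t<length zs. (h ! ((p # ps) ! t), f ! ((p # ps) ! t)) \<in> {zs ! t, neg2 (zs ! t)}) \<and>
      (\<forall>p'. p' \<notin> set (p # ps) \<longrightarrow> h ! p' = f ! p'))" for v
    have fin: "Q (bas (g[p := c]))" if "(c, f ! p) \<in> {(a, b), neg2 (a, b)}" for c
      unfolding Q_def using step[OF that] g(2) by (intro exI[of _ "g[p := c]"] conjI) simp_all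
    consider "f ! p = b" | "f ! p \<noteq> b" "f ! p = - b" | "f ! p \<noteq> b" "f ! p \<noteq> - b" by blast
    then have "app (W (p # ps) (XL zs)) (bas f) = 0 \<or> Q (app (W (p # ps) (XL zs)) (bas f))"
    proof cases
      case 1
      then show ?thesis unfolding W g(1) app_site_XE[OF p(1)] p(2) using fin[of a] by simp
    next
      case 2
      then show ?thesis unfolding W g(1) app_site_XE[OF p(1)] p(2) using fin[of "- a"] by (simp add: neg2_def)
    next
      case 3
      then show ?thesis unfolding W g(1) app_site_XE[OF p(1)] p(2) by simp
    qed
    then show ?thesis unfolding Q_def .
  qed
qed

lemma W_XE_self:
  assumes "distinct ps" "set ps \<subseteq> {..<length f}" "length g = length f"
  shows "app (W ps (map (\<lambda>p. XE (g ! p) (f ! p)) ps)) (bas f) =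
    bas (map (\<lambda>p. if p \<in> set ps then g ! p else f ! p) [0..<length f])"
  using assms
proof (induct ps)
  case Nil
  then show ?case by (simp add: W_def map_nth)
next
  case (Cons p ps)
  let ?h = "map (\<lambda>p. if p \<in> set ps then g ! p else f ! p) [0..<length f]"
  have p: "p < length ?h" "?h ! p = f ! p" using Cons by auto
  have "app (W (p # ps) (map (\<lambda>p. XE (g ! p) (f ! p)) (p # ps))) (bas f) = app (site p (XE (g ! p) (f ! p))) (bas ?h)"
    using Cons by (simp add: W_def)
  also have "\<dots> = bas (?h[p := g ! p])"
    unfolding app_site_XE[OF p(1)] p(2) by simp
  also have "?h[p := g ! p] = map (\<lambda>t. if t \<in> set (p # ps) then g ! t else f ! t) [0..<length f]"
    using p by (intro nth_equalityI) (auto simp: nth_list_update)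
  finally show ?case .
qed

text \<open>Adjacent exchanges move the head of one list to the front of the other; the tails are
  then compared by induction for the function \<open>\<lambda>l. F (x # l)\<close>.\<close>

lemma adjacent_swaps_mset:
  assumes "\<And>u x y w. F (u @ x # y # w) = F (u @ y # x # w)" and "mset zs = mset zs'"
  shows "F zs = F zs'"
  using assms
proof (induct zs arbitrary: zs' F)
  case (Cons x xs)
  have "x \<in> set zs'" using Cons.prems(2) by (metis list.set_intros(1) set_mset_mset)
  then obtain u w where zs': "zs' = u @ x # w" by (meson split_list)
  have "F (u @ x # w) = F (x # u @ w)" for u w
  proof (induct u arbitrary: w rule: rev_induct)
    case (snoc y u)
    have "F ((u @ [y]) @ x # w) = F (u @ x # y # w)" using Cons.prems(1)[of u y x w] by simp
    then show ?case using snoc[of "y # w"] by simp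
  qed simp
  moreover have "F (x # xs) = F (x # u @ w)"
  proof (rule Cons.hyps[of "\<lambda>l. F (x # l)"])
    show "F (x # v @ a # b # c) = F (x # v @ b # a # c)" for v a b c
      using Cons.prems(1)[of "x # v" a b c] by simp
    show "mset xs = mset (u @ w)" using Cons.prems(2) zs' by simp
  qed
  ultimately show ?case using zs' by simp
qed simp

text \<open>At \<open>q = 1\<close> the Hecke operators permute the basis words; these are the
  simple reflections of the hyperoctahedral group acting on indices.\<close>

definition tau :: "nat \<Rightarrow> rat list \<Rightarrow> rat list" where
  "tau i f = (if i = 0 then f[0 := - (f ! 0)] else f[i - 1 := f ! i, i := f ! (i - 1)])"

lemma app_hop_1: "f \<in> Om N m \<Longrightarrow> app (hop 1 N m i) (bas f) = bas (tau i f)"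
  by (auto simp: app_hop hecke_op_basis_def tau_def Let_def) (metis list_update_id)

lemma tau_Om:
  assumes "f \<in> Om (2 * s) m" "i < m"
  shows "tau i f \<in> Om (2 * s) m"
proof -
  have n: "f ! p \<in> half_idx (2 * s)" if "p < m" for p
    using assms(1) that nth_mem[of p f] unfolding Om_def by blast
  have u: "f[p := x] \<in> Om (2 * s) m" if "f \<in> Om (2 * s) m" "x \<in> half_idx (2 * s)" for f p x
    using that set_update_subset_insert[of f p x] by (auto simp: Om_def)
  show ?thesis
    unfolding tau_def using assms n by (auto intro!: u half_idx_uminus)
qed

lemma tau_tau:
  assumes "f \<in> Om N m" "i < m"
  shows "tau i (tau i f) = f"
  using assms by (intro nth_equalityI) (auto simp: tau_def Om_def nth_list_update)

lemma lookup_hop_1: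
  assumes v: "v \<in> sp (Om (2 * s) m)" and g: "g \<in> Om (2 * s) m" and i: "i < m"
  shows "Poly_Mapping.lookup (app (hop 1 (2 * s) m i) v) g = Poly_Mapping.lookup v (tau i g)"
  using v
proof (induct rule: sp_induct)
  case (single c h)
  have "tau i h = g \<longleftrightarrow> h = tau i g" using tau_tau[OF single i] tau_tau[OF g i] by auto
  then show ?case by (simp add: app_scale app_hop_1[OF single] lookup_bas)
qed (simp_all add: app_add lookup_add)

lemma lookup_Pr: "Poly_Mapping.lookup (app (Pr r m l) v) g = (if g \<in> blk r m l then Poly_Mapping.lookup v g else 0)"
proof (induct v rule: pm_induct)
  case (single c b)
  then show ?case by (auto simp: app_scale app_Pr lookup_bas)
qed (simp add: app_add lookup_add)

text \<open>The chosen representative of a pair of nonzero letters modulo simultaneous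
  negation.\<close>

definition nrm :: "rat \<times> rat \<Rightarrow> rat \<times> rat" where
  "nrm z = (if snd z > 0 then z else neg2 z)"

section \<open>Matrices commuting with signed permutations and block projections\<close>

context
  fixes r m :: nat and M :: "(rat list, rat) lop" and \<Omega> :: "rat list set"
  defines "\<Omega> \<equiv> Om (2 * (r + 2)) m"
  assumes pres: "pres \<Omega> M"
    and hop: "\<And>i f. i < m \<Longrightarrow> f \<in> \<Omega> \<Longrightarrow>
      app (M * hop 1 (2 * (r + 2)) m i) (bas f) = app (hop 1 (2 * (r + 2)) m i * M) (bas f)"
    and Pr: "\<And>l f. l \<le> m \<Longrightarrow> f \<in> \<Omega> \<Longrightarrow> app (M * Pr r m l) (bas f) = app (Pr r m l * M) (bas f)"
begin

text \<open>Conjugation by a permutation matrix permutes rows and columns simultaneously.\<close>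

lemma ent_tau:
  assumes "g \<in> \<Omega>" "f \<in> \<Omega>" "i < m"
  shows "ent M (tau i g) (tau i f) = ent M g f"
proof -
  have t: "tau i g \<in> \<Omega>" using assms tau_Om unfolding \<Omega>_def by blast
  have "app M (bas f) \<in> sp \<Omega>" using pres assms by (simp add: pres_def)
  then have "Poly_Mapping.lookup (app (hop 1 (2 * (r + 2)) m i * M) (bas f)) (tau i g)
      = Poly_Mapping.lookup (app M (bas f)) (tau i (tau i g))"
    using t assms unfolding \<Omega>_def app_times_lop by (intro lookup_hop_1)
  also have "tau i (tau i g) = g" using assms tau_tau unfolding \<Omega>_def by blast
  finally show ?thesis
    using hop[OF assms(3,2)] assms(2) unfolding \<Omega>_def
    by (simp only: ent_def app_times_lop app_hop_1)
qed

text \<open>An entry of \<open>M\<close> as a function of the list of its pairs of row and column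
  letters, on which signed permutations act. The default 0 makes the invariance hold without range
  conditions.\<close>

definition FF :: "(rat \<times> rat) list \<Rightarrow> rat" where
  "FF zs = (if map fst zs \<in> \<Omega> \<and> map snd zs \<in> \<Omega> then ent M (map fst zs) (map snd zs) else 0)"

lemma FF_swap: "FF (u @ x # y # w) = FF (u @ y # x # w)"
proof -
  have t: "tau (Suc (length u)) (map h (u @ x # y # w)) = map h (u @ y # x # w)" for h :: "rat \<times> rat \<Rightarrow> rat"
    by (simp add: tau_def nth_append list_update_append)
  have O: "map h (u @ y # x # w) \<in> \<Omega> \<longleftrightarrow> map h (u @ x # y # w) \<in> \<Omega>" for h :: "rat \<times> rat \<Rightarrow> rat"
    unfolding \<Omega>_def Om_def by auto
  have "Suc (length u) < m" if "map fst (u @ x # y # w) \<in> \<Omega>"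
    using that unfolding \<Omega>_def Om_def by auto
  then show ?thesis
    unfolding FF_def O using ent_tau[of "map fst (u @ x # y # w)" "map snd (u @ x # y # w)" "Suc (length u)"]
    unfolding t by simp
qed

lemma FF_mset: "mset zs = mset zs' \<Longrightarrow> FF zs = FF zs'"
  using adjacent_swaps_mset[of FF zs zs'] FF_swap by blast

text \<open>The reflection \<open>tau 0\<close> negates only the first pair, and by
  \<open>FF_mset\<close> any pair can be brought there.\<close>

lemma FF_neg2: "FF (u @ x # w) = FF (u @ neg2 x # w)"
proof -
  have h: "FF (x # w) = FF (neg2 x # w)" for w
  proof -
    have t: "tau 0 (map fst (x # w)) = map fst (neg2 x # w)" "tau 0 (map snd (x # w)) = map snd (neg2 x # w)"
      by (simp_all add: tau_def neg2_def)
    have neg: "- a \<in> half_idx (2 * (r + 2)) \<longleftrightarrow> a \<in> half_idx (2 * (r + 2))" for a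
      using half_idx_uminus[of a "r + 2"] half_idx_uminus[of "- a" "r + 2"] by auto
    have O: "map fst (neg2 x # w) \<in> \<Omega> \<longleftrightarrow> map fst (x # w) \<in> \<Omega>" "map snd (neg2 x # w) \<in> \<Omega> \<longleftrightarrow> map snd (x # w) \<in> \<Omega>"
      unfolding \<Omega>_def Om_def neg2_def mem_Collect_eq list.map list.set fst_conv snd_conv insert_subset neg by simp_all
    have "0 < m" if "map fst (x # w) \<in> \<Omega>" using that unfolding \<Omega>_def Om_def by auto
    then show ?thesis
      unfolding FF_def O using ent_tau[of "map fst (x # w)" "map snd (x # w)" 0] unfolding t by simp
  qed
  have "FF (u @ x # w) = FF (x # u @ w)" by (rule FF_mset) simp
  also have "\<dots> = FF (neg2 x # u @ w)" by (rule h)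
  also have "\<dots> = FF (u @ neg2 x # w)" by (rule FF_mset) simp
  finally show ?thesis .
qed

lemma FF_nrm: "FF (map nrm zs) = FF zs"
proof -
  have "FF (u @ map nrm zs) = FF (u @ zs)" for u
  proof (induct zs arbitrary: u)
    case (Cons z zs)
    have "FF (u @ map nrm (z # zs)) = FF (u @ nrm z # zs)" using Cons[of "u @ [nrm z]"] by simp
    also have "\<dots> = FF (u @ z # zs)" using FF_neg2[of u z zs] by (simp add: nrm_def)
    finally show ?case .
  qed simp
  from this[of "[]"] show ?thesis by simp
qed

text \<open>After normalizing signs, the pairs whose column letter is the top one are collected at
  the end. The column word then lies in a block, and commutation with its projection forces the row
  word into the same block.\<close>

lemma FF_adm:
  assumes nz: "FF zs \<noteq> 0" and z: "z \<in> set zs"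
  shows "adm r (fst z) (snd z)"
proof -
  let ?t = "hf (int r + 2)" and ?V = "half_idx (2 * (r + 1))"
  define ys where "ys = map nrm zs"
  let ?P = "\<lambda>z. snd z \<noteq> ?t"
  define ys' where "ys' = filter ?P ys @ filter (\<lambda>z. \<not> ?P z) ys"
  define l where "l = length (filter ?P ys)"
  have "mset ys' = mset ys" unfolding ys'_def by (simp add: mset_filter multiset_partition[symmetric])
  then have "FF ys' \<noteq> 0" using nz FF_nrm[of zs] FF_mset unfolding ys_def by metis
  then have O: "map fst ys' \<in> \<Omega>" "map snd ys' \<in> \<Omega>" and e: "ent M (map fst ys') (map snd ys') \<noteq> 0"
    unfolding FF_def by (metis (no_types, lifting))+
  have len: "length ys' = m" using O(1) unfolding \<Omega>_def Om_def by simp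
  have l: "l \<le> m" unfolding len[symmetric] ys'_def l_def by simp
  have tk: "take l ys' = filter ?P ys" "drop l ys' = filter (\<lambda>z. \<not> ?P z) ys"
    unfolding ys'_def l_def by simp_all
  have snd_V: "snd z \<in> ?V" if "z \<in> set (filter ?P ys)" for z
  proof -
    have "z \<in> set ys'" using that unfolding ys'_def by auto
    then have "snd z \<in> half_idx (2 * (r + 2))" using O(2) unfolding \<Omega>_def Om_def by auto
    then obtain x where x: "snd z = hf x" "1 - int (r + 2) \<le> x" "x \<le> int (r + 2)" by (rule half_idxE)
    have "0 < snd z"
    proof -
      have "z \<in> nrm ` set zs" using that unfolding ys_def by simp
      then obtain z' where z': "z = nrm z'" by blast
      have "snd z \<noteq> 0" unfolding x(1) by (rule hf_nonzero)
      then show ?thesis unfolding z' nrm_def neg2_def by (cases "0 < snd z'") auto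
    qed
    then have "1 \<le> x" unfolding x(1) by simp
    moreover have "x \<noteq> int r + 2" using that x(1) by auto
    ultimately show ?thesis unfolding x(1) hf_in_half_idx using x(3) by simp
  qed
  have "map snd ys' \<in> blk r m l"
  proof -
    have "set (take l (map snd ys')) \<subseteq> ?V" unfolding take_map tk using snd_V by auto
    moreover have "drop l (map snd ys') = replicate (m - l) ?t"
    proof (rule replicate_eqI)
      show "length (drop l (map snd ys')) = m - l" using len by simp
      show "y = ?t" if "y \<in> set (drop l (map snd ys'))" for y
        using that unfolding drop_map tk by auto
    qed
    ultimately show ?thesis using O(2) unfolding blk_def \<Omega>_def by blast
  qed
  then have "app M (bas (map snd ys')) = app (Pr r m l) (app M (bas (map snd ys')))"
    using Pr[OF l O(2)] by (simp add: app_Pr)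
  then have "map fst ys' \<in> blk r m l"
    using e lookup_Pr[of r m l "app M (bas (map snd ys'))" "map fst ys'"] unfolding ent_def by (metis (no_types, lifting))
  then have b: "set (take l (map fst ys')) \<subseteq> ?V" "drop l (map fst ys') = replicate (m - l) ?t"
    unfolding blk_def by blast+
  have adm_ys: "adm r (fst y) (snd y)" if y: "y \<in> set ys" for y
  proof (cases "?P y")
    case True
    then have f: "y \<in> set (filter ?P ys)" using y by simp
    then have "fst y \<in> ?V" using b(1) unfolding take_map tk by auto
    then show ?thesis using snd_V[OF f] by (simp add: adm_def)
  next
    case False
    then have "y \<in> set (filter (\<lambda>z. \<not> ?P z) ys)" using y by simp
    then have "fst y \<in> set (drop l (map fst ys'))" unfolding drop_map tk by auto
    then have "fst y = ?t" unfolding b(2) by simp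
    then show ?thesis using False by (simp add: adm_def)
  qed
  have "adm r (fst (nrm z)) (snd (nrm z))" using z by (intro adm_ys) (simp add: ys_def)
  moreover have "adm r a b" if "adm r (- a) (- b)" for a b
    using that half_idx_uminus[of "- a" "r + 1"] half_idx_uminus[of "- b" "r + 1"]
    unfolding adm_def by (simp del: mult_Suc_right add_2_eq_Suc') (metis minus_equation_iff)
  ultimately show ?thesis by (auto simp: nrm_def neg2_def split: if_splits)
qed

lemma FF_zip: "g \<in> \<Omega> \<Longrightarrow> f \<in> \<Omega> \<Longrightarrow> FF (zip g f) = ent M g f"
  by (simp add: FF_def \<Omega>_def Om_def)

text \<open>The entries of \<open>W\<close> are 0 or 1, and a nonzero one at \<open>(g, f)\<close>
  means that the pairs of \<open>g\<close> and \<open>f\<close> are those of \<open>g0\<close> and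
  \<open>f0\<close> up to order and signs, so that \<open>M\<close> has the same value at both
  places.\<close>

lemma ent_W:
  assumes ps: "ps \<in> DL m m" and o: "g0 \<in> \<Omega>" "f0 \<in> \<Omega>" and gf: "g \<in> \<Omega>" "f \<in> \<Omega>"
  shows "ent (W ps (XL (zip g0 f0))) g f \<ge> 0"
    "ent M g f * ent (W ps (XL (zip g0 f0))) g f = ent M g0 f0 * ent (W ps (XL (zip g0 f0))) g f"
proof -
  let ?zs = "zip g0 f0"
  have len: "length g0 = m" "length f0 = m" "length g = m" "length f = m"
    using o gf by (simp_all add: \<Omega>_def Om_def)
  have ps': "distinct ps" "length ps = m" "set ps = {..<m}"
    using ps card_subset_eq[of "{..<m}" "set ps"] by (auto simp: DL_def distinct_card)
  from W_XE_monomial[OF ps'(1), of ?zs f] consider "app (W ps (XL ?zs)) (bas f) = 0"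
    | g' where "app (W ps (XL ?zs)) (bas f) = bas g'" "length g' = length f"
      "\<And>t. t < length ?zs \<Longrightarrow> (g' ! (ps ! t), f ! (ps ! t)) \<in> {?zs ! t, neg2 (?zs ! t)}"
    using len ps' by auto
  then have "ent (W ps (XL ?zs)) g f \<ge> 0 \<and>
    ent M g f * ent (W ps (XL ?zs)) g f = ent M g0 f0 * ent (W ps (XL ?zs)) g f"
  proof cases
    case 1
    then show ?thesis by (simp add: ent_def)
  next
    case (2 g')
    have "ent M g f = ent M g0 f0" if "g' = g"
    proof -
      have nn: "nrm (zip g f ! (ps ! t)) = nrm (?zs ! t)" if t: "t < m" for t
      proof -
        have "(g ! (ps ! t), f ! (ps ! t)) \<in> {?zs ! t, neg2 (?zs ! t)}" using 2(3)[of t] t len \<open>g' = g\<close> by simp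
        moreover have "ps ! t < m" using ps' t by (metis lessThan_iff nth_mem)
        ultimately have mem: "zip g f ! (ps ! t) = ?zs ! t \<or> zip g f ! (ps ! t) = neg2 (?zs ! t)"
          using len by simp
        have "snd (?zs ! t) \<noteq> 0"
        proof -
          have "f0 ! t \<in> half_idx (2 * (r + 2))" using o(2) t len nth_mem[of t f0] unfolding \<Omega>_def Om_def by blast
          then have "f0 ! t \<noteq> 0" by (rule half_idx_nonzero)
          then show ?thesis using t len by simp
        qed
        then have "nrm (neg2 (?zs ! t)) = nrm (?zs ! t)" unfolding nrm_def neg2_def by (simp add: prod_eq_iff)
        with mem show ?thesis by (elim disjE) simp_all
      qed
      have "mset (map nrm (zip g f)) = image_mset (\<lambda>p. nrm (zip g f ! p)) (mset [0..<m])"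
      proof -
        have "map nrm (zip g f) = map (\<lambda>p. nrm (zip g f ! p)) [0..<m]"
          using len by (intro nth_equalityI) auto
        then show ?thesis by simp
      qed
      \<comment> \<open>\<open>ps\<close> lists every position once, so reading the pairs in its
        order only permutes them.\<close>
      also have "mset [0..<m] = mset ps"
        using ps' by (metis atLeast_upt distinct_upt set_eq_iff_mset_eq_distinct)
      also have "image_mset (\<lambda>p. nrm (zip g f ! p)) (mset ps) = mset (map (\<lambda>p. nrm (zip g f ! p)) ps)" by simp
      also have "map (\<lambda>p. nrm (zip g f ! p)) ps = map nrm ?zs"
        using len ps' nn by (intro nth_equalityI) auto
      finally have "FF (map nrm (zip g f)) = FF (map nrm ?zs)" by (rule FF_mset)
      then show ?thesis unfolding FF_nrm FF_zip[OF gf] FF_zip[OF o] .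
    qed
    with 2(1) show ?thesis by (simp add: ent_def lookup_bas)
  qed
  then show "ent (W ps (XL ?zs)) g f \<ge> 0"
    "ent M g f * ent (W ps (XL ?zs)) g f = ent M g0 f0 * ent (W ps (XL ?zs)) g f" by blast+
qed

text \<open>\<open>M\<close> is constant on the support of an orbit sum, so orthogonality says that
  the entry at \<open>(g0, f0)\<close> times a sum of nonnegative weights is 0. By
  \<open>FF_adm\<close> a nonzero entry makes the hypothesis \<open>orth\<close> applicable to its
  own orbit.\<close>

lemma ent_eq_0:
  assumes orth: "\<And>g0 f0. g0 \<in> \<Omega> \<Longrightarrow> f0 \<in> \<Omega> \<Longrightarrow> (\<forall>(a, b)\<in>set (zip g0 f0). adm r a b) \<Longrightarrow>
      (\<Sum>(g, f)\<in>\<Omega> \<times> \<Omega>. ent M g f * ent (SS m (XL (zip g0 f0))) g f) = 0"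
    and o: "g0 \<in> \<Omega>" "f0 \<in> \<Omega>"
  shows "ent M g0 f0 = 0"
proof (rule ccontr)
  assume nz: "ent M g0 f0 \<noteq> 0"
  then have "FF (zip g0 f0) \<noteq> 0" using FF_zip[OF o] by simp
  then have "\<forall>(a, b)\<in>set (zip g0 f0). adm r a b" using FF_adm by fastforce
  from orth[OF o this] have 0: "(\<Sum>(g, f)\<in>\<Omega> \<times> \<Omega>. ent M g f * ent (SS m (XL (zip g0 f0))) g f) = 0" .
  let ?S = "SS m (XL (zip g0 f0))"
  have len: "length g0 = m" "length f0 = m" using o by (simp_all add: \<Omega>_def Om_def)
  have ent_S: "ent ?S g f = (\<Sum>ps\<in>DL m m. ent (W ps (XL (zip g0 f0))) g f)" for g f
    using len by (simp add: SS_def ent_sum XL_def)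
  have 1: "ent M g f * ent ?S g f = ent M g0 f0 * ent ?S g f" "ent ?S g f \<ge> 0" if "g \<in> \<Omega>" "f \<in> \<Omega>" for g f
    unfolding ent_S sum_distrib_left using ent_W[OF _ o that] by (auto intro: sum.cong sum_nonneg)
  have "ent M g0 f0 * (\<Sum>(g, f)\<in>\<Omega> \<times> \<Omega>. ent ?S g f) = (\<Sum>(g, f)\<in>\<Omega> \<times> \<Omega>. ent M g f * ent ?S g f)"
    unfolding sum_distrib_left
  proof (intro sum.cong refl, clarify)
    fix g f assume "g \<in> \<Omega>" "f \<in> \<Omega>"
    from 1(1)[OF this] show "ent M g0 f0 * ent ?S g f = ent M g f * ent ?S g f" by (rule sym)
  qed
  then have "ent M g0 f0 * (\<Sum>(g, f)\<in>\<Omega> \<times> \<Omega>. ent ?S g f) = 0"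
    using 0 by simp
  then have "(\<Sum>(g, f)\<in>\<Omega> \<times> \<Omega>. ent ?S g f) = 0" using nz by simp
  moreover have fin: "finite (\<Omega> \<times> \<Omega>)" unfolding \<Omega>_def by (intro finite_cartesian_product finite_Om)
  ultimately have "ent ?S g0 f0 = 0"
    using sum_nonneg_eq_0_iff[OF fin, of "\<lambda>(g, f). ent ?S g f"] 1(2) o by fastforce
  \<comment> \<open>The placement in the natural order alone contributes 1 to this weight.\<close>
  moreover have "ent ?S g0 f0 \<ge> ent (W [0..<m] (XL (zip g0 f0))) g0 f0"
    unfolding ent_S using ent_W(1)[OF _ o o]
    by (intro member_le_sum) (auto simp: DL_def finite_DL[unfolded DL_def])
  moreover have "app (W [0..<m] (XL (zip g0 f0))) (bas f0) = bas g0"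
  proof -
    have "XL (zip g0 f0) = map (\<lambda>p. XE (g0 ! p) (f0 ! p)) [0..<m]"
      using len by (intro nth_equalityI) (auto simp: XL_def)
    moreover have "map (\<lambda>p. if p \<in> set [0..<m] then g0 ! p else f0 ! p) [0..<length f0] = g0"
      using len by (intro nth_equalityI) auto
    ultimately show ?thesis
      using W_XE_self[of "[0..<m]" f0 g0] len by (auto simp: lessThan_atLeast0)
  qed
  ultimately show False by (simp add: ent_def lookup_bas)
qed

end

subsection \<open>The double centralizer property\<close>

text \<open>The Gram-Schmidt step for a form without isotropic vectors: the new direction
  \<open>b'\<close> has a nonzero square unless it vanishes on \<open>I\<close>, so its component
  can be removed by division.\<close>

lemma orthogonal_complement:
  fixes v :: "'j \<Rightarrow> 'i \<Rightarrow> 'k::field"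
  assumes aniso: "\<And>x :: 'i \<Rightarrow> 'k. (\<Sum>i\<in>I. x i * x i) = 0 \<Longrightarrow> (\<forall>i\<in>I. x i = 0)" and J: "finite J"
  shows "\<exists>c. \<forall>j\<in>J. (\<Sum>i\<in>I. (a i - (\<Sum>k\<in>J. c k * v k i)) * v j i) = 0"
  using J
proof (induct J arbitrary: a)
  case (insert j J)
  define ip where "ip x y = (\<Sum>i\<in>I. x i * y i)" for x y :: "'i \<Rightarrow> 'k"
  have ip_lin: "ip x (\<lambda>i. y i + z i) = ip x y + ip x z" "ip (\<lambda>i. x i - t * y i) z = ip x z - t * ip y z" for x y z t
    by (simp_all add: ip_def sum.distrib sum_subtractf sum_distrib_left algebra_simps)
  have ip_sum: "ip x (\<lambda>i. \<Sum>k\<in>J. c k * v k i) = (\<Sum>k\<in>J. c k * ip x (v k))" for x c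
    unfolding ip_def sum_distrib_left by (subst sum.swap) (simp add: mult_ac)
  obtain c1 where c1: "\<And>k. k \<in> J \<Longrightarrow> ip (\<lambda>i. v j i - (\<Sum>k\<in>J. c1 k * v k i)) (v k) = 0"
    using insert(3)[of "v j"] unfolding ip_def by blast
  obtain c2 where c2: "\<And>k. k \<in> J \<Longrightarrow> ip (\<lambda>i. a i - (\<Sum>k\<in>J. c2 k * v k i)) (v k) = 0"
    using insert(3)[of a] unfolding ip_def by blast
  define b' where "b' i = v j i - (\<Sum>k\<in>J. c1 k * v k i)" for i
  define a' where "a' i = a i - (\<Sum>k\<in>J. c2 k * v k i)" for i
  define t where "t = ip a' b' / ip b' b'"
  have ab: "ip (\<lambda>i. a' i - t * b' i) b' = 0"
  proof (cases "ip b' b' = 0")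
    \<comment> \<open>A vanishing square forces \<open>b'\<close> to be 0 on \<open>I\<close>, so
      the claim holds whatever \<open>t\<close> is.\<close>
    case True
    then have "\<forall>i\<in>I. b' i = 0" using aniso[of b'] by (simp add: ip_def)
    then show ?thesis by (simp add: ip_def)
  next
    case False
    then show ?thesis unfolding ip_lin by (simp add: t_def)
  qed
  have aJ: "ip (\<lambda>i. a' i - t * b' i) (v k) = 0" if "k \<in> J" for k
    unfolding ip_lin using c1[OF that] c2[OF that] unfolding a'_def b'_def by simp
  have "v j = (\<lambda>i. b' i + (\<Sum>k\<in>J. c1 k * v k i))" by (simp add: b'_def fun_eq_iff)
  then have aj: "ip (\<lambda>i. a' i - t * b' i) (v j) = 0"
    using ip_lin(1)[of "\<lambda>i. a' i - t * b' i" b' "\<lambda>i. \<Sum>k\<in>J. c1 k * v k i"]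
      ip_sum[of "\<lambda>i. a' i - t * b' i" c1] ab aJ by simp
  define c where "c k = (if k = j then t else c2 k - t * c1 k)" for k
  have "a i - (\<Sum>k\<in>insert j J. c k * v k i) = a' i - t * b' i" for i
  proof -
    have "(\<Sum>k\<in>J. c k * v k i) = (\<Sum>k\<in>J. c2 k * v k i) - t * (\<Sum>k\<in>J. c1 k * v k i)"
      unfolding sum_distrib_left sum_subtractf [symmetric]
      using insert(2) by (intro sum.cong refl) (auto simp: c_def algebra_simps)
    then show ?thesis
      using insert(1,2) by (simp add: a'_def b'_def c_def algebra_simps)
  qed
  then have "\<forall>k\<in>insert j J. (\<Sum>i\<in>I. (a i - (\<Sum>k\<in>insert j J. c k * v k i)) * v k i) = 0"
    using aj aJ unfolding ip_def by simp
  then show ?case by blast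
qed simp

lemma specM_hop:
  fixes q :: "'k::field_char_0"
  assumes q: "q \<noteq> 0" and i: "i < m"
  shows "specM q (Om (2 * s) m) (hop q (2 * s) m i) (hop 1 (2 * s) m i)"
  unfolding specM_def
proof (intro conjI hop_pres[OF i] ballI allI)
  fix f g assume f: "f \<in> Om (2 * s) m"
  have s2: "spec q (inverse q - q) 0"
    using spec_diff[OF spec_inverse_q[OF q] spec_q] by simp
  then have s3: "spec q (1 + (inverse q - q)) 1"
    using spec_add[OF spec_1 s2] by simp
  note S = s2 s3 spec_0[of q] spec_1[of q] spec_inverse_q[OF q]
  have "\<exists>c1 c2 d1 d2. app (hop q (2 * s) m i) (bas f) = cst c1 * bas (tau i f) + cst c2 * bas f \<and>
      app (hop 1 (2 * s) m i) (bas f) = cst d1 * bas (tau i f) + cst d2 * bas f \<and> spec q c1 d1 \<and> spec q c2 d2"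
  proof (cases i)
    case 0
    have "app (hop p (2 * s) m i) (bas f) = cst 1 * bas (tau i f) + cst (if f ! 0 > 0 then 0 else inverse p - p) * bas f"
      for p :: "'p::field"
      using f by (simp add: app_hop hecke_op_basis_def tau_def 0 Let_def)
    note e = this[of q] this[of "1::rat"]
    show ?thesis
      by (rule exI, rule exI, rule exI, rule exI, rule conjI[OF e(1)], rule conjI[OF e(2)]) (use S in auto)
  next
    case (Suc j)
    \<comment> \<open>One formula serves both \<open>q\<close> and the rational number 1. For equal
      letters \<open>tau\<close> fixes the word, and the coefficient \<open>q^-1\<close> is attached
      to that term.\<close>
    have "app (hop p (2 * s) m i) (bas f) = cst (if f ! j = f ! i then inverse p else 1) * bas (tau i f)
        + cst (if f ! i < f ! j then inverse p - p else 0) * bas f"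
      for p :: "'p::field"
    proof (cases "f ! j = f ! i")
      case True
      then have "tau i f = f" by (simp add: tau_def Suc) (metis list_update_id)
      then show ?thesis using f True by (simp add: app_hop hecke_op_basis_def Suc Let_def)
    next
      case False
      then show ?thesis using f by (auto simp: app_hop hecke_op_basis_def tau_def Suc Let_def)
    qed
    note e = this[of q] this[of "1::rat"]
    show ?thesis
      by (rule exI, rule exI, rule exI, rule exI, rule conjI[OF e(1)], rule conjI[OF e(2)]) (use S in auto)
  qed
  then obtain c1 c2 d1 d2 where *: "app (hop q (2 * s) m i) (bas f) = cst c1 * bas (tau i f) + cst c2 * bas f"
    "app (hop 1 (2 * s) m i) (bas f) = cst d1 * bas (tau i f) + cst d2 * bas f" "spec q c1 d1" "spec q c2 d2" by blast
  then show "spec q (ent (hop q (2 * s) m i) g f) (ent (hop 1 (2 * s) m i) g f)"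
    using spec_add[OF *(3,4)] by (simp add: ent_def lookup_add lookup_bas spec_0)
qed

lemma specM_ent: "specM q S A M \<Longrightarrow> f \<in> S \<Longrightarrow> spec q (ent A g f) (ent M g f)"
  by (simp add: specM_def)

lemma specM_Pr: "specM q (Om (2 * (r + 2)) m) (Pr r m l) (Pr r m l)"
proof -
  have "pres (Om (2 * (r + 2)) m) (Pr r m l)"
    by (auto simp: pres_def app_Pr intro: sp_closed)
  then show ?thesis
    unfolding specM_def by (auto simp: ent_def app_Pr lookup_bas spec_0 spec_1 pres_def intro: sp_closed)
qed

lemma commutant_levi:
  fixes q :: "'k::field_char_0"
  assumes q: "\<not> algebraic q" and rat: "\<And>y::'k. \<exists>a b. evq q b \<noteq> 0 \<and> y = evq q a / evq q b"
    and q': "q \<noteq> 0" "q \<noteq> 1" "q \<noteq> inverse q" and m: "0 < m" and A: "A \<in> commutant q r m"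
  obtains p where "p \<in> subalg (levi_gens q r)"
    "\<And>v. v \<in> sp (Om (2 * (r + 2)) m) \<Longrightarrow> app A v = app (evl (wordL (fam q m)) p) v"
proof -
  let ?N = "2 * (r + 2)"
  define \<Omega> where "\<Omega> = Om ?N m"
  have fin: "finite \<Omega>" "finite (\<Omega> \<times> \<Omega>)" unfolding \<Omega>_def by (simp_all add: finite_Om)
  have N: "2 * r + 4 = ?N" by simp
  \<comment> \<open>The index pairs whose orbit sums are symmetrized tensors with all factors in
    \<open>Adm r\<close>.\<close>
  define Prs where "Prs = {(g, f) \<in> \<Omega> \<times> \<Omega>. \<forall>(a, b)\<in>set (zip g f). adm r a b}"
  have finO: "finite Prs" unfolding Prs_def by (rule finite_subset[OF _ fin(2)]) auto
  have "\<exists>p\<in>subalg (levi_gens q r). specM q \<Omega> (evl (wordL (fam q m)) p) (SS m (XL (zip (fst w) (snd w))))"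
    if "w \<in> Prs" for w
  proof -
    have "set (XL (zip (fst w) (snd w))) \<subseteq> Adm r"
    proof
      fix x assume "x \<in> set (XL (zip (fst w) (snd w)))"
      then obtain a b where "(a, b) \<in> set (zip (fst w) (snd w))" "x = XE a b" by (auto simp: XL_def)
      moreover have "\<forall>(a, b)\<in>set (zip (fst w) (snd w)). adm r a b" using that by (auto simp: Prs_def)
      ultimately show "x \<in> Adm r" unfolding Adm_def by blast
    qed
    from A1_SS[OF q'(1,2) this, of m] show ?thesis unfolding A1_def \<Omega>_def by blast
  qed
  then have "\<forall>w\<in>Prs. \<exists>p. p \<in> subalg (levi_gens q r) \<and>
      specM q \<Omega> (evl (wordL (fam q m)) p) (SS m (XL (zip (fst w) (snd w))))" by blast
  from bchoice[OF this] obtain P where P: "\<And>w. w \<in> Prs \<Longrightarrow> P w \<in> subalg (levi_gens q r)"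
    "\<And>w. w \<in> Prs \<Longrightarrow> specM q \<Omega> (evl (wordL (fam q m)) (P w)) (SS m (XL (zip (fst w) (snd w))))" by blast
  let ?B = "\<lambda>w. evl (wordL (fam q m)) (P w)"
  \<comment> \<open>An isotropic vector, rescaled to be regular and nonzero at \<open>q = 1\<close>,
    would give rational numbers, not all 0, whose squares sum to 0.\<close>
  have aniso: "\<forall>i\<in>\<Omega> \<times> \<Omega>. x i = 0" if "(\<Sum>i\<in>\<Omega> \<times> \<Omega>. x i * x i) = 0" for x :: "rat list \<times> rat list \<Rightarrow> 'k"
  proof (rule ccontr)
    assume "\<not> (\<forall>i\<in>\<Omega> \<times> \<Omega>. x i = 0)"
    then have "\<exists>i\<in>\<Omega> \<times> \<Omega>. x i \<noteq> 0" by blast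
    from ex_spec_scaled[OF q rat fin(2) this] obtain e c where ec: "e \<noteq> 0"
      "\<And>i. i \<in> \<Omega> \<times> \<Omega> \<Longrightarrow> spec q (e * x i) (c i)" "\<exists>i\<in>\<Omega> \<times> \<Omega>. c i \<noteq> 0" by blast
    have "spec q (\<Sum>i\<in>\<Omega> \<times> \<Omega>. (e * x i) * (e * x i)) (\<Sum>i\<in>\<Omega> \<times> \<Omega>. c i * c i)"
      by (intro spec_sum spec_mult ec(2))
    moreover have "(\<Sum>i\<in>\<Omega> \<times> \<Omega>. (e * x i) * (e * x i)) = (e * e) * (\<Sum>i\<in>\<Omega> \<times> \<Omega>. x i * x i)"
      by (simp add: sum_distrib_left mult_ac)
    ultimately have "spec q 0 (\<Sum>i\<in>\<Omega> \<times> \<Omega>. c i * c i)" using that by simp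
    then have "(\<Sum>i\<in>\<Omega> \<times> \<Omega>. c i * c i) = 0" using spec_unique[OF q _ spec_0] by blast
    then have "\<forall>i\<in>\<Omega> \<times> \<Omega>. c i * c i = 0" by (subst (asm) sum_nonneg_eq_0_iff[OF fin(2)]) auto
    with ec(3) show False by auto
  qed
  obtain c where c: "\<And>w. w \<in> Prs \<Longrightarrow> (\<Sum>i\<in>\<Omega> \<times> \<Omega>. (ent A (fst i) (snd i) -
      (\<Sum>k\<in>Prs. c k * ent (?B k) (fst i) (snd i))) * ent (?B w) (fst i) (snd i)) = 0"
    using orthogonal_complement[OF aniso finO, of "\<lambda>i. ent A (fst i) (snd i)" "\<lambda>w i. ent (?B w) (fst i) (snd i)"]
    by blast
  define p where "p = (\<Sum>k\<in>Prs. cst (c k) * P k)"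
  have p: "p \<in> subalg (levi_gens q r)"
  proof -
    have "(\<Sum>k\<in>X. cst (c k) * P k) \<in> subalg (levi_gens q r)" if "finite X" "X \<subseteq> Prs" for X
      using that
    proof induct
      case empty
      then show ?case using subalg.cst[of 0] by simp
    next
      case (insert k X)
      then show ?case using P(1)[of k] by (auto intro!: subalg.add subalg.mult subalg.cst)
    qed
    then show ?thesis unfolding p_def using finO by blast
  qed
  have evp: "evl (wordL (fam q m)) p = (\<Sum>k\<in>Prs. sc (c k) * ?B k)"
  proof -
    have "evl (wordL (fam q m)) (\<Sum>k\<in>X. cst (c k) * P k) = (\<Sum>k\<in>X. sc (c k) * ?B k)" if "finite X" for X
      using that by induct (simp_all add: evl_add)
    then show ?thesis unfolding p_def using finO by blast
  qed
  define D where "D = A - evl (wordL (fam q m)) p"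
  have DC: "D \<in> commutant q r m"
    unfolding D_def by (intro commutant_closed A levi_commutant[OF q'(1,3) m p])
  have presD: "pres \<Omega> D" using DC unfolding commutant_def N \<Omega>_def by blast
  have entD: "ent D g f = ent A g f - (\<Sum>k\<in>Prs. c k * ent (?B k) g f)" for g f
    unfolding D_def evp ent_diff ent_sum ent_sc_mult ..
  have orthD: "(\<Sum>i\<in>\<Omega> \<times> \<Omega>. ent D (fst i) (snd i) * ent (?B w) (fst i) (snd i)) = 0" if "w \<in> Prs" for w
    unfolding entD by (rule c[OF that])
  have zero: "ent D g f = 0" if "g \<in> \<Omega>" "f \<in> \<Omega>" for g f
  proof (rule ccontr)
    assume "ent D g f \<noteq> 0"
    then have "\<exists>i\<in>\<Omega> \<times> \<Omega>. ent D (fst i) (snd i) \<noteq> 0" using that by (intro bexI[of _ "(g, f)"]) auto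
    from ex_spec_scaled[OF q rat fin(2) this] obtain e d where ed: "e \<noteq> 0"
      "\<And>i. i \<in> \<Omega> \<times> \<Omega> \<Longrightarrow> spec q (e * ent D (fst i) (snd i)) (d i)" "\<exists>i\<in>\<Omega> \<times> \<Omega>. d i \<noteq> 0" by blast
    \<comment> \<open>The values \<open>d\<close> at \<open>q = 1\<close> are assembled into an
      operator over the rationals.\<close>
    define M where "M = Lin (\<lambda>f. if f \<in> \<Omega> then (\<Sum>g\<in>\<Omega>. cst (d (g, f)) * bas g) else 0 :: rat list \<Rightarrow>\<^sub>0 rat)"
    have entM: "ent M g f = (if g \<in> \<Omega> then d (g, f) else 0)" if "f \<in> \<Omega>" for g f
      using that fin(1) by (simp add: ent_def M_def lookup_sum lookup_bas if_distrib cong: if_cong)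
    have presM: "pres \<Omega> M" unfolding pres_def M_def by (auto intro!: sp_sum sp_scale sp_bas)
    have sM: "specM q \<Omega> (sc e * D) M"
      unfolding specM_def
    proof (intro conjI ballI allI presM pres_closed presD)
      fix f g assume f: "f \<in> \<Omega>"
      show "spec q (ent (sc e * D) g f) (ent M g f)"
      proof (cases "g \<in> \<Omega>")
        case True
        then have "(g, f) \<in> \<Omega> \<times> \<Omega>" using f by blast
        from ed(2)[OF this] show ?thesis using True unfolding entM[OF f] ent_sc_mult by simp
      next
        case False
        have "app D (bas f) \<in> sp \<Omega>" using presD f by (simp add: pres_def)
        then have "ent D g f = 0" using False by (auto simp: ent_def sp_def in_keys_iff)
        then show ?thesis using False f by (simp add: entM ent_sc_mult spec_0)
      qed
    qed
    \<comment> \<open>Commutation passes to \<open>q = 1\<close> because products specialize and a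
      value at 1 is unique.\<close>
    have transfer: "app (M * C') (bas f) = app (C' * M) (bas f)"
      if C: "specM q \<Omega> C C'" and DCf: "app D (app C (bas f)) = app C (app D (bas f))" and f: "f \<in> \<Omega>" for C C' f
    proof (rule poly_mapping_eqI)
      fix g
      have eq: "ent (sc e * D * C) g f = ent (C * (sc e * D)) g f"
        using DCf by (simp add: ent_def app_scale)
      have "spec q (ent (sc e * D * C) g f) (ent (M * C') g f)"
        by (rule specM_ent[OF specM_mult[OF fin(1) sM C] f])
      from spec_unique[OF q this[unfolded eq] specM_ent[OF specM_mult[OF fin(1) C sM] f]]
      have "ent (M * C') g f = ent (C' * M) g f" .
      then show "Poly_Mapping.lookup (app (M * C') (bas f)) g = Poly_Mapping.lookup (app (C' * M) (bas f)) g"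
        by (simp only: ent_def)
    qed
    have Dcom: "app D (app (hop q ?N m i) v) = app (hop q ?N m i) (app D v)" if "i < m" "v \<in> sp \<Omega>" for i v
      using DC that unfolding commutant_def N \<Omega>_def by simp
    have DPr: "app D (app (Pr r m l) v) = app (Pr r m l) (app D v)" if "l \<le> m" "v \<in> sp \<Omega>" for l v
      using DC that unfolding commutant_def N \<Omega>_def by simp
    have "ent M g f = 0" if gf: "g \<in> \<Omega>" "f \<in> \<Omega>" for g f
    proof (rule ent_eq_0[of r m M, folded \<Omega>_def, OF presM _ _ _ gf])
      show "app (M * hop 1 ?N m i) (bas f) = app (hop 1 ?N m i * M) (bas f)" if "i < m" "f \<in> \<Omega>" for i f
        using that by (intro transfer[OF specM_hop[OF q'(1) that(1), of "r + 2", folded \<Omega>_def]] Dcom sp_bas)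
      show "app (M * Pr r m l) (bas f) = app (Pr r m l * M) (bas f)" if "l \<le> m" "f \<in> \<Omega>" for l f
        using that by (intro transfer[OF specM_Pr[of q r m l, folded \<Omega>_def]] DPr sp_bas)
      show "(\<Sum>(g, f)\<in>\<Omega> \<times> \<Omega>. ent M g f * ent (SS m (XL (zip g0 f0))) g f) = 0"
        if "g0 \<in> \<Omega>" "f0 \<in> \<Omega>" "\<forall>(a, b)\<in>set (zip g0 f0). adm r a b" for g0 f0
      proof -
        have w: "(g0, f0) \<in> Prs" using that by (simp add: Prs_def)
        have "spec q (\<Sum>i\<in>\<Omega> \<times> \<Omega>. ent (sc e * D) (fst i) (snd i) * ent (?B (g0, f0)) (fst i) (snd i))
          (\<Sum>i\<in>\<Omega> \<times> \<Omega>. ent M (fst i) (snd i) * ent (SS m (XL (zip g0 f0))) (fst i) (snd i))"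
          by (intro spec_sum spec_mult specM_ent[OF sM] specM_ent[OF P(2)[OF w, unfolded fst_conv snd_conv]]) (simp_all only: mem_Times_iff)
        moreover have "(\<Sum>i\<in>\<Omega> \<times> \<Omega>. ent (sc e * D) (fst i) (snd i) * ent (?B (g0, f0)) (fst i) (snd i)) = 0"
          using orthD[OF w] by (simp add: ent_sc_mult mult.assoc sum_distrib_left [symmetric])
        ultimately have "spec q 0 (\<Sum>i\<in>\<Omega> \<times> \<Omega>. ent M (fst i) (snd i) * ent (SS m (XL (zip g0 f0))) (fst i) (snd i))"
          by (simp only:)
        from spec_unique[OF q this spec_0] show ?thesis by (simp only: case_prod_unfold)
      qed
    qed
    then have "d (g, f) = 0" if "g \<in> \<Omega>" "f \<in> \<Omega>" for g f
      using entM[of f g] that by (simp only: if_True)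
    with ed(3) show False by (metis mem_Times_iff prod.collapse)
  qed
  have "app D v = 0" if "v \<in> sp \<Omega>" for v
  proof -
    have Db: "app D (bas f) = 0" if f: "f \<in> \<Omega>" for f
    proof (rule poly_mapping_eqI)
      fix g
      have "app D (bas f) \<in> sp \<Omega>" using presD f by (simp add: pres_def)
      then show "Poly_Mapping.lookup (app D (bas f)) g = Poly_Mapping.lookup 0 g"
        using zero[of g f] f by (cases "g \<in> \<Omega>") (auto simp: ent_def sp_def in_keys_iff)
    qed
    have "app D v = app 0 v" by (rule app_eq_on[OF _ that]) (simp only: Db app_zero_lop)
    then show ?thesis by simp
  qed
  then have "app A v = app (evl (wordL (fam q m)) p) v" if "v \<in> sp (Om ?N m)" for v
    using that unfolding \<Omega>_def D_def by simp
  then show thesis by (rule that[OF p])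
qed

theorem theorem3p6:
  fixes q :: "'k::field_char_0" and r m :: nat
  assumes "\<not> algebraic q"
    and "\<forall>x::'k. \<exists>a b :: rat poly. poly (map_poly of_rat b) q \<noteq> 0 \<and>
           x = poly (map_poly of_rat a) q / poly (map_poly of_rat b) q"
    and "r \<ge> 1" and "m \<ge> 2"
  shows "Phi q r m ` levi_iquantum_group q r = End_duplex_hecke q r m"
proof -
  note q = assms(1)
  have rat: "\<exists>a b. evq q b \<noteq> 0 \<and> y = evq q a / evq q b" for y :: 'k
    using assms(2) unfolding evq_def by blast
  have m: "0 < m" "1 \<le> m" using assms(4) by auto
  \<comment> \<open>Transcendence is applied to \<open>X\<close>, \<open>X - 1\<close> and
    \<open>X^2 - 1\<close>; the last one yields \<open>q \<noteq> inverse q\<close>.\<close>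
  have nz: "evq q a \<noteq> 0" if "a \<noteq> 0" for a using that evq_eq_0_iff[OF q] by blast
  have q0: "q \<noteq> 0" using nz[of "[:0, 1:]"] by (simp add: evq_pCons)
  have q1: "q \<noteq> 1" using nz[of "[:- 1, 1:]"] by (auto simp: evq_pCons)
  have "q * q \<noteq> 1" using nz[of "[:- 1, 0, 1:]"] by (auto simp: evq_pCons)
  then have qi: "q \<noteq> inverse q" using q0 by (metis right_inverse)
  let ?W = "tensor_space (2 * r + 4) m :: (rat list \<Rightarrow>\<^sub>0 'k) set"
  let ?E = "\<lambda>p. restrict (app (evl (wordL (fam q m)) p)) ?W"
  have N: "2 * r + 4 = 2 * (r + 2)" by simp
  have W: "?W = sp (Om (2 * (r + 2)) m)" unfolding N by (rule tensor_space_sp)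
  have "levi_iquantum_group q r = cls (uq_gens r) (uq_rels q r) ` subalg (levi_gens q r)"
    unfolding levi_iquantum_group_def levi_gens_def [symmetric]
    by (rule generated_subalgebra_eq[OF uq_rels_closed levi_gens_closed])
  then have "Phi q r m ` levi_iquantum_group q r = ?E ` subalg (levi_gens q r)"
    unfolding image_image
    by (simp only: image_image) (intro image_cong refl Phi_cls[OF q0 qi m(2)] subalg_closed[OF _ levi_gens_closed])
  also have "\<dots> = (\<lambda>A. restrict (app A) ?W) ` commutant q r m"
  proof (intro equalityI subsetI)
    fix x assume "x \<in> ?E ` subalg (levi_gens q r)"
    then show "x \<in> (\<lambda>A. restrict (app A) ?W) ` commutant q r m"
      using levi_commutant[OF q0 qi m(1)] by blast
  next
    fix x assume "x \<in> (\<lambda>A. restrict (app A) ?W) ` commutant q r m"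
    then obtain A where A: "A \<in> commutant q r m" "x = restrict (app A) ?W" by blast
    from commutant_levi[OF q rat q0 q1 qi m(1) A(1)] obtain p where
      p: "p \<in> subalg (levi_gens q r)" "\<And>v. v \<in> ?W \<Longrightarrow> app A v = app (evl (wordL (fam q m)) p) v"
      unfolding W by blast
    have "x = ?E p" unfolding A(2) using p(2) by (rule restrict_ext)
    with p(1) show "x \<in> ?E ` subalg (levi_gens q r)" by blast
  qed
  also have "\<dots> = End_duplex_hecke q r m"
    by (rule End_duplex_hecke_eq[OF q0, symmetric])
  finally show ?thesis .
qed

end
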